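(* Let $s>0$ and let $u_0\in E_s$. Then there exist an $\varepsilon>0$ and a unique solution $u$ of the Cauchy problem $$u_t=4uu_x+G\star\big[\partial_x(2u_x^2+6u^2)+\partial_x^2(u_x^2)\big],\qquad u(0,x)=u_0(x),$$ that is analytic (in both variables $(t,x)$) on $(-\varepsilon,\varepsilon)\times\mathbb{R}$.
   Context: All functions of $x$ are defined on $\mathbb{R}$. $G(x)=\frac12 e^{-|x|}$ and $\star$ denotes convolution in $x$, so that $G\star f=(1-\partial_x^2)^{-1}f$ for $f\in L^2(\mathbb{R})$. The Cauchy problem is an equivalent form of the generalized Camassa-Holm equation $u_t-u_{txx}=\partial_x(2+\partial_x)[(2-\partial_x)u]^2$, $u(0,x)=u_0(x)$; here $u_x=\partial_x u$, etc. For $s>0$, the space $E_s$ is $$E_s=\Big\{u\in C^\infty(\mathbb{R}):\ \|u\|_s=\sup_{k\in\mathbb{N}}\frac{s^k\|\partial_x^k u\|_{H^1(\mathbb{R})}}{k!/(k+1)^2}<\infty\Big\},$$ where $\mathbb{N}=\{0,1,2,\dots\}$. *)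

theory Defs
  imports "HOL-Analysis.Analysis"
begin

definition kernel_G :: "real \<Rightarrow> real" where
  "kernel_G x = exp (- \<bar>x\<bar>) / 2"

definition convolution :: "(real \<Rightarrow> real) \<Rightarrow> (real \<Rightarrow> real) \<Rightarrow> real \<Rightarrow> real"  (infixl "\<star>" 75) where
  "(g \<star> f) x = (\<integral>y. g (x - y) * f y \<partial>lborel)"

definition square_integrable :: "(real \<Rightarrow> real) \<Rightarrow> bool" where
  "square_integrable f \<longleftrightarrow> f \<in> borel_measurable lborel \<and> integrable lborel (\<lambda>x. (f x)\<^sup>2)"

text \<open>
  Membership in the Sobolev space \<open>H\<^sup>m(\<real>)\<close> for functions possessing classical derivatives up to
  order \<open>m\<close>.  A classical derivative that exists everywhere and is square integrable is
  also the weak derivative, so for such functions this is the usual notion; it is only ever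
  applied to smooth functions.
\<close>

definition sobolev :: "nat \<Rightarrow> (real \<Rightarrow> real) \<Rightarrow> bool" where
  "sobolev m f \<longleftrightarrow>
     (\<forall>j<m. \<forall>x. (deriv ^^ j) f differentiable at x) \<and>
     (\<forall>j\<le>m. square_integrable ((deriv ^^ j) f))"

definition sobolev_norm :: "nat \<Rightarrow> (real \<Rightarrow> real) \<Rightarrow> real" where
  "sobolev_norm m f = sqrt (\<Sum>j\<le>m. \<integral>x. ((deriv ^^ j) f x)\<^sup>2 \<partial>lborel)"

definition smooth :: "(real \<Rightarrow> real) \<Rightarrow> bool" where
  "smooth f \<longleftrightarrow> (\<forall>k x. (deriv ^^ k) f differentiable at x)"

text \<open>
  Finiteness of the supremum over \<open>k\<close> is spelled out as finiteness of each \<open>H\<^sup>1\<close> norm together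
  with boundedness of the sequence of (real) weighted norms.
\<close>

definition E_space :: "real \<Rightarrow> (real \<Rightarrow> real) set" where
  "E_space s = {u. smooth u \<and> (\<forall>k. sobolev 1 ((deriv ^^ k) u)) \<and>
     bdd_above (range (\<lambda>k::nat.
       s ^ k * sobolev_norm 1 ((deriv ^^ k) u) / (fact k / (real k + 1)\<^sup>2)))}"

text \<open>Joint real analyticity: local expansion into an (absolutely convergent) double power series.\<close>

definition real_analytic2_on :: "(real \<Rightarrow> real \<Rightarrow> real) \<Rightarrow> (real \<times> real) set \<Rightarrow> bool" where
  "real_analytic2_on u S \<longleftrightarrow>
     (\<forall>(t0, x0) \<in> S. \<exists>r>0. \<exists>a :: nat \<Rightarrow> nat \<Rightarrow> real. \<forall>t x.
        \<bar>t - t0\<bar> < r \<longrightarrow> \<bar>x - x0\<bar> < r \<longrightarrow>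
        ((\<lambda>(i, j). a i j * (t - t0) ^ i * (x - x0) ^ j) has_sum u t x) UNIV)"

text \<open>
  The function to which \<open>(1 - \<partial>\<^sub>x\<^sup>2)\<^sup>-\<^sup>1 = G \<star>\<close> is applied, for a fixed time.
\<close>

definition nonlocal_source :: "(real \<Rightarrow> real) \<Rightarrow> real \<Rightarrow> real" where
  "nonlocal_source w y =
     deriv (\<lambda>z. 2 * (deriv w z)\<^sup>2 + 6 * (w z)\<^sup>2) y + (deriv ^^ 2) (\<lambda>z. (deriv w z)\<^sup>2) y"

text \<open>
  A solution of the evolution equation on \<open>(-\<epsilon>, \<epsilon>)\<close> is a continuous curve \<open>t \<mapsto> u(t, \<cdot>)\<close> in
  \<open>H\<^sup>3(\<real>)\<close> satisfying the equation at every point.  The order 3 is the number of \<open>x\<close>-derivatives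
  in the source term; it guarantees that this term belongs to \<open>L\<^sup>2(\<real>)\<close>, where the convolution
  with \<open>G\<close> is the operator \<open>(1 - \<partial>\<^sub>x\<^sup>2)\<^sup>-\<^sup>1\<close>.
\<close>

definition cauchy_solution ::
    "real \<Rightarrow> (real \<Rightarrow> real) \<Rightarrow> (real \<Rightarrow> real \<Rightarrow> real) \<Rightarrow> bool" where
  "cauchy_solution \<epsilon> u0 u \<longleftrightarrow>
     (\<forall>t\<in>{-\<epsilon><..<\<epsilon>}. sobolev 3 (u t)) \<and>
     (\<forall>t\<in>{-\<epsilon><..<\<epsilon>}. ((\<lambda>\<tau>. sobolev_norm 3 (\<lambda>x. u \<tau> x - u t x)) \<longlongrightarrow> 0) (at t)) \<and>
     (\<forall>t\<in>{-\<epsilon><..<\<epsilon>}. \<forall>x.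
        ((\<lambda>\<tau>. u \<tau> x) has_real_derivative
           4 * u t x * deriv (u t) x + (kernel_G \<star> nonlocal_source (u t)) x) (at t)) \<and>
     (\<forall>x. u 0 x = u0 x)"

end

theory Submission
  imports Defs
begin

text \<open>
  Integration by parts moves all derivatives in the nonlocal term onto the kernel: with
  \<open>D = G'\<close> one has \<open>G \<star> f' = D \<star> f\<close> and \<open>D \<star> f' = G \<star> f - f\<close>, so that the equation reads
  \<open>u\<^sub>t = 4 u u\<^sub>x - u\<^sub>x\<^sup>2 + D \<star> (2 u\<^sub>x\<^sup>2 + 6 u\<^sup>2) + G \<star> u\<^sub>x\<^sup>2\<close>, with only first derivatives of \<open>u\<close>.

  Uniqueness holds for all \<open>H\<^sup>3\<close> solutions by a maximum principle: where \<open>exp (- K t) \<bar>w\<bar>\<close>, for the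
  difference \<open>w\<close> of two solutions, is maximal in space-time, \<open>w\<^sub>x\<close> vanishes, and the nonlocal terms
  are bounded by \<open>sup \<bar>w\<bar>\<close> because \<open>b w\<^sub>x = (b w)\<^sub>x - b\<^sub>x w\<close>.

  Existence is a Cauchy-Kovalevskaya argument with pointwise majorants. The bounds defining
  \<open>E\<^sub>s\<close> give one square integrable weight \<open>W \<le> 1\<close> with \<open>\<bar>\<partial>\<^sub>x\<^sup>j u\<^sub>0\<bar> \<le> C j! s\<^sup>-\<^sup>j W\<close> and \<open>G \<star> W \<le> 2 W\<close>, so
  bounds by multiples of \<open>W\<close> survive products and convolutions. By induction on \<open>n\<close>, the
  coefficients of \<open>u = \<Sum>n. u\<^sub>n t\<^sup>n\<close> satisfy
  \<open>\<bar>\<partial>\<^sub>x\<^sup>j u\<^sub>n\<bar> / j! \<le> \<kappa> B\<^sup>n R\<^sup>j (n + j choose n) / (n + j + 1)\<^sup>3 W\<close>: the binomial coefficients convolve by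
  Vandermonde's identity and the weights \<open>1 / (m + 1)\<^sup>2\<close> of the first derivatives are stable under
  convolution.
\<close>

section \<open>Convolution with the kernel\<close>

text \<open>The product u u_x loses one derivative, so no fixed bound on the x-derivatives passes
  from one time coefficient to the next. Apart from the cubic denominator, the bounds of the
  existence part are the Taylor coefficients of \<open>1 / (1 - B t - R x)\<close>, for which
  differentiation in t and in x costs the same factor: \<open>(j+1) binom(n+j+1, n) = (n+j+1)
  binom(n+j, n) = (n+1) binom(n+j+1, n+1)\<close>. The derivative lost on the right is thus repaid
  by the factor n+1 in front of the next coefficient. In between it uses up one power of the
  denominator: hence cubes for the coefficients themselves and squares for the factors inside the
  flux.

  The weight replaces Sobolev norms: all estimates become real inequalities at a point. Bare suprema
  would not do, because the solution has to be a curve in H^3; square integrability of the weight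
  provides that.\<close>

definition kernel_D :: "real \<Rightarrow> real" where
  "kernel_D z = - sgn z * kernel_G z"

lemma kernel_G_measurable [measurable]: "kernel_G \<in> borel_measurable borel"
  unfolding kernel_G_def[abs_def] by measurable

lemma kernel_D_measurable [measurable]: "kernel_D \<in> borel_measurable borel"
  unfolding kernel_D_def[abs_def] by measurable

lemma kernel_G_nonneg: "0 \<le> kernel_G z"
  by (simp add: kernel_G_def)

lemma kernel_D_abs_le: "\<bar>kernel_D z\<bar> \<le> kernel_G z"
  using kernel_G_nonneg[of z] by (auto simp: kernel_D_def abs_mult sgn_real_def)

lemma has_bochner_integral_exp_abs:
  fixes c :: real
  assumes "0 < c"
  shows "has_bochner_integral lborel (\<lambda>z. exp (- (c * \<bar>z\<bar>))) (2 / c)"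
proof -
  have "(\<integral>\<^sup>+z. ennreal (exp (- (c * z))) * indicator {0..} z \<partial>lborel) = ennreal (0 - (- exp (- (c * 0)) / c))"
  proof (rule nn_integral_FTC_atLeast)
    show "((\<lambda>z. - exp (- (c * z)) / c) has_real_derivative exp (- (c * x))) (at x)" for x
      using assms by (auto intro!: derivative_eq_intros)
    have "((\<lambda>z. exp (- (c * z))) \<longlongrightarrow> 0) at_top"
      using assms
      by (intro filterlim_compose[OF exp_at_bot] filterlim_compose[OF filterlim_uminus_at_bot_at_top]
          filterlim_tendsto_pos_mult_at_top[OF tendsto_const _ filterlim_ident])
    then show "((\<lambda>z. - exp (- (c * z)) / c) \<longlongrightarrow> 0) at_top"
      using tendsto_divide[OF tendsto_minus tendsto_const[of c]] assms by fastforce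
  qed auto
  then have "(\<integral>\<^sup>+z. ennreal (indicator {0..} z * exp (- (c * z))) \<partial>lborel) = ennreal (1 / c)"
    by (simp add: mult.commute ennreal_mult' flip: ennreal_indicator)
  then have p: "has_bochner_integral lborel (\<lambda>z. indicator {0..} z * exp (- (c * z))) (1 / c)"
    using assms by (intro has_bochner_integral_nn_integral) auto
  then have m: "has_bochner_integral lborel (\<lambda>z. indicator {0..} (- z) * exp (- (c * - z))) (1 / c)"
    using lborel_has_bochner_integral_real_affine_iff[of "-1" "\<lambda>z. indicator {0..} z * exp (- (c * z))" "1/c" 0]
    by simp
  have "has_bochner_integral lborel
      (\<lambda>z. indicator {0..} z * exp (- (c * z)) + indicator {0..} (- z) * exp (- (c * - z))) (2 / c)"
    using has_bochner_integral_add[OF p m] by (simp flip: add_divide_distrib)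
  \<comment> \<open>The two half lines overlap only at 0, a null set, where the sum is 2 instead of
    1.\<close>
  moreover have "AE z in lborel. indicator {0..} z * exp (- (c * z)) + indicator {0..} (- z) * exp (- (c * - z))
       = exp (- (c * \<bar>z\<bar>))"
    using AE_lborel_singleton[of 0] by eventually_elim (auto simp: indicator_def)
  ultimately show ?thesis
    by (subst has_bochner_integral_cong_AE[symmetric]) auto
qed

lemma has_bochner_integral_exp_abs_shift:
  fixes c :: real
  assumes "0 < c"
  shows "has_bochner_integral lborel (\<lambda>y. exp (- (c * \<bar>x - y\<bar>))) (2 / c)"
  using lborel_has_bochner_integral_real_affine_iff[of "-1" "\<lambda>z. exp (- (c * \<bar>z\<bar>))" "2/c" x]
    has_bochner_integral_exp_abs[OF assms] by simp

lemma has_bochner_integral_kernel_G: "has_bochner_integral lborel (\<lambda>y. kernel_G (x - y)) 1"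
  using has_bochner_integral_mult_left[OF has_bochner_integral_exp_abs_shift[of 1 x], of "1/2"]
  by (simp add: kernel_G_def)

lemma integrable_kernel_G: "integrable lborel (\<lambda>y. kernel_G (x - y))"
  using has_bochner_integral_kernel_G by (rule integrable.intros)

lemma integral_kernel_G: "(\<integral>y. kernel_G (x - y) \<partial>lborel) = 1"
  using has_bochner_integral_kernel_G by (rule has_bochner_integral_integral_eq)

lemma integrable_kernel_mult_bounded:
  assumes [measurable]: "k \<in> borel_measurable borel" "f \<in> borel_measurable borel"
    and k: "\<And>z. \<bar>k z\<bar> \<le> kernel_G z" and f: "\<And>y. \<bar>f y\<bar> \<le> M"
  shows "integrable lborel (\<lambda>y. k (x - y) * f y)"
proof (rule Bochner_Integration.integrable_bound)
  show "integrable lborel (\<lambda>y. kernel_G (x - y) * M)"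
    by (intro integrable_mult_left integrable_kernel_G)
  have "\<bar>k (x - y)\<bar> * \<bar>f y\<bar> \<le> kernel_G (x - y) * \<bar>M\<bar>" for y
    using f[of y] by (intro mult_mono k) (auto simp: kernel_G_nonneg)
  then show "AE y in lborel. norm (k (x - y) * f y) \<le> norm (kernel_G (x - y) * M)"
    by (auto simp: abs_mult kernel_G_nonneg)
qed measurable

lemma convolution_bound:
  assumes [measurable]: "k \<in> borel_measurable borel" "f \<in> borel_measurable borel"
    and k: "\<And>z. \<bar>k z\<bar> \<le> kernel_G z" and f: "\<And>y. \<bar>f y\<bar> \<le> M"
  shows "\<bar>(k \<star> f) x\<bar> \<le> M"
proof -
  have M: "0 \<le> M" using f[of 0] by linarith
  have "\<bar>(k \<star> f) x\<bar> \<le> (\<integral>y. \<bar>k (x - y) * f y\<bar> \<partial>lborel)"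
    unfolding convolution_def by simp
  also have "\<dots> \<le> (\<integral>y. kernel_G (x - y) * M \<partial>lborel)"
  proof (rule integral_mono)
    show "integrable lborel (\<lambda>y. \<bar>k (x - y) * f y\<bar>)"
      using integrable_kernel_mult_bounded[OF assms] by simp
    show "integrable lborel (\<lambda>y. kernel_G (x - y) * M)"
      by (intro integrable_mult_left integrable_kernel_G)
    show "\<bar>k (x - y) * f y\<bar> \<le> kernel_G (x - y) * M" for y
      unfolding abs_mult using M by (intro mult_mono k f) (auto simp: kernel_G_nonneg)
  qed
  also have "\<dots> = M" by (simp add: integral_kernel_G)
  finally show ?thesis .
qed

section \<open>Integration by parts against the kernel, one half line at a time\<close>

definition half_conv :: "(real \<Rightarrow> real) \<Rightarrow> real \<Rightarrow> real" where
  "half_conv g x = (LBINT y:{x..}. exp (x - y) * g y)"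

text \<open>The integrand of the difference is the derivative of \<open>exp (x - y) * f y\<close> in
  \<open>y\<close>, whose boundary term at infinity vanishes because \<open>f\<close> is bounded. In
  operator terms, \<open>half_conv\<close> inverts \<open>1 - d/dx\<close>.\<close>

lemma half_conv_deriv:
  assumes d: "\<And>y. (f has_real_derivative f' y) (at y)" and M: "\<And>y. \<bar>f y\<bar> \<le> M"
    and i': "set_integrable lborel {x..} (\<lambda>y. exp (x - y) * f' y)"
    and i: "set_integrable lborel {x..} (\<lambda>y. exp (x - y) * f y)"
  shows "half_conv f' x = half_conv f x - f x"
proof -
  let ?h = "\<lambda>y. exp (x - y) * f' y - exp (x - y) * f y"
  have ih: "set_integrable lborel {x..} ?h"
    using i i' by (rule set_integral_diff(1)[rotated])
  have lim: "((\<lambda>b. exp (x - b) * f b) \<longlongrightarrow> 0) at_top"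
  proof (rule Lim_null_comparison)
    show "\<forall>\<^sub>F b in at_top. norm (exp (x - b) * f b) \<le> exp (x - b) * M"
      using M by (simp add: abs_mult)
    have "((\<lambda>b. exp (- b) * (exp x * M)) \<longlongrightarrow> 0) at_top"
      by (intro tendsto_mult_left_zero filterlim_compose[OF exp_at_bot filterlim_uminus_at_bot_at_top])
    then show "((\<lambda>b. exp (x - b) * M) \<longlongrightarrow> 0) at_top"
      by (simp add: exp_diff exp_minus divide_inverse mult_ac)
  qed
  have "(LBINT y:{x..b}. ?h y) = exp (x - b) * f b - f x" if "x \<le> b" for b
  proof -
    have "(?h has_integral (exp (x - b) * f b - exp (x - x) * f x)) {x..b}"
      using that
      by (intro fundamental_theorem_of_calculus)
         (auto simp flip: has_real_derivative_iff_has_vector_derivative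
           intro!: derivative_eq_intros DERIV_subset[OF d])
    moreover have "set_integrable lborel {x..b} ?h"
      using ih by (rule set_integrable_subset) auto
    ultimately show ?thesis
      by (simp add: set_borel_integral_eq_integral(2) integral_unique)
  qed
  then have "\<forall>\<^sub>F b in at_top. exp (x - b) * f b - f x = (LBINT y:{x..b}. ?h y)"
    by (intro eventually_at_top_linorderI[of x]) simp
  then have "((\<lambda>b. LBINT y:{x..b}. ?h y) \<longlongrightarrow> 0 - f x) at_top"
    by (rule Lim_transform_eventually[rotated]) (intro tendsto_intros lim)
  moreover have "((\<lambda>b. LBINT y:{x..b}. ?h y) \<longlongrightarrow> (LBINT y:{x..}. ?h y)) at_top"
    using ih by (intro tendsto_set_lebesgue_integral_at_top) auto
  ultimately have "(LBINT y:{x..}. ?h y) = 0 - f x"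
    by (intro tendsto_unique[OF trivial_limit_at_top_linorder])
  then show ?thesis
    using set_integral_diff(2)[OF i' i] by (simp add: half_conv_def)
qed

text \<open>Cutting at the kink \<open>y = x\<close> leaves two purely exponential halves. The left
  one is written as \<open>half_conv\<close> of the reflected function, so that only right half
  lines need analysis. \<open>kernel_D\<close> differs from \<open>kernel_G\<close> by a sign on the
  left half, hence sum and difference.\<close>

lemma kernel_conv_split:
  assumes [measurable]: "g \<in> borel_measurable borel" and i: "integrable lborel (\<lambda>y. kernel_G (x - y) * g y)"
  shows "set_integrable lborel {x..} (\<lambda>y. exp (x - y) * g y)" (is ?a)
    and "set_integrable lborel {-x..} (\<lambda>y. exp (- x - y) * g (- y))" (is ?b)
    and "(kernel_G \<star> g) x = (half_conv g x + half_conv (\<lambda>y. g (- y)) (- x)) / 2" (is ?c)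
    and "(kernel_D \<star> g) x = (half_conv g x - half_conv (\<lambda>y. g (- y)) (- x)) / 2" (is ?d)
proof -
  let ?p = "\<lambda>y. indicator {x..} y * (exp (x - y) * g y)"
  let ?q = "\<lambda>y. indicator {..x} y * (exp (y - x) * g y)"
  have p: "integrable lborel ?p"
    using integrable_mult_right[OF i, of 2]
    by (rule Bochner_Integration.integrable_bound)
       (auto simp: kernel_G_def indicator_def abs_mult)
  have q: "integrable lborel ?q"
    using integrable_mult_right[OF i, of 2]
    by (rule Bochner_Integration.integrable_bound)
       (auto simp: kernel_G_def indicator_def abs_mult)
  have e: "indicator {..x} (- y) * (exp (- y - x) * g (- y)) =
      indicator {- x..} y * (exp (- x - y) * g (- y))" for y
  proof -
    have "- y - x = - x - y" by simp
    then show ?thesis by (auto simp: indicator_def)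
  qed
  have q': "has_bochner_integral lborel (\<lambda>y. indicator {- x..} y * (exp (- x - y) * g (- y))) (integral\<^sup>L lborel ?q)"
    using lborel_has_bochner_integral_real_affine_iff[of "-1" ?q "integral\<^sup>L lborel ?q" 0]
      has_bochner_integral_integrable[OF q]
    by (simp add: e)
  show ?a using p by (simp add: set_integrable_def)
  show ?b using q' by (auto simp: set_integrable_def intro: integrable.intros)
  have hp: "half_conv g x = integral\<^sup>L lborel ?p"
    by (simp add: half_conv_def set_lebesgue_integral_def)
  have hq: "half_conv (\<lambda>y. g (- y)) (- x) = integral\<^sup>L lborel ?q"
    using has_bochner_integral_integral_eq[OF q']
    by (simp add: half_conv_def set_lebesgue_integral_def)
  have "(kernel_G \<star> g) x = (\<integral>y. (?p y + ?q y) / 2 \<partial>lborel)"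
    unfolding convolution_def
    using AE_lborel_singleton[of x]
    by (intro integral_cong_AE; (measurable)?) (auto simp: kernel_G_def indicator_def)
  then show ?c using p q by (simp add: hp hq)
  have "(kernel_D \<star> g) x = (\<integral>y. (?p y - ?q y) / 2 \<partial>lborel)"
    unfolding convolution_def
    using AE_lborel_singleton[of x]
    by (intro integral_cong_AE; (measurable)?) (auto simp: kernel_G_def kernel_D_def indicator_def)
  then show ?d using p q by (simp add: hp hq)
qed

text \<open>\<open>kernel_G\<close> is continuous at 0, so moving the derivative onto it leaves no
  local term; \<open>kernel_D\<close> jumps there by -1, which produces the \<open>- f x\<close>. In
  distributions: \<open>G'' = G - \<delta>\<close>.\<close>

lemma convolution_deriv_by_parts:
  assumes d: "\<And>y. (f has_real_derivative f' y) (at y)" and M: "\<And>y. \<bar>f y\<bar> \<le> M"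
    and [measurable]: "f' \<in> borel_measurable borel"
    and i: "integrable lborel (\<lambda>y. kernel_G (x - y) * f' y)"
  shows "(kernel_G \<star> f') x = (kernel_D \<star> f) x"
    and "(kernel_D \<star> f') x = (kernel_G \<star> f) x - f x"
proof -
  have "continuous_on UNIV f"
    using d by (intro continuous_at_imp_continuous_on) (auto intro: DERIV_isCont)
  then have [measurable]: "f \<in> borel_measurable borel"
    by (rule borel_measurable_continuous_onI)
  have i0: "integrable lborel (\<lambda>y. kernel_G (x - y) * f y)"
    using M by (intro integrable_kernel_mult_bounded[of _ _ M]) (auto simp: kernel_G_nonneg)
  note s = kernel_conv_split[OF _ i] and s0 = kernel_conv_split[OF _ i0]
  have a: "half_conv f' x = half_conv f x - f x"
    using M by (intro half_conv_deriv[OF d, of M] s s0) auto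
  \<comment> \<open>Reflection reverses the sign of the derivative. This is what exchanges sum and
    difference of the halves, and with them the two kernels.\<close>
  have d': "((\<lambda>y. f (- y)) has_real_derivative - f' (- y)) (at y)" for y
    using DERIV_chain2[OF d[of "- y"] DERIV_minus[OF DERIV_ident]] by simp
  have "half_conv (\<lambda>y. - f' (- y)) (- x) = half_conv (\<lambda>y. f (- y)) (- x) - f (- (- x))"
    using M s(2) s0(2)
    by (intro half_conv_deriv[OF d', of M]) (auto simp: set_integrable_def)
  then have b: "half_conv (\<lambda>y. f' (- y)) (- x) = f x - half_conv (\<lambda>y. f (- y)) (- x)"
    by (simp add: half_conv_def set_lebesgue_integral_def)
  show "(kernel_G \<star> f') x = (kernel_D \<star> f) x" "(kernel_D \<star> f') x = (kernel_G \<star> f) x - f x"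
    using a b by (auto simp: s(3,4) s0(3,4) field_simps)
qed

section \<open>Sobolev bounds and slowly varying weights\<close>

text \<open>The function \<open>(1 - (y - x)) * (f y) ^ 2\<close> equals \<open>(f x) ^ 2\<close> at
  \<open>y = x\<close> and vanishes at \<open>y = x + 1\<close>, so minus the integral of its
  derivative is \<open>(f x) ^ 2\<close>. Only values on \<open>[x, x + 1]\<close> enter; this
  locality yields decay at infinity and, later, the weight.\<close>

lemma square_le_unit_interval_integral:
  fixes f :: "real \<Rightarrow> real"
  assumes d: "\<And>y. (f has_real_derivative f' y) (at y)"
    and i: "integrable lborel (\<lambda>y. (f y)\<^sup>2)" and i': "integrable lborel (\<lambda>y. (f' y)\<^sup>2)"
  shows "(f x)\<^sup>2 \<le> (\<integral>y. indicator {x..x+1} y * (2 * (f y)\<^sup>2 + (f' y)\<^sup>2) \<partial>lborel)"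
proof -
  let ?g = "\<lambda>y. 2 * (f y)\<^sup>2 + (f' y)\<^sup>2"
  let ?h = "\<lambda>y. (1 - (y - x)) * (f y)\<^sup>2"
  let ?h' = "\<lambda>y. - (f y)\<^sup>2 + (1 - (y - x)) * (2 * f y * f' y)"
  have "(?h has_real_derivative ?h' y) (at y within {x..x+1})" for y
    by (rule derivative_eq_intros DERIV_subset[OF d] refl | simp add: algebra_simps)+
  then have "(?h' has_integral ?h (x+1) - ?h x) {x..x+1}"
    by (intro fundamental_theorem_of_calculus[where f = ?h])
       (simp_all add: has_real_derivative_iff_has_vector_derivative)
  then have 1: "((\<lambda>y. - ?h' y) has_integral (f x)\<^sup>2) {x..x+1}"
    by (auto dest: has_integral_neg)
  have gi: "integrable lborel ?g"
    using i i' by auto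
  then have gs: "set_integrable lborel {x..x+1} ?g"
    unfolding set_integrable_def by (intro integrable_mult_indicator) auto
  then have 2: "(?g has_integral (LBINT y:{x..x+1}. ?g y)) {x..x+1}"
    by (simp add: set_borel_integral_eq_integral integrable_integral)
  have "- ?h' y \<le> ?g y" if "y \<in> {x..x+1}" for y
  proof -
    have "\<bar>1 - (y - x)\<bar> \<le> 1" using that by auto
    moreover have "\<bar>2 * f y * f' y\<bar> \<le> (f y)\<^sup>2 + (f' y)\<^sup>2"
      using zero_le_power2[of "f y - f' y"] zero_le_power2[of "f y + f' y"]
      by (auto simp: power2_eq_square algebra_simps abs_le_iff)
    ultimately have "\<bar>(1 - (y - x)) * (2 * f y * f' y)\<bar> \<le> 1 * ((f y)\<^sup>2 + (f' y)\<^sup>2)"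
      unfolding abs_mult[of "1 - (y - x)"] by (intro mult_mono) auto
    then show ?thesis by (simp add: abs_le_iff)
  qed
  from has_integral_le[OF 1 2 this] show ?thesis
    by (simp add: set_lebesgue_integral_def)
qed

lemma square_le_integral:
  fixes f :: "real \<Rightarrow> real"
  assumes d: "\<And>y. (f has_real_derivative f' y) (at y)"
    and i: "integrable lborel (\<lambda>y. (f y)\<^sup>2)" and i': "integrable lborel (\<lambda>y. (f' y)\<^sup>2)"
  shows "(f x)\<^sup>2 \<le> 2 * ((\<integral>y. (f y)\<^sup>2 \<partial>lborel) + (\<integral>y. (f' y)\<^sup>2 \<partial>lborel))"
proof -
  have g: "integrable lborel (\<lambda>y. 2 * (f y)\<^sup>2 + (f' y)\<^sup>2)"
    using i i' by auto
  have "(f x)\<^sup>2 \<le> (\<integral>y. indicator {x..x+1} y *\<^sub>R (2 * (f y)\<^sup>2 + (f' y)\<^sup>2) \<partial>lborel)"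
    using square_le_unit_interval_integral[OF assms] by simp
  also have "\<dots> \<le> (\<integral>y. 2 * (f y)\<^sup>2 + (f' y)\<^sup>2 \<partial>lborel)"
    using g by (intro integral_mono integrable_mult_indicator) (auto simp: indicator_def)
  also have "\<dots> = 2 * (\<integral>y. (f y)\<^sup>2 \<partial>lborel) + (\<integral>y. (f' y)\<^sup>2 \<partial>lborel)"
    using i i' by simp
  also have "\<dots> \<le> 2 * (\<integral>y. (f y)\<^sup>2 \<partial>lborel) + 2 * (\<integral>y. (f' y)\<^sup>2 \<partial>lborel)"
    using Bochner_Integration.integral_nonneg[of lborel "\<lambda>y. (f' y)\<^sup>2"] by simp
  finally show ?thesis by simp
qed

text \<open>The unit interval that controls \<open>f x\<close> moves off to infinity, so its share
  of an integrable function tends to 0 by dominated convergence.\<close>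

lemma square_integrable_tendsto_0_at_top:
  fixes f :: "real \<Rightarrow> real"
  assumes d: "\<And>y. (f has_real_derivative f' y) (at y)"
    and i: "integrable lborel (\<lambda>y. (f y)\<^sup>2)" and i': "integrable lborel (\<lambda>y. (f' y)\<^sup>2)"
  shows "(f \<longlongrightarrow> 0) at_top"
proof -
  let ?g = "\<lambda>y. 2 * (f y)\<^sup>2 + (f' y)\<^sup>2"
  have g: "integrable lborel ?g" using i i' by auto
  have "((\<lambda>x. \<integral>y. indicator {x..x+1} y *\<^sub>R ?g y \<partial>lborel) \<longlongrightarrow> (\<integral>y. 0 \<partial>(lborel :: real measure))) at_top"
  proof (rule integral_dominated_convergence_at_top[where w = ?g])
    show "AE y in lborel. ((\<lambda>x. indicator {x..x+1} y *\<^sub>R ?g y) \<longlongrightarrow> 0) at_top"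
    proof
      fix y
      have "\<forall>\<^sub>F x in at_top. 0 = indicator {x..x+1} y *\<^sub>R ?g y"
        using eventually_gt_at_top[of y] by eventually_elim auto
      then show "((\<lambda>x. indicator {x..x+1} y *\<^sub>R ?g y) \<longlongrightarrow> 0) at_top"
        by (rule Lim_transform_eventually[OF tendsto_const])
    qed
    show "\<forall>\<^sub>F x in at_top. AE y in lborel. norm (indicator {x..x+1} y *\<^sub>R ?g y) \<le> ?g y"
      by (intro always_eventually allI AE_I2) (auto simp: indicator_def)
  qed (use g in \<open>auto intro: borel_measurable_integrable\<close>)
  then have "((\<lambda>x. \<integral>y. indicator {x..x+1} y *\<^sub>R ?g y \<partial>lborel) \<longlongrightarrow> 0) at_top"
    by simp
  then have "((\<lambda>x. (f x)\<^sup>2) \<longlongrightarrow> 0) at_top"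
    by (rule Lim_null_comparison[rotated])
       (use square_le_unit_interval_integral[OF assms] in simp)
  then show ?thesis
    by (simp add: tendsto_null_power)
qed

lemma square_integrable_tendsto_0_at_infinity:
  fixes f :: "real \<Rightarrow> real"
  assumes d: "\<And>y. (f has_real_derivative f' y) (at y)"
    and i: "integrable lborel (\<lambda>y. (f y)\<^sup>2)" and i': "integrable lborel (\<lambda>y. (f' y)\<^sup>2)"
  shows "(f \<longlongrightarrow> 0) at_infinity"
proof -
  have d': "((\<lambda>y. f (- y)) has_real_derivative - f' (- y)) (at y)" for y
    using DERIV_chain2[OF d[of "- y"] DERIV_minus[OF DERIV_ident]] by simp
  have "((\<lambda>y. f (- y)) \<longlongrightarrow> 0) at_top"
    using lborel_integrable_real_affine[OF i, of "-1" 0] lborel_integrable_real_affine[OF i', of "-1" 0]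
    by (intro square_integrable_tendsto_0_at_top[OF d']) auto
  then have "(f \<longlongrightarrow> 0) at_bot"
    by (simp add: filterlim_at_bot_mirror)
  with square_integrable_tendsto_0_at_top[OF assms] show ?thesis
    by (simp add: at_infinity_eq_at_top_bot filterlim_sup)
qed

section \<open>Weights that vary more slowly than the kernel decays\<close>

locale slow_weight =
  fixes W :: "real \<Rightarrow> real"
  assumes measurable_weight [measurable]: "W \<in> borel_measurable borel"
    and nonneg: "0 \<le> W x" and le_1: "W x \<le> 1"
    and slow: "W y \<le> exp (\<bar>x - y\<bar> / 2) * W x"
    and integrable_square: "integrable lborel (\<lambda>x. (W x)\<^sup>2)"
begin

text \<open>The weight grows at most at exponential rate 1/2 while the kernel decays at rate 1.
  Comparing \<open>W y\<close> with \<open>W x\<close> leaves the integral of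
  \<open>exp (- \<bar>z\<bar> / 2) / 2\<close>, which is the constant 2.\<close>

lemma convolution_le_weight:
  assumes [measurable]: "k \<in> borel_measurable borel" "f \<in> borel_measurable borel"
    and k: "\<And>z. \<bar>k z\<bar> \<le> kernel_G z" and f: "\<And>y. \<bar>f y\<bar> \<le> c * W y" and c: "0 \<le> c"
  shows "\<bar>(k \<star> f) x\<bar> \<le> 2 * c * W x"
proof -
  have fb: "\<bar>f y\<bar> \<le> c" for y
    using f[of y] mult_left_mono[OF le_1[of y] c] by simp
  have e: "has_bochner_integral lborel (\<lambda>y. exp (- (\<bar>x - y\<bar> / 2)) * (c * W x / 2)) (4 * (c * W x / 2))"
    using has_bochner_integral_mult_left[OF has_bochner_integral_exp_abs_shift[of "1/2" x], of "c * W x / 2"]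
    by simp
  have "\<bar>(k \<star> f) x\<bar> \<le> (\<integral>y. \<bar>k (x - y) * f y\<bar> \<partial>lborel)"
    unfolding convolution_def by simp
  also have "\<dots> \<le> (\<integral>y. exp (- (\<bar>x - y\<bar> / 2)) * (c * W x / 2) \<partial>lborel)"
  proof (rule integral_mono)
    show "integrable lborel (\<lambda>y. \<bar>k (x - y) * f y\<bar>)"
      using integrable_kernel_mult_bounded[OF _ _ k fb] by simp
    show "integrable lborel (\<lambda>y. exp (- (\<bar>x - y\<bar> / 2)) * (c * W x / 2))"
      using e by (rule integrable.intros)
    fix y
    have "\<bar>k (x - y) * f y\<bar> \<le> kernel_G (x - y) * (c * (exp (\<bar>x - y\<bar> / 2) * W x))"
      unfolding abs_mult using order_trans[OF f mult_left_mono[OF slow c]]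
      by (intro mult_mono k) (auto simp: kernel_G_nonneg)
    also have "\<dots> = (exp (- \<bar>x - y\<bar>) * exp (\<bar>x - y\<bar> / 2)) * (c * W x / 2)"
      by (simp add: kernel_G_def)
    also have "\<dots> = exp (- (\<bar>x - y\<bar> / 2)) * (c * W x / 2)"
      by (simp flip: exp_add)
    finally show "\<bar>k (x - y) * f y\<bar> \<le> exp (- (\<bar>x - y\<bar> / 2)) * (c * W x / 2)" .
  qed
  also have "\<dots> = 2 * c * W x"
    using has_bochner_integral_integral_eq[OF e] by simp
  finally show ?thesis .
qed

end

text \<open>Averaging with \<open>exp (- \<bar>x - y\<bar>)\<close> makes any integrable density
  vary at rate at most 1, by the triangle inequality. The square root halves the rate and makes the
  square integrable; dividing by 1 plus the total mass gives values at most 1, also when the mass is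
  0.\<close>

lemma slow_weight_exp_average:
  assumes V: "integrable lborel V" and V0: "\<And>y. 0 \<le> V y"
  defines "W \<equiv> (\<lambda>x. sqrt ((\<integral>y. exp (- \<bar>x - y\<bar>) * V y \<partial>lborel) / (1 + (\<integral>y. V y \<partial>lborel))))"
  shows "slow_weight W"
proof -
  note [measurable] = borel_measurable_integrable[OF V]
  define Z where "Z = (\<lambda>x. \<integral>y. exp (- \<bar>x - y\<bar>) * V y \<partial>lborel)"
  define I where "I = (\<integral>y. V y \<partial>lborel)"
  have I0: "0 \<le> I" using V0 by (simp add: I_def)
  have int: "integrable lborel (\<lambda>y. exp (- \<bar>x - y\<bar>) * V y)" for x
    using V by (rule Bochner_Integration.integrable_bound) (auto simp: abs_mult mult_left_le_one_le)
  have Z0: "0 \<le> Z x" for x using V0 by (simp add: Z_def)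
  have ZI: "Z x \<le> I" for x
    unfolding Z_def I_def using V V0 int by (intro integral_mono) (auto simp: mult_left_le_one_le)
  have slow: "Z y \<le> exp \<bar>x - y\<bar> * Z x" for x y
  proof -
    have "Z y \<le> (\<integral>z. exp \<bar>x - y\<bar> * (exp (- \<bar>x - z\<bar>) * V z) \<partial>lborel)"
      unfolding Z_def using V0 int
      by (intro integral_mono integrable_mult_right)
         (auto simp: mult.assoc[symmetric] exp_add[symmetric] intro!: mult_right_mono)
    then show ?thesis by (simp add: Z_def)
  qed
  \<comment> \<open>Fubini with the \<open>x\<close>-integral inside: each slice contributes exactly
    \<open>2 * V y\<close>.\<close>
  have "integrable (lborel \<Otimes>\<^sub>M lborel) (\<lambda>(y, x). exp (- \<bar>x - y\<bar>) * V y)"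
  proof (rule lborel_pair.Fubini_integrable)
    have *: "has_bochner_integral lborel (\<lambda>x. exp (- \<bar>x - y\<bar>) * V y) (2 * V y)" for y
      using has_bochner_integral_mult_left[OF has_bochner_integral_exp_abs_shift[of 1 y]]
      by (simp add: abs_minus_commute)
    then have "(\<integral>x. exp (- \<bar>x - y\<bar>) * V y \<partial>lborel) = 2 * V y" for y
      by (rule has_bochner_integral_integral_eq)
    moreover have "norm (case (y, x) of (y, x) \<Rightarrow> exp (- \<bar>x - y\<bar>) * V y) = exp (- \<bar>x - y\<bar>) * V y" for x y
      using V0 by simp
    ultimately show "integrable lborel (\<lambda>y. \<integral>x. norm (case (y, x) of (y, x) \<Rightarrow> exp (- \<bar>x - y\<bar>) * V y) \<partial>lborel)"
      using V by (simp only:) simp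
    show "AE y in lborel. integrable lborel (\<lambda>x. case (y, x) of (y, x) \<Rightarrow> exp (- \<bar>x - y\<bar>) * V y)"
      using integrable.intros[OF *] by simp
  qed measurable
  from lborel_pair.integrable_snd[OF this] have Zi: "integrable lborel Z"
    by (simp add: Z_def)
  note [measurable] = borel_measurable_integrable[OF Zi]
  have W: "W = (\<lambda>x. sqrt (Z x / (1 + I)))"
    by (simp add: W_def Z_def I_def)
  show ?thesis
  proof
    show "W \<in> borel_measurable borel" unfolding W by measurable
    show "0 \<le> W x" for x using Z0 I0 by (simp add: W)
    show "W x \<le> 1" for x using ZI[of x] I0 by (simp add: W)
    show "W y \<le> exp (\<bar>x - y\<bar> / 2) * W x" for x y
    proof -
      have "Z y / (1 + I) \<le> (exp (\<bar>x - y\<bar> / 2))\<^sup>2 * (Z x / (1 + I))"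
        using divide_right_mono[OF slow, of "1 + I" y x] I0
        by (simp flip: exp_double)
      then have "sqrt (Z y / (1 + I)) \<le> sqrt ((exp (\<bar>x - y\<bar> / 2))\<^sup>2 * (Z x / (1 + I)))"
        by (rule real_sqrt_le_mono)
      then show ?thesis unfolding W real_sqrt_mult by simp
    qed
    show "integrable lborel (\<lambda>x. (W x)\<^sup>2)"
      using Zi Z0 I0 by (simp add: W)
  qed
qed

lemma deriv_funpow_has_derivative:
  assumes "smooth f"
  shows "((deriv ^^ j) f has_real_derivative (deriv ^^ Suc j) f x) (at x)"
  using assms DERIV_deriv_iff_real_differentiable by (auto simp: smooth_def)

lemma sobolev_norm_1_square:
  "(sobolev_norm 1 f)\<^sup>2 = (\<integral>y. (f y)\<^sup>2 \<partial>lborel) + (\<integral>y. (deriv f y)\<^sup>2 \<partial>lborel)"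
  by (simp add: sobolev_norm_def sum_nonneg)

text \<open>One density \<open>V\<close> collects the local energies of all derivatives, each
  rescaled by \<open>(s ^ j / fact j) ^ 2\<close>. Every rescaled derivative at \<open>x\<close> is
  controlled by the mass of \<open>V\<close> near \<open>x\<close>, hence by the exponential average
  of \<open>V\<close>, and the weight no longer depends on the order \<open>j\<close>.\<close>

lemma E_space_weight:
  assumes "0 < s" "u0 \<in> E_space s"
  obtains W C where "slow_weight W" "0 \<le> C"
    "\<And>j x. \<bar>(deriv ^^ j) u0 x\<bar> \<le> C * fact j * (1 / s) ^ j * W x"
proof -
  define f where "f = (\<lambda>j. (deriv ^^ j) u0)"
  have sm: "smooth u0" and sob: "\<And>k. sobolev 1 (f k)"
    using assms by (auto simp: E_space_def f_def)
  have d: "(f j has_real_derivative f (Suc j) x) (at x)" for j x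
    unfolding f_def by (rule deriv_funpow_has_derivative[OF sm])
  have i: "integrable lborel (\<lambda>y. (f j y)\<^sup>2)" for j
    using sob[of j] by (auto simp: sobolev_def square_integrable_def dest: spec[of _ 0])
  have "bdd_above (range (\<lambda>k. s ^ k * sobolev_norm 1 (f k) / (fact k / (real k + 1)\<^sup>2)))"
    using assms by (simp add: E_space_def f_def)
  then obtain K where K: "\<And>k. s ^ k * sobolev_norm 1 (f k) / (fact k / (real k + 1)\<^sup>2) \<le> K"
    by (auto simp: bdd_above_def)
  \<comment> \<open>\<open>g j\<close> is the integrand that controls \<open>(f j x) ^ 2\<close>
    over a unit interval; \<open>c j\<close> is the square of the scaling in the norm of
    \<open>E_space\<close>.\<close>
  define g where "g = (\<lambda>j y. 2 * (f j y)\<^sup>2 + (f (Suc j) y)\<^sup>2)"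
  define c where "c = (\<lambda>j. (s ^ j / fact j)\<^sup>2)"
  have c0: "0 < c j" for j using assms by (simp add: c_def)
  have gi: "integrable lborel (g j)" for j using i by (auto simp: g_def)
  have g0: "0 \<le> g j y" for j y by (simp add: g_def)
  define N where "N = (\<lambda>j. (sobolev_norm 1 (f j))\<^sup>2)"
  have N: "N j = (\<integral>y. (f j y)\<^sup>2 \<partial>lborel) + (\<integral>y. (f (Suc j) y)\<^sup>2 \<partial>lborel)" for j
    unfolding N_def sobolev_norm_1_square by (simp add: f_def)
  have Ig: "(\<integral>y. g j y \<partial>lborel) \<le> 2 * N j" for j
    unfolding g_def N using i Bochner_Integration.integral_nonneg[of lborel "\<lambda>y. (f (Suc j) y)\<^sup>2"] by simp
  have fN: "(f j y)\<^sup>2 \<le> 2 * N j" for j y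
    unfolding N using d i i by (rule square_le_integral)
  \<comment> \<open>The factor \<open>(k + 1) ^ 2\<close> in the norm of \<open>E_space\<close>
    appears squared and makes the rescaled energies summable.\<close>
  have cN: "c j * N j \<le> K\<^sup>2 * (1 / (real j + 1) ^ 4)" for j
  proof -
    have n0: "0 \<le> sobolev_norm 1 (f j)" by (simp add: sobolev_norm_def sum_nonneg)
    have "s ^ j / fact j * sobolev_norm 1 (f j) \<le> K / (real j + 1)\<^sup>2"
      using K[of j] by (simp add: field_simps)
    then have "(s ^ j / fact j * sobolev_norm 1 (f j))\<^sup>2 \<le> (K / (real j + 1)\<^sup>2)\<^sup>2"
      using n0 assms by (intro power_mono) auto
    then show ?thesis
      by (simp add: c_def N_def power_mult_distrib power_divide flip: power_mult)
  qed
  \<comment> \<open>Energy of order \<open>j + 1\<close> with the scaling of order \<open>j\<close>: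
    the mismatch costs \<open>((j + 1) / s) ^ 2\<close>, and two of the four powers remain.\<close>
  have cN': "c j * N (Suc j) \<le> K\<^sup>2 / s\<^sup>2 * (1 / (real j + 1)\<^sup>2)" for j
  proof -
    have "c j = c (Suc j) * (real j + 1)\<^sup>2 / s\<^sup>2"
    proof -
      have "s ^ Suc j / fact (Suc j) = s ^ j / fact j * (s / (real j + 1))"
        by (simp add: field_simps)
      then have "c (Suc j) = c j * (s / (real j + 1))\<^sup>2"
        unfolding c_def by (simp only: power_mult_distrib)
      then show ?thesis
        using assms by (simp add: power_divide)
    qed
    then have "c j * N (Suc j) = c (Suc j) * N (Suc j) * ((real j + 1)\<^sup>2 / s\<^sup>2)"
      by simp
    also have "\<dots> \<le> K\<^sup>2 * (1 / (real (Suc j) + 1) ^ 4) * ((real j + 1)\<^sup>2 / s\<^sup>2)"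
      by (intro mult_right_mono cN) auto
    also have "\<dots> \<le> K\<^sup>2 * (1 / (real j + 1) ^ 4) * ((real j + 1)\<^sup>2 / s\<^sup>2)"
      by (intro mult_right_mono mult_left_mono divide_left_mono power_mono) auto
    also have "\<dots> = K\<^sup>2 / s\<^sup>2 * ((real j + 1)\<^sup>2 / (real j + 1) ^ 4)" by simp
    also have "(real j + 1)\<^sup>2 / (real j + 1) ^ 4 = 1 / (real j + 1)\<^sup>2"
      by (simp add: power2_eq_square power4_eq_xxxx)
    finally show ?thesis .
  qed
  have sq2: "summable (\<lambda>j. 1 / (real j + 1)\<^sup>2)"
    using inverse_power_summable[of 2, where ?'a = real, THEN summable_Suc_iff[THEN iffD2]]
    by (simp add: inverse_eq_divide add.commute)
  have sq4: "summable (\<lambda>j. 1 / (real j + 1) ^ 4)"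
    using inverse_power_summable[of 4, where ?'a = real, THEN summable_Suc_iff[THEN iffD2]]
    by (simp add: inverse_eq_divide add.commute)
  have N0: "0 \<le> N j" for j by (simp add: N_def)
  have s1: "summable (\<lambda>j. c j * N j)"
    by (rule summable_comparison_test'[OF summable_mult[OF sq4, of "K\<^sup>2"], of 0])
       (use cN c0 N0 in \<open>simp add: abs_mult less_imp_le\<close>)
  have s2: "summable (\<lambda>j. c j * N (Suc j))"
    by (rule summable_comparison_test'[OF summable_mult[OF sq2, of "K\<^sup>2 / s\<^sup>2"], of 0])
       (use cN' c0 N0 in \<open>simp add: abs_mult less_imp_le\<close>)
  have sg: "summable (\<lambda>j. c j * g j y)" for y
  proof (rule summable_comparison_test')
    show "summable (\<lambda>j. 4 * (c j * N j) + 2 * (c j * N (Suc j)))"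
      by (intro summable_add summable_mult s1 s2)
    have "g j y \<le> 4 * N j + 2 * N (Suc j)" for j
      using fN[of j y] fN[of "Suc j" y] by (simp add: g_def)
    from mult_left_mono[OF this less_imp_le[OF c0]]
    show "norm (c j * g j y) \<le> 4 * (c j * N j) + 2 * (c j * N (Suc j))" for j
      using c0[of j] g0[of j y] by (simp add: abs_mult algebra_simps)
  qed
  define V where "V = (\<lambda>y. \<Sum>j. c j * g j y)"
  have Vi: "integrable lborel V"
    unfolding V_def
  proof (rule integrable_suminf)
    show "integrable lborel (\<lambda>y. c j * g j y)" for j using gi by simp
    show "AE y in lborel. summable (\<lambda>j. norm (c j * g j y))"
      using sg c0 g0 by (simp add: abs_mult less_imp_le)
    show "summable (\<lambda>j. \<integral>y. norm (c j * g j y) \<partial>lborel)"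
    proof (rule summable_comparison_test'[OF summable_mult[OF s1, of 2]])
      fix j
      have "c j * (\<integral>y. g j y \<partial>lborel) \<le> 2 * (c j * N j)"
        using mult_left_mono[OF Ig less_imp_le[OF c0]] by (simp add: mult_ac)
      then show "norm (\<integral>y. norm (c j * g j y) \<partial>lborel) \<le> 2 * (c j * N j)"
        using c0[of j] g0 by (simp add: abs_mult less_imp_le)
    qed
  qed
  have gV: "c j * g j y \<le> V y" for j y
    unfolding V_def using sg[of y] c0 g0 sum_le_suminf[of "\<lambda>j. c j * g j y" "{j}"]
    by (auto simp: less_imp_le)
  have V0: "0 \<le> V y" for y
    using gV[of 0 y] c0[of 0] g0[of 0 y] by (meson less_imp_le mult_nonneg_nonneg order_trans)
  define I where "I = (\<integral>y. V y \<partial>lborel)"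
  have I0: "0 \<le> I" using V0 by (simp add: I_def)
  define Z where "Z = (\<lambda>x. \<integral>y. exp (- \<bar>x - y\<bar>) * V y \<partial>lborel)"
  have Zi: "integrable lborel (\<lambda>y. exp (- \<bar>x - y\<bar>) * V y)" for x
    using Vi by (rule Bochner_Integration.integrable_bound)
      (use Vi in \<open>auto simp: abs_mult mult_left_le_one_le intro!: borel_measurable_times dest: borel_measurable_integrable\<close>)
  show ?thesis
  proof (rule that)
    show "slow_weight (\<lambda>x. sqrt (Z x / (1 + I)))"
      using slow_weight_exp_average[OF Vi V0] by (simp add: Z_def I_def)
    show "0 \<le> sqrt (exp 1 * (1 + I))" using I0 by simp
    fix j x
    have "(f j x)\<^sup>2 \<le> (\<integral>y. indicator {x..x+1} y * g j y \<partial>lborel)"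
      unfolding g_def using d i i by (rule square_le_unit_interval_integral)
    also have "\<dots> \<le> (\<integral>y. exp 1 / c j * (exp (- \<bar>x - y\<bar>) * V y) \<partial>lborel)"
    proof (rule integral_mono)
      show "integrable lborel (\<lambda>y. indicator {x..x+1} y * g j y)"
        using integrable_mult_indicator[OF _ gi, of "{x..x+1}" j] by simp
      show "integrable lborel (\<lambda>y. exp 1 / c j * (exp (- \<bar>x - y\<bar>) * V y))"
        using Zi by simp
      fix y
      \<comment> \<open>On \<open>[x, x + 1]\<close> one has
        \<open>\<bar>x - y\<bar> \<le> 1\<close>; this passage from the interval to the exponential
        average is the origin of \<open>exp 1\<close> in the constant.\<close>
      have "indicator {x..x+1} y \<le> exp 1 * exp (- \<bar>x - y\<bar>)"
        by (auto simp: indicator_def simp flip: exp_add)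
      then have "indicator {x..x+1} y * g j y \<le> exp 1 * exp (- \<bar>x - y\<bar>) * (V y / c j)"
        using gV[of j y] c0[of j] g0[of j y]
        by (intro mult_mono) (auto simp: field_simps)
      then show "indicator {x..x+1} y * g j y \<le> exp 1 / c j * (exp (- \<bar>x - y\<bar>) * V y)"
        by simp
    qed
    also have "\<dots> = exp 1 / c j * Z x" by (simp add: Z_def)
    finally have "sqrt ((f j x)\<^sup>2) \<le> sqrt (exp 1 / c j * Z x)" by (rule real_sqrt_le_mono)
    also have "exp 1 / c j * Z x = (exp 1 * (1 + I)) * (fact j * (1 / s) ^ j)\<^sup>2 * (Z x / (1 + I))"
    proof -
      have "1 / c j = (fact j * (1 / s) ^ j)\<^sup>2"
        by (simp add: c_def power_divide power_mult_distrib)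
      moreover have "Z x = (1 + I) * (Z x / (1 + I))" using I0 by simp
      ultimately show ?thesis
        by (metis (no_types, opaque_lifting) mult.commute mult.left_commute times_divide_eq_right mult.right_neutral)
    qed
    also have "sqrt \<dots> = sqrt (exp 1 * (1 + I)) * (fact j * (1 / s) ^ j) * sqrt (Z x / (1 + I))"
      unfolding real_sqrt_mult using assms by simp
    finally show "\<bar>(deriv ^^ j) u0 x\<bar> \<le> sqrt (exp 1 * (1 + I)) * fact j * (1 / s) ^ j * sqrt (Z x / (1 + I))"
      by (simp add: f_def mult.assoc)
  qed
qed

section \<open>The flux for functions in \<open>H\<^sup>3\<close>\<close>

lemma convolution_add:
  assumes "integrable lborel (\<lambda>y. k (x - y) * f y)" "integrable lborel (\<lambda>y. k (x - y) * g y)"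
  shows "(k \<star> (\<lambda>y. f y + g y)) x = (k \<star> f) x + (k \<star> g) x"
  unfolding convolution_def distrib_left using assms by (rule Bochner_Integration.integral_add)

lemma convolution_diff:
  assumes "integrable lborel (\<lambda>y. k (x - y) * f y)" "integrable lborel (\<lambda>y. k (x - y) * g y)"
  shows "(k \<star> (\<lambda>y. f y - g y)) x = (k \<star> f) x - (k \<star> g) x"
  unfolding convolution_def right_diff_distrib using assms by (rule Bochner_Integration.integral_diff)

lemma convolution_cmult: "(k \<star> (\<lambda>y. c * f y)) x = c * (k \<star> f) x"
  by (simp add: convolution_def mult.left_commute[of _ c])

lemma sobolev_has_derivative:
  assumes "sobolev m f" "j < m"
  shows "((deriv ^^ j) f has_real_derivative (deriv ^^ Suc j) f x) (at x)"
  using assms DERIV_deriv_iff_real_differentiable by (auto simp: sobolev_def)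

lemma sobolev_measurable:
  assumes "sobolev m f" "j \<le> m"
  shows "(deriv ^^ j) f \<in> borel_measurable borel"
  using assms by (auto simp: sobolev_def square_integrable_def)

lemma sobolev_integrable:
  assumes "sobolev m f" "j \<le> m"
  shows "integrable lborel (\<lambda>x. ((deriv ^^ j) f x)\<^sup>2)"
  using assms by (auto simp: sobolev_def square_integrable_def)

text \<open>The embedding of H^1 into bounded functions uses one further derivative, hence
  \<open>j < m\<close>. The factor 2 merely rounds up the square root of 2.\<close>

lemma sobolev_abs_le:
  assumes "sobolev m f" "j < m"
  shows "\<bar>(deriv ^^ j) f x\<bar> \<le> 2 * sobolev_norm m f"
proof -
  have "((deriv ^^ j) f x)\<^sup>2
      \<le> 2 * ((\<integral>y. ((deriv ^^ j) f y)\<^sup>2 \<partial>lborel) + (\<integral>y. ((deriv ^^ Suc j) f y)\<^sup>2 \<partial>lborel))"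
    using assms by (intro square_le_integral sobolev_has_derivative sobolev_integrable) auto
  also have "\<dots> = 2 * (\<Sum>i\<in>{j, Suc j}. \<integral>y. ((deriv ^^ i) f y)\<^sup>2 \<partial>lborel)"
    by simp
  also have "\<dots> \<le> 2 * (\<Sum>i\<le>m. \<integral>y. ((deriv ^^ i) f y)\<^sup>2 \<partial>lborel)"
    using assms by (intro mult_left_mono sum_mono2) auto
  also have "\<dots> = 2 * (sobolev_norm m f)\<^sup>2"
    by (simp add: sobolev_norm_def sum_nonneg)
  also have "\<dots> \<le> (2 * sobolev_norm m f)\<^sup>2"
    by (simp add: power_mult_distrib)
  finally have "\<bar>(deriv ^^ j) f x\<bar>\<^sup>2 \<le> (2 * sobolev_norm m f)\<^sup>2" by simp
  then show ?thesis
    by (rule power2_le_imp_le) (simp add: sobolev_norm_def sum_nonneg)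
qed

lemma sobolev_diff:
  assumes "sobolev m f" "sobolev m g"
  shows "j \<le> m \<Longrightarrow> (deriv ^^ j) (\<lambda>x. f x - g x) = (\<lambda>x. (deriv ^^ j) f x - (deriv ^^ j) g x)"
    and "sobolev m (\<lambda>x. f x - g x)"
proof -
  show *: "(deriv ^^ j) (\<lambda>x. f x - g x) = (\<lambda>x. (deriv ^^ j) f x - (deriv ^^ j) g x)" if "j \<le> m" for j
    using that
  proof (induction j)
    case (Suc j)
    then have "(deriv ^^ Suc j) (\<lambda>x. f x - g x) = deriv (\<lambda>x. (deriv ^^ j) f x - (deriv ^^ j) g x)"
      by simp
    also have "\<dots> = (\<lambda>x. (deriv ^^ Suc j) f x - (deriv ^^ Suc j) g x)"
      using Suc.prems assms
      by (intro ext DERIV_imp_deriv DERIV_diff sobolev_has_derivative) auto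
    finally show ?case .
  qed simp
  show "sobolev m (\<lambda>x. f x - g x)"
    unfolding sobolev_def
  proof (intro conjI allI impI)
    show "(deriv ^^ j) (\<lambda>x. f x - g x) differentiable at x" if "j < m" for j x
      using that assms by (subst *) (auto simp: sobolev_def intro!: differentiable_diff)
    show "square_integrable ((deriv ^^ j) (\<lambda>x. f x - g x))" if j: "j \<le> m" for j
    proof -
      note [measurable] = sobolev_measurable[OF assms(1) j] sobolev_measurable[OF assms(2) j]
      have "integrable lborel (\<lambda>x. ((deriv ^^ j) f x - (deriv ^^ j) g x)\<^sup>2)"
      proof (rule Bochner_Integration.integrable_bound)
        show "integrable lborel (\<lambda>x. 2 * ((deriv ^^ j) f x)\<^sup>2 + 2 * ((deriv ^^ j) g x)\<^sup>2)"
          using sobolev_integrable[OF assms(1) j] sobolev_integrable[OF assms(2) j] by simp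
        have "(a - b)\<^sup>2 \<le> 2 * a\<^sup>2 + 2 * b\<^sup>2" for a b :: real
          using zero_le_power2[of "a + b"] by (simp add: power2_eq_square algebra_simps)
        then show "AE x in lborel. norm (((deriv ^^ j) f x - (deriv ^^ j) g x)\<^sup>2)
            \<le> norm (2 * ((deriv ^^ j) f x)\<^sup>2 + 2 * ((deriv ^^ j) g x)\<^sup>2)"
          by simp
      qed measurable
      then show ?thesis
        using j by (simp add: * square_integrable_def)
    qed
  qed
qed

text \<open>The first-order part is integrated by parts once and the second-order part twice; the
  second integration uses the \<open>kernel_D\<close> rule, whose local term is
  \<open>- (deriv w x) ^ 2\<close>.\<close>

lemma convolution_nonlocal_source:
  assumes "sobolev 3 w"
  shows "(kernel_G \<star> nonlocal_source w) x =
    (kernel_D \<star> (\<lambda>y. 2 * (deriv w y)\<^sup>2 + 6 * (w y)\<^sup>2)) x + (kernel_G \<star> (\<lambda>y. (deriv w y)\<^sup>2)) x - (deriv w x)\<^sup>2"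
proof -
  define w1 w2 w3 where "w1 = deriv w" and "w2 = (deriv ^^ 2) w" and "w3 = (deriv ^^ 3) w"
  have d0: "(w has_real_derivative w1 y) (at y)" and d1: "(w1 has_real_derivative w2 y) (at y)"
    and d2: "(w2 has_real_derivative w3 y) (at y)" for y
    using sobolev_has_derivative[OF assms, of 0] sobolev_has_derivative[OF assms, of 1]
      sobolev_has_derivative[OF assms, of 2]
    by (simp_all add: w1_def w2_def w3_def numeral_eq_Suc)
  have [measurable]: "w \<in> borel_measurable borel" "w1 \<in> borel_measurable borel"
    "w2 \<in> borel_measurable borel" "w3 \<in> borel_measurable borel"
    using sobolev_measurable[OF assms, of 0] sobolev_measurable[OF assms, of 1]
      sobolev_measurable[OF assms, of 2] sobolev_measurable[OF assms, of 3]
    by (simp_all add: w1_def w2_def w3_def)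
  define M where "M = 2 * sobolev_norm 3 w"
  have b0: "\<bar>w y\<bar> \<le> M" and b1: "\<bar>w1 y\<bar> \<le> M" and b2: "\<bar>w2 y\<bar> \<le> M" for y
    using sobolev_abs_le[OF assms, of 0 y] sobolev_abs_le[OF assms, of 1 y] sobolev_abs_le[OF assms, of 2 y]
    by (simp_all add: w1_def w2_def M_def)
  have M0: "0 \<le> M" using b0[of 0] by linarith
  have prod: "\<bar>a * b\<bar> \<le> M * M" if "\<bar>a\<bar> \<le> M" "\<bar>b\<bar> \<le> M" for a b
    unfolding abs_mult using that M0 by (intro mult_mono) auto
  define p q p' q' q'' where "p = (\<lambda>y. 2 * (w1 y)\<^sup>2 + 6 * (w y)\<^sup>2)" and "q = (\<lambda>y. (w1 y)\<^sup>2)"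
    and "p' = (\<lambda>y. 4 * (w1 y * w2 y) + 12 * (w y * w1 y))" and "q' = (\<lambda>y. 2 * (w1 y * w2 y))"
    and "q'' = (\<lambda>y. 2 * (w2 y * w2 y) + 2 * (w1 y * w3 y))"
  have dp: "(p has_real_derivative p' y) (at y)" for y
    unfolding p_def p'_def by (rule derivative_eq_intros d0 d1 refl | simp)+
  have dq: "(q has_real_derivative q' y) (at y)" for y
    unfolding q_def q'_def by (rule derivative_eq_intros d1 refl | simp)+
  have dq': "(q' has_real_derivative q'' y) (at y)" for y
    unfolding q'_def q''_def by (rule derivative_eq_intros d1 d2 refl | simp add: algebra_simps)+
  have [measurable]: "p' \<in> borel_measurable borel" "q' \<in> borel_measurable borel" "q'' \<in> borel_measurable borel"
    unfolding p'_def q'_def q''_def by measurable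
  have bp: "\<bar>p y\<bar> \<le> 8 * (M * M)" and bp': "\<bar>p' y\<bar> \<le> 16 * (M * M)"
    and bq: "\<bar>q y\<bar> \<le> M * M" and bq': "\<bar>q' y\<bar> \<le> 2 * (M * M)" for y
    using prod[OF b0 b0, of y y] prod[OF b1 b1, of y y] prod[OF b1 b2, of y y] prod[OF b0 b1, of y y]
    unfolding p_def p'_def q_def q'_def power2_eq_square by linarith+
  have src: "nonlocal_source w = (\<lambda>y. p' y + q'' y)"
  proof
    fix y
    have "deriv (\<lambda>z. 2 * (deriv w z)\<^sup>2 + 6 * (w z)\<^sup>2) y = p' y"
      using DERIV_imp_deriv[OF dp] by (simp add: p_def w1_def)
    moreover have "deriv (\<lambda>z. (deriv w z)\<^sup>2) = q'"
      using DERIV_imp_deriv[OF dq] by (auto simp: q_def w1_def)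
    ultimately show "nonlocal_source w y = p' y + q'' y"
      using DERIV_imp_deriv[OF dq'] by (simp add: nonlocal_source_def numeral_2_eq_2)
  qed
  have ip': "integrable lborel (\<lambda>y. kernel_G (x - y) * p' y)"
    using bp' by (intro integrable_kernel_mult_bounded) (auto simp: kernel_G_nonneg)
  have iq': "integrable lborel (\<lambda>y. kernel_G (x - y) * q' y)"
    using bq' by (intro integrable_kernel_mult_bounded) (auto simp: kernel_G_nonneg)
  \<comment> \<open>The third derivative is only square integrable, not bounded. The inequality
    \<open>\<bar>w3\<bar> \<le> 1 + w3 ^ 2\<close> dominates the product by the kernel plus an
    integrable square.\<close>
  have "integrable lborel (\<lambda>y. kernel_G (x - y) * (w1 y * w3 y))"
  proof (rule Bochner_Integration.integrable_bound)
    have "integrable lborel (\<lambda>y. (w3 y)\<^sup>2)"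
      using sobolev_integrable[OF assms, of 3] by (simp add: w3_def)
    then show "integrable lborel (\<lambda>y. M * (kernel_G (x - y) + (w3 y)\<^sup>2))"
      using integrable_kernel_G[of x] by simp
    have "\<bar>kernel_G (x - y) * (w1 y * w3 y)\<bar> \<le> M * (kernel_G (x - y) + (w3 y)\<^sup>2)" for y
    proof -
      have G1: "kernel_G (x - y) \<le> 1" by (simp add: kernel_G_def) (smt (verit) exp_le_one_iff)
      have "\<bar>w3 y\<bar> \<le> 1 + (w3 y)\<^sup>2"
        using zero_le_power2[of "\<bar>w3 y\<bar> - 1"] by (simp add: power2_eq_square algebra_simps)
      then have "kernel_G (x - y) * \<bar>w3 y\<bar> \<le> kernel_G (x - y) * (1 + (w3 y)\<^sup>2)"
        by (intro mult_left_mono) (auto simp: kernel_G_nonneg)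
      also have "\<dots> \<le> kernel_G (x - y) + (w3 y)\<^sup>2"
        using mult_right_mono[OF G1, of "(w3 y)\<^sup>2"] by (simp add: algebra_simps)
      finally have "\<bar>w1 y\<bar> * (kernel_G (x - y) * \<bar>w3 y\<bar>) \<le> M * (kernel_G (x - y) + (w3 y)\<^sup>2)"
        using b1[of y] M0 by (intro mult_mono) (auto simp: kernel_G_nonneg)
      then show ?thesis by (simp add: abs_mult kernel_G_nonneg mult_ac)
    qed
    then show "AE y in lborel. norm (kernel_G (x - y) * (w1 y * w3 y)) \<le> norm (M * (kernel_G (x - y) + (w3 y)\<^sup>2))"
      using abs_ge_self order_trans by fastforce
  qed measurable
  moreover have "integrable lborel (\<lambda>y. kernel_G (x - y) * (w2 y * w2 y))"
    by (intro integrable_kernel_mult_bounded[where M = "M * M"] prod b2) (auto simp: kernel_G_nonneg)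
  ultimately have "integrable lborel (\<lambda>y. 2 * (kernel_G (x - y) * (w2 y * w2 y)) + 2 * (kernel_G (x - y) * (w1 y * w3 y)))"
    by (intro Bochner_Integration.integrable_add integrable_mult_right)
  then have iq'': "integrable lborel (\<lambda>y. kernel_G (x - y) * q'' y)"
    unfolding q''_def by (rule back_subst[where P = "integrable lborel"]) (simp add: algebra_simps)
  have "(kernel_G \<star> nonlocal_source w) x = (kernel_G \<star> p') x + (kernel_G \<star> q'') x"
    unfolding src by (rule convolution_add[OF ip' iq''])
  also have "(kernel_G \<star> p') x = (kernel_D \<star> p) x"
    using bp by (intro convolution_deriv_by_parts(1)[OF dp _ _ ip']) auto
  also have "(kernel_G \<star> q'') x = (kernel_D \<star> q') x"
    using bq' by (intro convolution_deriv_by_parts(1)[OF dq' _ _ iq'']) auto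
  also have "(kernel_D \<star> q') x = (kernel_G \<star> q) x - q x"
    using bq by (intro convolution_deriv_by_parts(2)[OF dq _ _ iq']) auto
  finally show ?thesis by (simp add: p_def q_def w1_def)
qed

definition flux :: "(real \<Rightarrow> real) \<Rightarrow> real \<Rightarrow> real" where
  "flux w x = 4 * w x * deriv w x + (kernel_G \<star> nonlocal_source w) x"

text \<open>Away from \<open>x\<close> the derivative of the difference \<open>w = u - v\<close> is
  not small, so it must not occur in the bound. Every nonlocal occurrence is rewritten as the
  derivative of a product with \<open>w\<close>, minus a term in which the derivative falls on
  \<open>u + v\<close>; the first is then absorbed by the kernel. The local terms at
  \<open>x\<close> lose their derivative because \<open>deriv u x = deriv v x\<close>.\<close>

lemma flux_diff_at_critical_point:
  assumes u: "sobolev 3 u" and v: "sobolev 3 v"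
    and uM: "\<And>j y. j < 3 \<Longrightarrow> \<bar>(deriv ^^ j) u y\<bar> \<le> M"
    and vM: "\<And>j y. j < 3 \<Longrightarrow> \<bar>(deriv ^^ j) v y\<bar> \<le> M"
    and m: "\<And>y. \<bar>u y - v y\<bar> \<le> m" and crit: "deriv u x = deriv v x"
  shows "\<bar>flux u x - flux v x\<bar> \<le> 32 * (M * m)"
proof -
  define u1 u2 v1 v2 where "u1 = deriv u" "u2 = deriv u1" "v1 = deriv v" "v2 = deriv v1"
  have d: "(u has_real_derivative u1 y) (at y)" "(u1 has_real_derivative u2 y) (at y)"
    "(v has_real_derivative v1 y) (at y)" "(v1 has_real_derivative v2 y) (at y)" for y
    using sobolev_has_derivative[OF u, of 0] sobolev_has_derivative[OF u, of 1]
      sobolev_has_derivative[OF v, of 0] sobolev_has_derivative[OF v, of 1]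
    by (simp_all add: u1_u2_v1_v2_def numeral_eq_Suc)
  have [measurable]: "u \<in> borel_measurable borel" "u1 \<in> borel_measurable borel"
    "u2 \<in> borel_measurable borel" "v \<in> borel_measurable borel" "v1 \<in> borel_measurable borel"
    "v2 \<in> borel_measurable borel"
    using sobolev_measurable[OF u, of 0] sobolev_measurable[OF u, of 1]
      sobolev_measurable[OF u, of 2] sobolev_measurable[OF v, of 0] sobolev_measurable[OF v, of 1]
      sobolev_measurable[OF v, of 2]
    by (simp_all add: u1_u2_v1_v2_def numeral_eq_Suc)
  have B: "\<bar>u y\<bar> \<le> M" "\<bar>u1 y\<bar> \<le> M" "\<bar>u2 y\<bar> \<le> M" "\<bar>v y\<bar> \<le> M" "\<bar>v1 y\<bar> \<le> M" "\<bar>v2 y\<bar> \<le> M" for y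
    using uM[of 0 y] uM[of 1 y] uM[of 2 y] vM[of 0 y] vM[of 1 y] vM[of 2 y]
    by (simp_all add: u1_u2_v1_v2_def numeral_eq_Suc)
  have M0: "0 \<le> M" and m0: "0 \<le> m" using B(1)[of 0] m[of 0] by linarith+
  define w w1 where "w = (\<lambda>y. u y - v y)" "w1 = (\<lambda>y. u1 y - v1 y)"
  \<comment> \<open>These come from \<open>u1 ^ 2 - v1 ^ 2 = (u1 + v1) * w1 = f' - g\<close> and
    \<open>u ^ 2 - v ^ 2 = h\<close>, where \<open>f'\<close> is the derivative of
    \<open>f\<close>.\<close>
  define f g h f' where "f = (\<lambda>y. (u1 y + v1 y) * w y)" "g = (\<lambda>y. (u2 y + v2 y) * w y)"
    "h = (\<lambda>y. (u y + v y) * w y)" "f' = (\<lambda>y. (u2 y + v2 y) * w y + (u1 y + v1 y) * w1 y)"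
  have [measurable]: "f \<in> borel_measurable borel" "g \<in> borel_measurable borel"
    "h \<in> borel_measurable borel" "f' \<in> borel_measurable borel"
    unfolding f_g_h_f'_def w_w1_def by measurable
  have pr: "\<bar>(a + b) * c\<bar> \<le> 2 * (M * m)" if "\<bar>a\<bar> \<le> M" "\<bar>b\<bar> \<le> M" "\<bar>c\<bar> \<le> m" for a b c
  proof -
    have "\<bar>(a + b) * c\<bar> \<le> (2 * M) * m"
      unfolding abs_mult using that M0 by (intro mult_mono) auto
    then show ?thesis by simp
  qed
  have bd: "\<bar>f y\<bar> \<le> 2 * (M * m)" "\<bar>g y\<bar> \<le> 2 * (M * m)" "\<bar>h y\<bar> \<le> 2 * (M * m)" for y
    unfolding f_g_h_f'_def w_w1_def by (intro pr B m)+
  \<comment> \<open>This bound is not proportional to \<open>m\<close>. It serves only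
    integrability; in the final estimate \<open>f'\<close> is replaced by \<open>f\<close>.\<close>
  have bf': "\<bar>f' y\<bar> \<le> 2 * (M * m) + 4 * (M * M)" for y
  proof -
    have "\<bar>(u1 y + v1 y) * w1 y\<bar> \<le> (2 * M) * (2 * M)"
      unfolding abs_mult w_w1_def using B[of y] M0 by (intro mult_mono) auto
    moreover have "f' y = g y + (u1 y + v1 y) * w1 y" by (simp add: f_g_h_f'_def)
    ultimately show ?thesis using bd(2)[of y] by linarith
  qed
  have df: "(f has_real_derivative f' y) (at y)" for y
    unfolding f_g_h_f'_def w_w1_def by (rule derivative_eq_intros d refl | simp add: algebra_simps)+
  have kG: "\<bar>kernel_G z\<bar> \<le> kernel_G z" for z by (simp add: kernel_G_nonneg)
  have iG: "integrable lborel (\<lambda>y. kernel_G (x - y) * r y)"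
    and iD: "integrable lborel (\<lambda>y. kernel_D (x - y) * r y)"
    if "r \<in> borel_measurable borel" "\<And>y. \<bar>r y\<bar> \<le> c" for r c
    by (intro integrable_kernel_mult_bounded[OF _ that(1) kG that(2)]
          integrable_kernel_mult_bounded[OF _ that(1) kernel_D_abs_le that(2)]; measurable)+
  have cG: "\<bar>(kernel_G \<star> r) x\<bar> \<le> c" and cD: "\<bar>(kernel_D \<star> r) x\<bar> \<le> c"
    if "r \<in> borel_measurable borel" "\<And>y. \<bar>r y\<bar> \<le> c" for r c
    by (intro convolution_bound[OF _ that(1) kG that(2)]
          convolution_bound[OF _ that(1) kernel_D_abs_le that(2)]; measurable)+
  have MM: "\<bar>a\<^sup>2\<bar> \<le> M * M" if "\<bar>a\<bar> \<le> M" for a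
    unfolding power2_eq_square abs_mult using that M0 by (intro mult_mono) auto
  have iu: "integrable lborel (\<lambda>y. kernel_D (x - y) * (2 * (u1 y)\<^sup>2 + 6 * (u y)\<^sup>2))"
  proof (rule iD)
    show "\<bar>2 * (u1 y)\<^sup>2 + 6 * (u y)\<^sup>2\<bar> \<le> 8 * (M * M)" for y
      using MM[OF B(1), of y] MM[OF B(2), of y] by linarith
  qed measurable
  have iv: "integrable lborel (\<lambda>y. kernel_D (x - y) * (2 * (v1 y)\<^sup>2 + 6 * (v y)\<^sup>2))"
  proof (rule iD)
    show "\<bar>2 * (v1 y)\<^sup>2 + 6 * (v y)\<^sup>2\<bar> \<le> 8 * (M * M)" for y
      using MM[OF B(4), of y] MM[OF B(5), of y] by linarith
  qed measurable
  have "(kernel_D \<star> (\<lambda>y. 2 * (u1 y)\<^sup>2 + 6 * (u y)\<^sup>2)) x - (kernel_D \<star> (\<lambda>y. 2 * (v1 y)\<^sup>2 + 6 * (v y)\<^sup>2)) x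
     = (kernel_D \<star> (\<lambda>y. (2 * (u1 y)\<^sup>2 + 6 * (u y)\<^sup>2) - (2 * (v1 y)\<^sup>2 + 6 * (v y)\<^sup>2))) x"
    by (rule convolution_diff[OF iu iv, symmetric])
  also have "(\<lambda>y. (2 * (u1 y)\<^sup>2 + 6 * (u y)\<^sup>2) - (2 * (v1 y)\<^sup>2 + 6 * (v y)\<^sup>2))
     = (\<lambda>y. 2 * f' y - (2 * g y - 6 * h y))"
    by (auto simp: f_g_h_f'_def w_w1_def power2_eq_square algebra_simps)
  also have "(kernel_D \<star> (\<lambda>y. 2 * f' y - (2 * g y - 6 * h y))) x
     = 2 * (kernel_D \<star> f') x - (2 * (kernel_D \<star> g) x - 6 * (kernel_D \<star> h) x)"
  proof -
    have b1: "\<bar>2 * f' y\<bar> \<le> 2 * (2 * (M * m) + 4 * (M * M))" for y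
      using bf'[of y] by (simp add: abs_mult)
    have b2: "\<bar>2 * g y - 6 * h y\<bar> \<le> 16 * (M * m)" for y using bd[of y] by linarith
    have b3: "\<bar>2 * g y\<bar> \<le> 4 * (M * m)" and b4: "\<bar>6 * h y\<bar> \<le> 12 * (M * m)" for y
      using bd[of y] by (simp_all add: abs_mult)
    have "(kernel_D \<star> (\<lambda>y. 2 * f' y - (2 * g y - 6 * h y))) x
      = (kernel_D \<star> (\<lambda>y. 2 * f' y)) x - (kernel_D \<star> (\<lambda>y. 2 * g y - 6 * h y)) x"
      by (intro convolution_diff iD[OF _ b1] iD[OF _ b2]; measurable)
    also have "(kernel_D \<star> (\<lambda>y. 2 * g y - 6 * h y)) x
      = (kernel_D \<star> (\<lambda>y. 2 * g y)) x - (kernel_D \<star> (\<lambda>y. 6 * h y)) x"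
      by (intro convolution_diff iD[OF _ b3] iD[OF _ b4]; measurable)
    finally show ?thesis by (simp only: convolution_cmult)
  qed
  also have "(kernel_D \<star> f') x = (kernel_G \<star> f) x - f x"
    by (intro convolution_deriv_by_parts(2)[OF df bd(1)] iG[OF _ bf']; measurable)
  finally have 1: "(kernel_D \<star> (\<lambda>y. 2 * (u1 y)\<^sup>2 + 6 * (u y)\<^sup>2)) x - (kernel_D \<star> (\<lambda>y. 2 * (v1 y)\<^sup>2 + 6 * (v y)\<^sup>2)) x
     = 2 * ((kernel_G \<star> f) x - f x) - (2 * (kernel_D \<star> g) x - 6 * (kernel_D \<star> h) x)" .
  have "(kernel_G \<star> (\<lambda>y. (u1 y)\<^sup>2)) x - (kernel_G \<star> (\<lambda>y. (v1 y)\<^sup>2)) x = (kernel_G \<star> (\<lambda>y. (u1 y)\<^sup>2 - (v1 y)\<^sup>2)) x"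
    by (intro convolution_diff[symmetric] iG[OF _ MM[OF B(2)]] iG[OF _ MM[OF B(5)]]; measurable)
  also have "(\<lambda>y. (u1 y)\<^sup>2 - (v1 y)\<^sup>2) = (\<lambda>y. f' y - g y)"
    by (auto simp: f_g_h_f'_def w_w1_def power2_eq_square algebra_simps)
  also have "(kernel_G \<star> (\<lambda>y. f' y - g y)) x = (kernel_G \<star> f') x - (kernel_G \<star> g) x"
    by (intro convolution_diff iG[OF _ bf'] iG[OF _ bd(2)]; measurable)
  also have "(kernel_G \<star> f') x = (kernel_D \<star> f) x"
    by (intro convolution_deriv_by_parts(1)[OF df bd(1)] iG[OF _ bf']; measurable)
  finally have 2: "(kernel_G \<star> (\<lambda>y. (u1 y)\<^sup>2)) x - (kernel_G \<star> (\<lambda>y. (v1 y)\<^sup>2)) x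
     = (kernel_D \<star> f) x - (kernel_G \<star> g) x" .
  have c: "u1 x = v1 x" using crit by (simp add: u1_u2_v1_v2_def)
  have eq: "flux u x - flux v x = 4 * (u1 x * w x) + (2 * ((kernel_G \<star> f) x - f x) - (2 * (kernel_D \<star> g) x - 6 * (kernel_D \<star> h) x))
     + ((kernel_D \<star> f) x - (kernel_G \<star> g) x)"
  proof -
    have fu: "flux u x = 4 * u x * u1 x + ((kernel_D \<star> (\<lambda>y. 2 * (u1 y)\<^sup>2 + 6 * (u y)\<^sup>2)) x
        + (kernel_G \<star> (\<lambda>y. (u1 y)\<^sup>2)) x - (u1 x)\<^sup>2)"
      unfolding flux_def convolution_nonlocal_source[OF u] u1_u2_v1_v2_def ..
    have fv: "flux v x = 4 * v x * v1 x + ((kernel_D \<star> (\<lambda>y. 2 * (v1 y)\<^sup>2 + 6 * (v y)\<^sup>2)) x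
        + (kernel_G \<star> (\<lambda>y. (v1 y)\<^sup>2)) x - (v1 x)\<^sup>2)"
      unfolding flux_def convolution_nonlocal_source[OF v] u1_u2_v1_v2_def ..
    have *: "4 * a * r + (A + P - z) - (4 * b * r + (A' + P' - z)) = 4 * (r * (a - b)) + (A - A') + (P - P')"
      for a b r A P A' P' z :: real
      by (simp add: algebra_simps)
    show ?thesis
      unfolding 1[symmetric] 2[symmetric] unfolding fu fv c[symmetric] w_w1_def by (rule *)
  qed
  \<comment> \<open>The constant is 4 + 2 * (2 + 2) + 2 * 2 + 6 * 2 + 2 + 2 = 32.\<close>
  have arith: "\<bar>4 * a + (2 * (b - c) - (2 * d - 6 * e)) + (p - q)\<bar> \<le> 32 * X"
    if "\<bar>a\<bar> \<le> X" "\<bar>b\<bar> \<le> 2 * X" "\<bar>c\<bar> \<le> 2 * X" "\<bar>d\<bar> \<le> 2 * X" "\<bar>e\<bar> \<le> 2 * X"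
      "\<bar>p\<bar> \<le> 2 * X" "\<bar>q\<bar> \<le> 2 * X" for a b c d e p q X :: real
  proof (rule abs_leI)
    show "4 * a + (2 * (b - c) - (2 * d - 6 * e)) + (p - q) \<le> 32 * X"
      using abs_le_D1[OF that(1)] abs_le_D1[OF that(2)] abs_le_D2[OF that(3)] abs_le_D2[OF that(4)]
        abs_le_D1[OF that(5)] abs_le_D1[OF that(6)] abs_le_D2[OF that(7)] by argo
    show "- (4 * a + (2 * (b - c) - (2 * d - 6 * e)) + (p - q)) \<le> 32 * X"
      using abs_le_D2[OF that(1)] abs_le_D2[OF that(2)] abs_le_D1[OF that(3)] abs_le_D1[OF that(4)]
        abs_le_D2[OF that(5)] abs_le_D2[OF that(6)] abs_le_D1[OF that(7)] by argo
  qed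
  have "\<bar>u1 x * w x\<bar> \<le> M * m"
    unfolding abs_mult w_w1_def using B(2)[of x] m[of x] M0 by (intro mult_mono) auto
  then show ?thesis
    unfolding eq
    by (rule arith[OF _ cG[OF _ bd(1)] bd(1) cD[OF _ bd(2)] cD[OF _ bd(3)] cD[OF _ bd(1)] cG[OF _ bd(2)]])
       measurable
qed

section \<open>Uniqueness\<close>

text \<open>The supremum is 1-Lipschitz for uniform distance, so a modulus \<open>e t\<close> that
  is uniform in \<open>x\<close> passes to it.\<close>

lemma continuous_on_sup_norm:
  fixes F :: "real \<Rightarrow> real \<Rightarrow> real"
  assumes b: "\<And>t. t \<in> A \<Longrightarrow> \<exists>B. \<forall>x. \<bar>F t x\<bar> \<le> B"
    and e: "\<And>t. t \<in> A \<Longrightarrow> (e t \<longlongrightarrow> 0) (at t)"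
    and F: "\<And>t \<tau> x. t \<in> A \<Longrightarrow> \<tau> \<in> A \<Longrightarrow> \<bar>F \<tau> x - F t x\<bar> \<le> e t \<tau>"
  shows "continuous_on A (\<lambda>t. SUP x. \<bar>F t x\<bar>)"
  unfolding continuous_on_def
proof
  fix t assume t: "t \<in> A"
  have bdd: "bdd_above (range (\<lambda>x. \<bar>F \<tau> x\<bar>))" if "\<tau> \<in> A" for \<tau>
    using b[OF that] by (auto simp: bdd_above_def)
  have "((\<lambda>\<tau>. (SUP x. \<bar>F \<tau> x\<bar>) - (SUP x. \<bar>F t x\<bar>)) \<longlongrightarrow> 0) (at t within A)"
  proof (rule Lim_null_comparison)
    show "(e t \<longlongrightarrow> 0) (at t within A)"
      using tendsto_within_subset[OF e[OF t]] by blast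
    have "\<bar>(SUP x. \<bar>F \<tau> x\<bar>) - (SUP x. \<bar>F t x\<bar>)\<bar> \<le> e t \<tau>" if \<tau>: "\<tau> \<in> A" for \<tau>
    proof -
      have "\<bar>F \<tau> x\<bar> \<le> (SUP x. \<bar>F t x\<bar>) + e t \<tau>" for x
        using cSUP_upper[OF UNIV_I bdd[OF t], of x] F[OF t \<tau>, of x] by linarith
      then have "(SUP x. \<bar>F \<tau> x\<bar>) \<le> (SUP x. \<bar>F t x\<bar>) + e t \<tau>"
        by (intro cSUP_least) auto
      moreover have "\<bar>F t x\<bar> \<le> (SUP x. \<bar>F \<tau> x\<bar>) + e t \<tau>" for x
        using cSUP_upper[OF UNIV_I bdd[OF \<tau>], of x] F[OF t \<tau>, of x] by linarith
      then have "(SUP x. \<bar>F t x\<bar>) \<le> (SUP x. \<bar>F \<tau> x\<bar>) + e t \<tau>"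
        by (intro cSUP_least) auto
      ultimately show ?thesis by linarith
    qed
    then show "\<forall>\<^sub>F \<tau> in at t within A. norm ((SUP x. \<bar>F \<tau> x\<bar>) - (SUP x. \<bar>F t x\<bar>)) \<le> e t \<tau>"
      by (simp add: eventually_at_filter)
  qed
  then show "((\<lambda>\<tau>. SUP x. \<bar>F \<tau> x\<bar>) \<longlongrightarrow> (SUP x. \<bar>F t x\<bar>)) (at t within A)"
    by (rule LIM_zero_cancel)
qed

text \<open>Outside a large interval \<open>\<bar>f\<bar>\<close> stays below its nonzero value at
  \<open>y\<close>, so the maximum over that compact interval is global.\<close>

lemma vanishing_attains_sup_abs:
  fixes f :: "real \<Rightarrow> real"
  assumes c: "continuous_on UNIV f" and l: "(f \<longlongrightarrow> 0) at_infinity" and y: "f y \<noteq> 0"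
  obtains x where "\<And>z. \<bar>f z\<bar> \<le> \<bar>f x\<bar>"
proof -
  have "\<forall>\<^sub>F x in at_infinity. \<bar>f x\<bar> < \<bar>f y\<bar>"
    using tendstoD[OF l, of "\<bar>f y\<bar>"] y by (simp add: dist_real_def)
  then obtain R where R: "\<And>x. R \<le> \<bar>x\<bar> \<Longrightarrow> \<bar>f x\<bar> < \<bar>f y\<bar>"
    by (auto simp: eventually_at_infinity)
  have yR: "\<bar>y\<bar> < R" using R[of y] by force
  have "continuous_on {-R..R} (\<lambda>x. \<bar>f x\<bar>)"
    using c by (intro continuous_on_rabs) (rule continuous_on_subset, auto)
  moreover have "compact {-R..R}" "{-R..R} \<noteq> {}" using yR by auto
  ultimately obtain x where x: "x \<in> {-R..R}" "\<And>z. z \<in> {-R..R} \<Longrightarrow> \<bar>f z\<bar> \<le> \<bar>f x\<bar>"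
    using continuous_attains_sup[of "{-R..R}" "\<lambda>x. \<bar>f x\<bar>"] by blast
  have "\<bar>f z\<bar> \<le> \<bar>f x\<bar>" for z
  proof (cases "z \<in> {-R..R}")
    case False
    then have "\<bar>f z\<bar> < \<bar>f y\<bar>" by (intro R) auto
    also have "\<dots> \<le> \<bar>f x\<bar>" using yR by (intro x) auto
    finally show ?thesis by simp
  qed (use x in auto)
  then show ?thesis by (rule that)
qed

lemma maximum_principle:
  fixes w :: "real \<Rightarrow> real \<Rightarrow> real"
  assumes dx: "\<And>t x. t \<in> {0..T} \<Longrightarrow> (w t has_real_derivative wx t x) (at x)"
    and lim: "\<And>t. t \<in> {0..T} \<Longrightarrow> (w t \<longlongrightarrow> 0) at_infinity"
    and b: "\<And>t. t \<in> {0..T} \<Longrightarrow> \<exists>B. \<forall>x. \<bar>w t x\<bar> \<le> B"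
    and e: "\<And>t. t \<in> {0..T} \<Longrightarrow> (e t \<longlongrightarrow> 0) (at t)"
    and F: "\<And>t \<tau> x. t \<in> {0..T} \<Longrightarrow> \<tau> \<in> {0..T} \<Longrightarrow> \<bar>w \<tau> x - w t x\<bar> \<le> e t \<tau>"
    and dt: "\<And>t x. t \<in> {0..T} \<Longrightarrow> ((\<lambda>\<tau>. w \<tau> x) has_real_derivative wt t x) (at t)"
    and crit: "\<And>t x m. t \<in> {0..T} \<Longrightarrow> wx t x = 0 \<Longrightarrow> (\<And>y. \<bar>w t y\<bar> \<le> m) \<Longrightarrow> \<bar>wt t x\<bar> \<le> C * m"
    and init: "\<And>x. w 0 x = 0" and t: "t \<in> {0..T}"
  shows "w t x = 0"
proof (rule ccontr)
  assume nz: "w t x \<noteq> 0"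
  \<comment> \<open>Any rate above \<open>C\<close> works; the excess 1 makes the damped derivative
    at the maximum strictly negative.\<close>
  define K where "K = C + 1"
  define S where "S = (\<lambda>t. SUP x. \<bar>w t x\<bar>)"
  define \<phi> where "\<phi> = (\<lambda>t. exp (- (K * t)) * S t)"
  have bdd: "bdd_above (range (\<lambda>x. \<bar>w \<tau> x\<bar>))" if "\<tau> \<in> {0..T}" for \<tau>
    using b[OF that] by (auto simp: bdd_above_def)
  have up: "\<bar>w \<tau> y\<bar> \<le> S \<tau>" if "\<tau> \<in> {0..T}" for \<tau> y
    unfolding S_def by (rule cSUP_upper[OF UNIV_I bdd[OF that]])
  have "continuous_on {0..T} S"
    unfolding S_def by (rule continuous_on_sup_norm[OF b e F])
  then have "continuous_on {0..T} \<phi>"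
    unfolding \<phi>_def by (intro continuous_intros)
  then obtain t' where t': "t' \<in> {0..T}" and max: "\<And>\<tau>. \<tau> \<in> {0..T} \<Longrightarrow> \<phi> \<tau> \<le> \<phi> t'"
    using continuous_attains_sup[of "{0..T}" \<phi>] t by fastforce
  have "0 < \<bar>w t x\<bar>" using nz by simp
  also have "\<dots> \<le> S t" by (rule up[OF t])
  finally have "0 < \<phi> t" by (simp add: \<phi>_def)
  with max[OF t] have "0 < \<phi> t'" by linarith
  then have S0: "0 < S t'" by (simp add: \<phi>_def zero_less_mult_iff)
  have "S 0 = 0" by (simp add: S_def init)
  with S0 t' have t'0: "0 < t'" by (cases "t' = 0") auto
  obtain y where "w t' y \<noteq> 0"
  proof -
    have "\<exists>y. w t' y \<noteq> 0"
    proof (rule ccontr)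
      assume "\<not> (\<exists>y. w t' y \<noteq> 0)"
      then have "S t' = 0" by (simp add: S_def)
      with S0 show False by simp
    qed
    then show ?thesis using that by blast
  qed
  moreover have "continuous_on UNIV (w t')"
    using dx[OF t'] by (intro continuous_at_imp_continuous_on) (auto intro: DERIV_isCont)
  ultimately obtain x' where x': "\<And>z. \<bar>w t' z\<bar> \<le> \<bar>w t' x'\<bar>"
    using vanishing_attains_sup_abs[OF _ lim[OF t']] by blast
  have Sx: "S t' = \<bar>w t' x'\<bar>"
    by (intro antisym up t') (auto simp: S_def intro!: cSUP_least x')
  define \<sigma> where "\<sigma> = sgn (w t' x')"
  have \<sigma>: "\<sigma> * w t' x' = S t'" "\<bar>\<sigma>\<bar> = 1"
    using S0 Sx by (auto simp: \<sigma>_def sgn_mult_self_eq abs_sgn_eq linordered_idom_class.abs_sgn mult.commute)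
  have le: "\<sigma> * a \<le> \<bar>a\<bar>" for a
    using \<sigma>(2) by (metis abs_ge_self abs_mult mult_1)
  have "((\<lambda>z. \<sigma> * w t' z) has_real_derivative \<sigma> * wx t' x') (at x')"
    by (intro DERIV_cmult dx t')
  moreover have "\<sigma> * w t' z \<le> \<sigma> * w t' x'" for z
    using le[of "w t' z"] x'[of z] \<sigma>(1) Sx by linarith
  ultimately have "\<sigma> * wx t' x' = 0"
    by (intro DERIV_local_max[of _ _ x' 1]) auto
  then have "wx t' x' = 0" using \<sigma>(2) by auto
  then have wt: "\<bar>wt t' x'\<bar> \<le> C * S t'"
    by (intro crit t' up)
  \<comment> \<open>At the fixed point \<open>x'\<close> the smooth function \<open>\<psi>\<close>
    lies below \<open>\<phi>\<close> and touches it at \<open>t'\<close>. The supremum itself need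
    not be differentiable in time, but \<open>\<psi>\<close> is, and its negative slope forces a
    larger value of \<open>\<phi>\<close> at an earlier time.\<close>
  define \<psi> where "\<psi> = (\<lambda>\<tau>. exp (- (K * \<tau>)) * (\<sigma> * w \<tau> x'))"
  define l where "l = exp (- (K * t')) * (\<sigma> * wt t' x' - K * S t')"
  have "(\<psi> has_real_derivative l) (at t')"
    unfolding \<psi>_def l_def
    by (rule derivative_eq_intros dt[OF t'] refl | simp add: \<sigma>(1) algebra_simps)+
  moreover have "l < 0"
  proof -
    have "\<sigma> * wt t' x' - K * S t' \<le> - S t'"
      using le[of "wt t' x'"] wt by (simp add: K_def algebra_simps)
    then show ?thesis unfolding l_def using S0 by (simp add: mult_less_0_iff)
  qed
  ultimately obtain d where d: "0 < d" "\<And>h. 0 < h \<Longrightarrow> h < d \<Longrightarrow> \<psi> t' < \<psi> (t' - h)"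
    using DERIV_neg_dec_left by blast
  \<comment> \<open>The cap by \<open>t'\<close> keeps \<open>t' - h\<close> inside
    \<open>[0, T]\<close>; this needs \<open>t' > 0\<close>, which the initial condition
    provided.\<close>
  define h where "h = min (d / 2) t'"
  have h: "0 < h" "h < d" "t' - h \<in> {0..T}" using d(1) t'0 t' by (auto simp: h_def)
  have "\<psi> (t' - h) \<le> \<phi> (t' - h)"
    unfolding \<psi>_def \<phi>_def using order_trans[OF le up[OF h(3)]] by simp
  also have "\<dots> \<le> \<phi> t'" by (rule max[OF h(3)])
  also have "\<dots> = \<psi> t'" by (simp add: \<psi>_def \<phi>_def \<sigma>(1))
  finally show False using d(2)[OF h(1,2)] by simp
qed

text \<open>H^3 continuity controls the orders 0, 1, 2 uniformly in \<open>x\<close>, and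
  compactness of the time interval makes the bound uniform in time. These are the orders entering
  the estimate at critical points.\<close>

lemma cauchy_solution_bounded:
  assumes u: "cauchy_solution \<epsilon> u0 u" and T: "T < \<epsilon>"
  obtains M where "\<And>t j y. t \<in> {-T..T} \<Longrightarrow> j < 3 \<Longrightarrow> \<bar>(deriv ^^ j) (u t) y\<bar> \<le> M"
proof -
  have in_e: "t \<in> {-\<epsilon><..<\<epsilon>}" if "t \<in> {-T..T}" for t
    using that T by auto
  have sob: "sobolev 3 (u t)" if "t \<in> {-T..T}" for t
    using u in_e[OF that] by (auto simp: cauchy_solution_def)
  have "\<exists>M. \<forall>t\<in>{-T..T}. \<forall>y. \<bar>(deriv ^^ j) (u t) y\<bar> \<le> M" if j: "j < 3" for j
  proof -
    have b: "\<exists>B. \<forall>y. \<bar>(deriv ^^ j) (u t) y\<bar> \<le> B" if "t \<in> {-T..T}" for t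
      using sobolev_abs_le[OF sob[OF that] j] by blast
    have "continuous_on {-T..T} (\<lambda>t. SUP y. \<bar>(deriv ^^ j) (u t) y\<bar>)"
    proof (rule continuous_on_sup_norm[OF b])
      show "((\<lambda>\<tau>. 2 * sobolev_norm 3 (\<lambda>x. u \<tau> x - u t x)) \<longlongrightarrow> 0) (at t)" if "t \<in> {-T..T}" for t
        using u in_e[OF that] by (auto simp: cauchy_solution_def intro: tendsto_mult_right_zero)
      show "\<bar>(deriv ^^ j) (u \<tau>) y - (deriv ^^ j) (u t) y\<bar> \<le> 2 * sobolev_norm 3 (\<lambda>x. u \<tau> x - u t x)"
        if "t \<in> {-T..T}" "\<tau> \<in> {-T..T}" for t \<tau> y
        using sobolev_abs_le[OF sobolev_diff(2)[OF sob[OF that(2)] sob[OF that(1)]] j]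
          sobolev_diff(1)[OF sob[OF that(2)] sob[OF that(1)], of j] j by auto
    qed
    then have "bounded ((\<lambda>t. SUP y. \<bar>(deriv ^^ j) (u t) y\<bar>) ` {-T..T})"
      by (intro compact_imp_bounded compact_continuous_image) auto
    then obtain M where M: "\<And>t. t \<in> {-T..T} \<Longrightarrow> \<bar>SUP y. \<bar>(deriv ^^ j) (u t) y\<bar>\<bar> \<le> M"
      unfolding bounded_iff by (metis imageI real_norm_def)
    have "\<bar>(deriv ^^ j) (u t) y\<bar> \<le> M" if t: "t \<in> {-T..T}" for t y
    proof -
      have "\<bar>(deriv ^^ j) (u t) y\<bar> \<le> (SUP y. \<bar>(deriv ^^ j) (u t) y\<bar>)"
        using b[OF t] by (intro cSUP_upper) (auto simp: bdd_above_def)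
      also have "\<dots> \<le> M" using M[OF t] by linarith
      finally show ?thesis .
    qed
    then show ?thesis by blast
  qed
  then obtain M where M: "\<And>j t y. j < 3 \<Longrightarrow> t \<in> {-T..T} \<Longrightarrow> \<bar>(deriv ^^ j) (u t) y\<bar> \<le> M j"
    by metis
  show ?thesis
  proof (rule that)
    show "\<bar>(deriv ^^ j) (u t) y\<bar> \<le> \<bar>M 0\<bar> + \<bar>M 1\<bar> + \<bar>M 2\<bar>" if "t \<in> {-T..T}" "j < 3" for t j y
    proof -
      have "j = 0 \<or> j = 1 \<or> j = 2" using that(2) by auto
      then show ?thesis using M[OF that(2,1), of y] by (elim disjE) auto
    qed
  qed
qed

lemma cauchy_solution_unique:
  assumes u: "cauchy_solution \<epsilon> u0 u" and v: "cauchy_solution \<epsilon> u0 v" and t: "t \<in> {-\<epsilon><..<\<epsilon>}"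
  shows "u t x = v t x"
proof -
  define T where "T = \<bar>t\<bar>"
  have T: "T < \<epsilon>" "0 \<le> T" using t by (auto simp: T_def)
  obtain Mu where Mu: "\<And>t j y. t \<in> {-T..T} \<Longrightarrow> j < 3 \<Longrightarrow> \<bar>(deriv ^^ j) (u t) y\<bar> \<le> Mu"
    using cauchy_solution_bounded[OF u T(1)] by blast
  obtain Mv where Mv: "\<And>t j y. t \<in> {-T..T} \<Longrightarrow> j < 3 \<Longrightarrow> \<bar>(deriv ^^ j) (v t) y\<bar> \<le> Mv"
    using cauchy_solution_bounded[OF v T(1)] by blast
  define M where "M = max Mu Mv"
  \<comment> \<open>The maximum principle runs forward in time; for negative \<open>t\<close> it is
    applied to the solutions with time reversed.\<close>
  define \<sigma> :: real where "\<sigma> = (if t < 0 then - 1 else 1)"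
  have \<sigma>: "\<sigma> * T = t" "\<bar>\<sigma>\<bar> = 1" by (auto simp: \<sigma>_def T_def)
  have inT: "\<sigma> * \<tau> \<in> {-T..T}" and ine: "\<sigma> * \<tau> \<in> {-\<epsilon><..<\<epsilon>}" if "\<tau> \<in> {0..T}" for \<tau>
    using that T by (auto simp: \<sigma>_def)
  have sob: "sobolev 3 (u (\<sigma> * \<tau>))" "sobolev 3 (v (\<sigma> * \<tau>))" if "\<tau> \<in> {0..T}" for \<tau>
    using u v ine[OF that] by (auto simp: cauchy_solution_def)
  have cont: "((\<lambda>\<tau>. sobolev_norm 3 (\<lambda>x. z (\<sigma> * \<tau>) x - z (\<sigma> * r) x)) \<longlongrightarrow> 0) (at r)"
    if z: "cauchy_solution \<epsilon> u0 z" and r: "r \<in> {0..T}" for z r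
  proof -
    have "((\<lambda>\<tau>. sobolev_norm 3 (\<lambda>x. z \<tau> x - z (\<sigma> * r) x)) \<longlongrightarrow> 0) (at (\<sigma> * r))"
      using z ine[OF r] by (auto simp: cauchy_solution_def)
    moreover have "filterlim (\<lambda>\<tau>. \<sigma> * \<tau>) (at (\<sigma> * r)) (at r)"
      using \<sigma>(2) by (intro filterlim_atI tendsto_intros) (auto simp: eventually_at_filter)
    ultimately show ?thesis by (rule filterlim_compose)
  qed
  let ?w = "\<lambda>\<tau> y. u (\<sigma> * \<tau>) y - v (\<sigma> * \<tau>) y"
  have "?w T x = 0"
  proof (rule maximum_principle[where w = ?w and T = T
        and e = "\<lambda>r \<tau>. 2 * sobolev_norm 3 (\<lambda>x. u (\<sigma> * \<tau>) x - u (\<sigma> * r) x)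
                      + 2 * sobolev_norm 3 (\<lambda>x. v (\<sigma> * \<tau>) x - v (\<sigma> * r) x)"
        and wx = "\<lambda>\<tau> y. deriv (u (\<sigma> * \<tau>)) y - deriv (v (\<sigma> * \<tau>)) y"
        and wt = "\<lambda>\<tau> y. \<sigma> * (flux (u (\<sigma> * \<tau>)) y - flux (v (\<sigma> * \<tau>)) y)"
        and C = "32 * M"])
    fix r y assume r: "r \<in> {0..T}"
    note su = sob(1)[OF r] and sv = sob(2)[OF r]
    have dd: "(?w r has_real_derivative deriv (u (\<sigma> * r)) y - deriv (v (\<sigma> * r)) y) (at y)" for y
      using sobolev_has_derivative[OF su, of 0] sobolev_has_derivative[OF sv, of 0]
      by (intro DERIV_diff) auto
    show "(?w r has_real_derivative deriv (u (\<sigma> * r)) y - deriv (v (\<sigma> * r)) y) (at y)" by (rule dd)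
    note sd = sobolev_diff[OF su sv]
    have "(?w r has_real_derivative deriv (?w r) y) (at y)" for y
      using sobolev_has_derivative[OF sd(2), of 0] by simp
    then show "(?w r \<longlongrightarrow> 0) at_infinity"
      by (rule square_integrable_tendsto_0_at_infinity)
         (use sobolev_integrable[OF sd(2), of 0] sobolev_integrable[OF sd(2), of 1] in auto)
    show "\<exists>B. \<forall>x. \<bar>?w r x\<bar> \<le> B"
      using sobolev_abs_le[OF sd(2), of 0] by auto
    show "((\<lambda>\<tau>. 2 * sobolev_norm 3 (\<lambda>x. u (\<sigma> * \<tau>) x - u (\<sigma> * r) x)
                      + 2 * sobolev_norm 3 (\<lambda>x. v (\<sigma> * \<tau>) x - v (\<sigma> * r) x)) \<longlongrightarrow> 0) (at r)"
      by (intro tendsto_add_zero tendsto_mult_right_zero cont u v r)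
    have chain: "((\<lambda>\<tau>. z (\<sigma> * \<tau>) y) has_real_derivative \<sigma> * flux (z (\<sigma> * r)) y) (at r)"
      if z: "cauchy_solution \<epsilon> u0 z" for z
    proof -
      have "((\<lambda>\<tau>. z \<tau> y) has_real_derivative flux (z (\<sigma> * r)) y) (at (\<sigma> * r))"
        using z ine[OF r] by (auto simp: cauchy_solution_def flux_def)
      from DERIV_chain2[OF this DERIV_cmult_Id[of \<sigma>]] show ?thesis by (simp add: mult.commute)
    qed
    show "((\<lambda>\<tau>. ?w \<tau> y) has_real_derivative \<sigma> * (flux (u (\<sigma> * r)) y - flux (v (\<sigma> * r)) y)) (at r)"
      unfolding right_diff_distrib by (intro DERIV_diff chain u v)
    show "\<bar>\<sigma> * (flux (u (\<sigma> * r)) y - flux (v (\<sigma> * r)) y)\<bar> \<le> 32 * M * m"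
      if "deriv (u (\<sigma> * r)) y - deriv (v (\<sigma> * r)) y = 0" "\<And>y. \<bar>?w r y\<bar> \<le> m" for m
    proof -
      have "\<bar>flux (u (\<sigma> * r)) y - flux (v (\<sigma> * r)) y\<bar> \<le> 32 * (M * m)"
        using that Mu[OF inT[OF r]] Mv[OF inT[OF r]]
        by (intro flux_diff_at_critical_point su sv) (auto simp: M_def le_max_iff_disj)
      then show ?thesis by (simp add: abs_mult \<sigma>(2))
    qed
  next
    fix r \<tau> y assume r: "r \<in> {0..T}" and \<tau>: "\<tau> \<in> {0..T}"
    have "\<bar>u (\<sigma> * \<tau>) y - u (\<sigma> * r) y\<bar> \<le> 2 * sobolev_norm 3 (\<lambda>x. u (\<sigma> * \<tau>) x - u (\<sigma> * r) x)"
      using sobolev_abs_le[OF sobolev_diff(2)[OF sob(1)[OF \<tau>] sob(1)[OF r]], of 0] by simp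
    moreover have "\<bar>v (\<sigma> * \<tau>) y - v (\<sigma> * r) y\<bar> \<le> 2 * sobolev_norm 3 (\<lambda>x. v (\<sigma> * \<tau>) x - v (\<sigma> * r) x)"
      using sobolev_abs_le[OF sobolev_diff(2)[OF sob(2)[OF \<tau>] sob(2)[OF r]], of 0] by simp
    ultimately show "\<bar>?w \<tau> y - ?w r y\<bar> \<le> 2 * sobolev_norm 3 (\<lambda>x. u (\<sigma> * \<tau>) x - u (\<sigma> * r) x)
        + 2 * sobolev_norm 3 (\<lambda>x. v (\<sigma> * \<tau>) x - v (\<sigma> * r) x)"
      by linarith
  next
    show "?w 0 y = 0" for y
      using u v by (simp add: cauchy_solution_def)
    show "T \<in> {0..T}" using T by simp
  qed
  then show ?thesis by (simp add: \<sigma>)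
qed

section \<open>Jets\<close>

text \<open>
  A jet consists of the normalised derivatives \<open>A j = \<partial>\<^sub>x\<^sup>j f / j!\<close>, for which the Leibniz rule is
  the Cauchy product.
\<close>

definition jet_mul :: "(nat \<Rightarrow> real \<Rightarrow> real) \<Rightarrow> (nat \<Rightarrow> real \<Rightarrow> real) \<Rightarrow> nat \<Rightarrow> real \<Rightarrow> real" where
  "jet_mul A B j x = (\<Sum>i\<le>j. A i x * B (j - i) x)"

definition jet_deriv :: "(nat \<Rightarrow> real \<Rightarrow> real) \<Rightarrow> nat \<Rightarrow> real \<Rightarrow> real" where
  "jet_deriv A j x = real (Suc j) * A (Suc j) x"

definition jet :: "(nat \<Rightarrow> real \<Rightarrow> real) \<Rightarrow> bool" where
  "jet A \<longleftrightarrow> (\<forall>j x. (A j has_real_derivative jet_deriv A j x) (at x))"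

lemma jetD: "jet A \<Longrightarrow> (A j has_real_derivative jet_deriv A j x) (at x)"
  by (simp add: jet_def)

lemma jet_measurable: "jet A \<Longrightarrow> A j \<in> borel_measurable borel"
  by (intro borel_measurable_continuous_onI continuous_at_imp_continuous_on ballI)
     (blast intro: DERIV_isCont jetD)

lemma jet_jet_deriv: "jet A \<Longrightarrow> jet (jet_deriv A)"
  unfolding jet_def[of "jet_deriv A"]
proof (intro allI)
  fix j x
  assume A: "jet A"
  show "(jet_deriv A j has_real_derivative jet_deriv (jet_deriv A) j x) (at x)"
    using DERIV_cmult[OF jetD[OF A, of "Suc j" x], of "real (Suc j)"]
    by (simp only: jet_deriv_def[abs_def])
qed

lemma jet_jet_mul:
  assumes "jet A" "jet B"
  shows "jet (jet_mul A B)"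
  unfolding jet_def
proof (intro allI)
  fix j x
  have "((\<lambda>x. \<Sum>i\<le>j. A i x * B (j - i) x) has_real_derivative
      (\<Sum>i\<le>j. jet_deriv A i x * B (j - i) x + jet_deriv B (j - i) x * A i x)) (at x)"
    by (intro DERIV_sum DERIV_mult jetD assms)
  moreover have "(\<Sum>i\<le>j. jet_deriv A i x * B (j - i) x + jet_deriv B (j - i) x * A i x) = jet_deriv (jet_mul A B) j x"
  proof -
    have "jet_deriv (jet_mul A B) j x = (\<Sum>i\<le>Suc j. real (Suc j) * (A i x * B (Suc j - i) x))"
      by (simp only: jet_deriv_def jet_mul_def sum_distrib_left)
    \<comment> \<open>The factor \<open>Suc j\<close> is split into \<open>i\<close> and
      \<open>Suc j - i\<close>, the shares of the two factors in the product rule.\<close>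
    also have "\<dots> = (\<Sum>i\<le>Suc j. real i * (A i x * B (Suc j - i) x) + real (Suc j - i) * (A i x * B (Suc j - i) x))"
      by (intro sum.cong refl) (simp only: distrib_right[symmetric] of_nat_add[symmetric] atMost_iff le_add_diff_inverse)
    also have "\<dots> = (\<Sum>i\<le>Suc j. real i * (A i x * B (Suc j - i) x)) + (\<Sum>i\<le>Suc j. real (Suc j - i) * (A i x * B (Suc j - i) x))"
      by (rule sum.distrib)
    also have "(\<Sum>i\<le>Suc j. real i * (A i x * B (Suc j - i) x)) = (\<Sum>i\<le>j. jet_deriv A i x * B (j - i) x)"
      by (simp only: sum.atMost_Suc_shift) (simp add: jet_deriv_def mult.assoc)
    also have "(\<Sum>i\<le>Suc j. real (Suc j - i) * (A i x * B (Suc j - i) x)) = (\<Sum>i\<le>j. jet_deriv B (j - i) x * A i x)"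
      by (auto simp: jet_deriv_def Suc_diff_le mult_ac intro!: sum.cong)
    finally show ?thesis by (simp add: sum.distrib)
  qed
  ultimately show "(jet_mul A B j has_real_derivative jet_deriv (jet_mul A B) j x) (at x)"
    by (simp add: jet_mul_def[abs_def])
qed

section \<open>Differentiation of convolutions through quadratic remainders\<close>

lemma quadratic_remainder_imp_derivative:
  fixes F :: "real \<Rightarrow> real"
  assumes "\<And>h. \<bar>F (x + h) - F x - h * D\<bar> \<le> M * h\<^sup>2"
  shows "(F has_real_derivative D) (at x)"
  unfolding DERIV_def
proof (rule LIM_zero_cancel, rule Lim_null_comparison)
  show "((\<lambda>h. M * \<bar>h\<bar>) \<longlongrightarrow> 0) (at 0)"
    by (rule tendsto_eq_intros refl | simp)+
  have "\<bar>(F (x + h) - F x) / h - D\<bar> \<le> M * \<bar>h\<bar>" if "h \<noteq> 0" for h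
  proof -
    have "((F (x + h) - F x) / h - D) * h = F (x + h) - F x - h * D"
      using that by (simp add: field_simps)
    then have "\<bar>(F (x + h) - F x) / h - D\<bar> * \<bar>h\<bar> = \<bar>F (x + h) - F x - h * D\<bar>"
      by (simp only: abs_mult[symmetric])
    also have "\<dots> \<le> M * \<bar>h\<bar> * \<bar>h\<bar>"
      using assms[of h] by (simp add: power2_eq_square mult.assoc)
    finally show ?thesis using that by simp
  qed
  then show "\<forall>\<^sub>F h in at 0. norm ((F (x + h) - F x) / h - D) \<le> M * \<bar>h\<bar>"
    by (simp add: eventually_at_filter)
qed

lemma quadratic_remainder_le:
  fixes f :: "real \<Rightarrow> real"
  assumes f: "\<And>y. (f has_real_derivative g y) (at y)" and g: "\<And>y. (g has_real_derivative k y) (at y)"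
    and k: "\<And>y. \<bar>k y\<bar> \<le> M"
  shows "\<bar>f (x + h) - f x - h * g x\<bar> \<le> M * h\<^sup>2"
proof -
  have M0: "0 \<le> M" using k[of 0] by linarith
  have g': "\<bar>g y - g x\<bar> \<le> M * \<bar>y - x\<bar>" for y
    using field_differentiable_bound[of UNIV g k M y x] g k by (auto simp: DERIV_subset)
  have "\<bar>(f (x + h) - (x + h) * g x) - (f x - x * g x)\<bar> \<le> M * \<bar>h\<bar> * \<bar>(x + h) - x\<bar>"
  proof -
    have "norm ((\<lambda>y. f y - y * g x) (x + h) - (\<lambda>y. f y - y * g x) x) \<le> M * \<bar>h\<bar> * norm (x + h - x)"
    proof (rule field_differentiable_bound[where S = "closed_segment x (x + h)"])
      show "((\<lambda>y. f y - y * g x) has_field_derivative g y - g x) (at y within closed_segment x (x + h))" for y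
        by (rule derivative_eq_intros DERIV_subset[OF f] refl | simp)+
      show "norm (g y - g x) \<le> M * \<bar>h\<bar>" if "y \<in> closed_segment x (x + h)" for y
      proof -
        have "\<bar>y - x\<bar> \<le> \<bar>h\<bar>"
          using segment_bound1[OF that] by (simp add: abs_minus_commute)
        then show ?thesis
          using order_trans[OF g' mult_left_mono[OF _ M0]] by simp
      qed
    qed auto
    then show ?thesis by simp
  qed
  then show ?thesis
    by (simp add: algebra_simps power2_eq_square abs_mult_self_eq)
qed

lemma convolution_swap: "(k \<star> f) x = (\<integral>z. k z * f (x - z) \<partial>lborel)"
  unfolding convolution_def
  by (subst lborel_integral_real_affine[of "-1" _ x]) auto

lemma integrable_kernel_mult_reflected:
  fixes k f :: "real \<Rightarrow> real"
  assumes "integrable lborel (\<lambda>y. k (x - y) * f y)"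
  shows "integrable lborel (\<lambda>z. k z * f (x - z))"
  using lborel_integrable_real_affine[OF assms, of "-1" x] by simp

text \<open>With the variable \<open>x\<close> moved from the kernel to \<open>f\<close>, the
  kernel's singularity at 0 is harmless. A bounded second derivative gives a quadratic remainder
  uniform in the point, and convolution preserves uniform bounds, so no limit has to be exchanged
  with the integral.\<close>

lemma convolution_has_derivative:
  assumes [measurable]: "k \<in> borel_measurable borel"
    and k: "\<And>z. \<bar>k z\<bar> \<le> kernel_G z"
    and f: "\<And>y. (f has_real_derivative g y) (at y)" and g: "\<And>y. (g has_real_derivative h y) (at y)"
    and bf: "\<And>y. \<bar>f y\<bar> \<le> F" and bg: "\<And>y. \<bar>g y\<bar> \<le> G" and bh: "\<And>y. \<bar>h y\<bar> \<le> M"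
  shows "((k \<star> f) has_real_derivative (k \<star> g) x) (at x)"
proof (rule quadratic_remainder_imp_derivative)
  fix d
  have [measurable]: "f \<in> borel_measurable borel" "g \<in> borel_measurable borel"
    using f g by (auto intro!: borel_measurable_continuous_onI continuous_at_imp_continuous_on
        intro: DERIV_isCont)
  have if': "integrable lborel (\<lambda>y. k (x' - y) * f y)" for x'
    using k bf by (intro integrable_kernel_mult_bounded[where M = F]) auto
  have ig: "integrable lborel (\<lambda>y. k (x - y) * g y)"
    using k bg by (intro integrable_kernel_mult_bounded[where M = G]) auto
  note i = integrable_kernel_mult_reflected[OF if'] integrable_kernel_mult_reflected[OF ig]
  let ?r = "\<lambda>y. f (y + d) - f y - d * g y"
  have r: "\<bar>?r y\<bar> \<le> M * d\<^sup>2" for y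
    using f g bh by (rule quadratic_remainder_le)
  have "(k \<star> f) (x + d) - (k \<star> f) x - d * (k \<star> g) x
      = (\<integral>z. k z * f (x + d - z) - k z * f (x - z) - d * (k z * g (x - z)) \<partial>lborel)"
    unfolding convolution_swap using i by simp
  also have "\<dots> = (k \<star> ?r) x"
    unfolding convolution_swap by (intro Bochner_Integration.integral_cong refl) (simp add: algebra_simps)
  finally show "\<bar>(k \<star> f) (x + d) - (k \<star> f) x - d * (k \<star> g) x\<bar> \<le> M * d\<^sup>2"
    using convolution_bound[OF _ _ k r] by simp
qed

text \<open>A bilinear version of the flux after integration by parts: at \<open>A = B\<close> and
  \<open>j = 0\<close> it is the flux itself. Two arguments are needed because the coefficient of
  \<open>t ^ n\<close> in a quadratic expression pairs the time coefficients \<open>k\<close> and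
  \<open>n - k\<close>.\<close>

definition jet_flux :: "(nat \<Rightarrow> real \<Rightarrow> real) \<Rightarrow> (nat \<Rightarrow> real \<Rightarrow> real) \<Rightarrow> nat \<Rightarrow> real \<Rightarrow> real" where
  "jet_flux A B j x = 4 * jet_mul A (jet_deriv B) j x
     + (kernel_D \<star> (\<lambda>y. 2 * jet_mul (jet_deriv A) (jet_deriv B) j y + 6 * jet_mul A B j y)) x
     + (kernel_G \<star> jet_mul (jet_deriv A) (jet_deriv B) j) x
     - jet_mul (jet_deriv A) (jet_deriv B) j x"

context slow_weight
begin

lemma le_weight_imp_bounded: "\<bar>a\<bar> \<le> c * W x \<Longrightarrow> \<bar>a\<bar> \<le> \<bar>c\<bar>"
  using mult_right_mono[OF abs_ge_self[of c] nonneg[of x]] mult_left_mono[OF le_1[of x] abs_ge_zero[of c]]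
  by simp

text \<open>A product of two bounds carries \<open>W * W\<close>; \<open>W \<le> 1\<close> brings it
  back to a single \<open>W\<close>.\<close>

lemma jet_mul_le_weight:
  assumes A: "\<And>i x. \<bar>A i x\<bar> \<le> a i * W x" and B: "\<And>i x. \<bar>B i x\<bar> \<le> b i * W x"
    and a0: "\<And>i. 0 \<le> a i" and b0: "\<And>i. 0 \<le> b i"
  shows "\<bar>jet_mul A B j x\<bar> \<le> (\<Sum>i\<le>j. a i * b (j - i)) * W x"
proof -
  have "\<bar>A i x * B (j - i) x\<bar> \<le> a i * b (j - i) * W x" for i
  proof -
    have "\<bar>A i x * B (j - i) x\<bar> \<le> (a i * W x) * (b (j - i) * W x)"
      unfolding abs_mult using a0 nonneg by (intro mult_mono A B) auto
    also have "\<dots> = (a i * b (j - i) * W x) * W x" by simp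
    also have "\<dots> \<le> (a i * b (j - i) * W x) * 1"
      using a0 b0 nonneg le_1 by (intro mult_left_mono) auto
    finally show ?thesis by simp
  qed
  then have "(\<Sum>i\<le>j. \<bar>A i x * B (j - i) x\<bar>) \<le> (\<Sum>i\<le>j. a i * b (j - i) * W x)"
    by (intro sum_mono)
  then show ?thesis
    unfolding jet_mul_def sum_distrib_right by (rule order_trans[OF sum_abs])
qed

lemma jet_convolution:
  assumes [measurable]: "k \<in> borel_measurable borel" and k: "\<And>z. \<bar>k z\<bar> \<le> kernel_G z"
    and A: "jet A" and a: "\<And>i x. \<bar>A i x\<bar> \<le> a i * W x"
  shows "jet (\<lambda>j. k \<star> A j)"
  unfolding jet_def
proof (intro allI)
  fix j x
  have b: "\<bar>A i y\<bar> \<le> \<bar>a i\<bar>" for i y by (rule le_weight_imp_bounded[OF a])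
  have b1: "\<bar>jet_deriv A i y\<bar> \<le> real (Suc i) * \<bar>a (Suc i)\<bar>" for i y
    unfolding jet_deriv_def abs_mult by (intro mult_mono b) auto
  have b2: "\<bar>jet_deriv (jet_deriv A) i y\<bar> \<le> real (Suc i) * (real (Suc (Suc i)) * \<bar>a (Suc (Suc i))\<bar>)" for i y
    unfolding jet_deriv_def[of "jet_deriv A"] abs_mult by (intro mult_mono b1) auto
  have "((k \<star> A j) has_real_derivative (k \<star> jet_deriv A j) x) (at x)"
    by (rule convolution_has_derivative[OF _ k jetD[OF A] jetD[OF jet_jet_deriv[OF A]] b b1 b2]) measurable
  also have "(k \<star> jet_deriv A j) x = jet_deriv (\<lambda>j. k \<star> A j) j x"
    by (simp only: jet_deriv_def[abs_def] convolution_cmult)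
  finally show "((k \<star> A j) has_real_derivative jet_deriv (\<lambda>j. k \<star> A j) j x) (at x)" .
qed

text \<open>One sequence bounds both a jet and its derivative, so all products obey the same
  Cauchy-product bound. Convolution doubles a bound, and the constant is 4 + 2 * (2 + 6) + 2 + 1 =
  23.\<close>

lemma jet_flux_estimate:
  assumes A: "jet A" and B: "jet B" and a0: "\<And>i. 0 \<le> a i" and b0: "\<And>i. 0 \<le> b i"
    and Aa: "\<And>i x. \<bar>A i x\<bar> \<le> a i * W x" and A'a: "\<And>i x. \<bar>jet_deriv A i x\<bar> \<le> a i * W x"
    and Bb: "\<And>i x. \<bar>B i x\<bar> \<le> b i * W x" and B'b: "\<And>i x. \<bar>jet_deriv B i x\<bar> \<le> b i * W x"
  shows "jet (jet_flux A B)"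
    and "\<bar>jet_flux A B j x\<bar> \<le> 23 * (\<Sum>i\<le>j. a i * b (j - i)) * W x"
proof -
  define S where "S = (\<lambda>j. \<Sum>i\<le>j. a i * b (j - i))"
  have S0: "0 \<le> S j" for j unfolding S_def using a0 b0 by (intro sum_nonneg) auto
  define P Q T where "P = jet_mul A (jet_deriv B)" and "Q = jet_mul (jet_deriv A) (jet_deriv B)"
    and "T = (\<lambda>j y. 2 * Q j y + 6 * jet_mul A B j y)"
  have jP: "jet P" and jQ: "jet Q" and jm: "jet (jet_mul A B)"
    unfolding P_def Q_def by (intro jet_jet_mul jet_jet_deriv A B)+
  have jT: "jet T"
    unfolding jet_def
  proof (intro allI)
    fix j x
    show "(T j has_real_derivative jet_deriv T j x) (at x)"
      unfolding T_def
      by (rule derivative_eq_intros jetD[OF jQ] jetD[OF jm] refl | simp add: jet_deriv_def algebra_simps)+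
  qed
  have bP: "\<bar>P j x\<bar> \<le> S j * W x" and bQ: "\<bar>Q j x\<bar> \<le> S j * W x" and bm: "\<bar>jet_mul A B j x\<bar> \<le> S j * W x" for j x
    unfolding P_def Q_def S_def by (intro jet_mul_le_weight Aa Bb A'a B'b a0 b0)+
  have bT: "\<bar>T j x\<bar> \<le> 8 * S j * W x" for j x
    using bQ[of j x] bm[of j x] unfolding T_def abs_le_iff by argo
  have kG: "\<bar>kernel_G z\<bar> \<le> kernel_G z" for z by (simp add: kernel_G_nonneg)
  note jDT = jet_convolution[OF kernel_D_measurable kernel_D_abs_le jT bT]
  note jGQ = jet_convolution[OF kernel_G_measurable kG jQ bQ]
  have eq: "jet_flux A B = (\<lambda>j x. 4 * P j x + (kernel_D \<star> T j) x + (kernel_G \<star> Q j) x - Q j x)"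
    by (intro ext) (simp add: jet_flux_def P_def Q_def T_def)
  show "jet (jet_flux A B)"
    unfolding jet_def eq
  proof (intro allI)
    fix j x
    have "((\<lambda>x. 4 * P j x + (kernel_D \<star> T j) x + (kernel_G \<star> Q j) x - Q j x) has_real_derivative
        4 * jet_deriv P j x + jet_deriv (\<lambda>j. kernel_D \<star> T j) j x + jet_deriv (\<lambda>j. kernel_G \<star> Q j) j x - jet_deriv Q j x) (at x)"
      by (intro DERIV_diff DERIV_add DERIV_cmult jetD[OF jP] jetD[OF jQ] jetD[OF jDT] jetD[OF jGQ])
    then show "((\<lambda>x. 4 * P j x + (kernel_D \<star> T j) x + (kernel_G \<star> Q j) x - Q j x) has_real_derivative
        jet_deriv (\<lambda>j x. 4 * P j x + (kernel_D \<star> T j) x + (kernel_G \<star> Q j) x - Q j x) j x) (at x)"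
      by (simp add: jet_deriv_def algebra_simps)
  qed
  have "\<bar>(kernel_D \<star> T j) x\<bar> \<le> 2 * (8 * S j) * W x"
    using S0 by (intro convolution_le_weight jet_measurable[OF jT] bT kernel_D_abs_le) auto
  moreover have "\<bar>(kernel_G \<star> Q j) x\<bar> \<le> 2 * S j * W x"
    using S0 by (intro convolution_le_weight jet_measurable[OF jQ] bQ kG) auto
  ultimately have "\<bar>jet_flux A B j x\<bar> \<le> 23 * S j * W x"
    using bP[of j x] bQ[of j x] unfolding eq abs_le_iff by argo
  then show "\<bar>jet_flux A B j x\<bar> \<le> 23 * (\<Sum>i\<le>j. a i * b (j - i)) * W x"
    by (simp add: S_def)
qed

end

section \<open>Discrete convolution bounds for the majorants\<close>

lemma sum_inverse_squares_le: "(\<Sum>m\<le>N. 1 / (real m + 1)\<^sup>2) \<le> 2 - 1 / (real N + 1)"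
proof (induction N)
  case (Suc N)
  have "1 / (real N + 2)\<^sup>2 \<le> 1 / ((real N + 1) * (real N + 2))"
    by (rule divide_left_mono) (auto simp: power2_eq_square)
  also have "\<dots> = 1 / (real N + 1) - 1 / (real N + 2)"
    by (simp add: divide_simps)
  finally show ?case using Suc by (simp add: add.commute)
qed simp

text \<open>With \<open>a = m + 1\<close> and \<open>b = N - m + 1\<close> one has
  \<open>1 / (a * b) = (1 / a + 1 / b) / (a + b)\<close>, and \<open>a + b\<close> is at least
  \<open>N + 1\<close>. This extracts the decay in \<open>N\<close> and leaves two sums of inverse
  squares, each at most 2.\<close>

lemma sum_inverse_squares_convolution_le:
  "(\<Sum>m\<le>N. 1 / ((real m + 1)\<^sup>2 * (real (N - m) + 1)\<^sup>2)) \<le> 8 / (real N + 1)\<^sup>2"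
proof -
  have le: "1 / ((real m + 1)\<^sup>2 * (real (N - m) + 1)\<^sup>2)
      \<le> 2 / (real N + 1)\<^sup>2 * (1 / (real m + 1)\<^sup>2 + 1 / (real (N - m) + 1)\<^sup>2)" if "m \<le> N" for m
  proof -
    define a b where "a = real m + 1" and "b = real (N - m) + 1"
    have ab: "0 < a" "0 < b" "real N + 1 \<le> a + b" using that by (auto simp: a_def b_def of_nat_diff)
    have "1 / a + 1 / b = (a + b) / (a * b)"
      using ab by (simp add: field_simps)
    then have "1 / (a\<^sup>2 * b\<^sup>2) = (1 / a + 1 / b)\<^sup>2 / (a + b)\<^sup>2"
      using ab by (simp add: power_divide power_mult_distrib)
    also have "\<dots> \<le> (1 / a + 1 / b)\<^sup>2 / (real N + 1)\<^sup>2"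
      using ab by (intro divide_left_mono power_mono mult_pos_pos) auto
    also have "\<dots> \<le> (2 * (1 / a\<^sup>2 + 1 / b\<^sup>2)) / (real N + 1)\<^sup>2"
    proof (rule divide_right_mono)
      show "(1 / a + 1 / b)\<^sup>2 \<le> 2 * (1 / a\<^sup>2 + 1 / b\<^sup>2)"
        using zero_le_power2[of "1 / a - 1 / b"] by (simp add: power2_eq_square algebra_simps)
    qed simp
    finally show ?thesis by (simp add: a_def b_def)
  qed
  have "(\<Sum>m\<le>N. 1 / ((real m + 1)\<^sup>2 * (real (N - m) + 1)\<^sup>2))
      \<le> (\<Sum>m\<le>N. 2 / (real N + 1)\<^sup>2 * (1 / (real m + 1)\<^sup>2 + 1 / (real (N - m) + 1)\<^sup>2))"
    using le by (intro sum_mono) auto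
  also have "\<dots> = 2 / (real N + 1)\<^sup>2 * ((\<Sum>m\<le>N. 1 / (real m + 1)\<^sup>2) + (\<Sum>m\<le>N. 1 / (real (N - m) + 1)\<^sup>2))"
    by (simp only: sum.distrib[symmetric] sum_distrib_left)
  also have "(\<Sum>m\<le>N. 1 / (real (N - m) + 1)\<^sup>2) = (\<Sum>m\<le>N. 1 / (real m + 1)\<^sup>2)"
    using sum.nat_diff_reindex[of "\<lambda>m. 1 / (real m + 1)\<^sup>2" "Suc N"] by (simp add: lessThan_Suc_atMost)
  also have "2 / (real N + 1)\<^sup>2 * ((\<Sum>m\<le>N. 1 / (real m + 1)\<^sup>2) + (\<Sum>m\<le>N. 1 / (real m + 1)\<^sup>2))
      \<le> 2 / (real N + 1)\<^sup>2 * (2 + 2)"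
  proof -
    have "(\<Sum>m\<le>N. 1 / (real m + 1)\<^sup>2) \<le> 2"
      using sum_inverse_squares_le[of N] by (rule order_trans) simp
    then show ?thesis by (intro mult_left_mono add_mono) auto
  qed
  finally show ?thesis by simp
qed

text \<open>The weight depends only on the total order \<open>m = k + i\<close>. Summing over
  \<open>k\<close> at fixed \<open>m\<close> is Vandermonde's convolution, whose value no longer
  depends on \<open>m\<close>.\<close>

lemma sum_binomial_product_le:
  fixes g :: "nat \<Rightarrow> real"
  assumes g: "\<And>m. 0 \<le> g m"
  shows "(\<Sum>k\<le>n. \<Sum>i\<le>j. real (k + i choose k) * real ((n - k) + (j - i) choose (n - k)) * g (k + i))
    \<le> real (n + j choose n) * (\<Sum>m\<le>n + j. g m)"
proof -
  let ?c = "\<lambda>k m. real (m choose k) * real ((n + j) - m choose (n - k)) * g m"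
  have "(\<Sum>i\<le>j. real (k + i choose k) * real ((n - k) + (j - i) choose (n - k)) * g (k + i)) \<le> (\<Sum>m\<le>n + j. ?c k m)"
    if k: "k \<le> n" for k
  proof -
    have "(\<Sum>i\<le>j. real (k + i choose k) * real ((n - k) + (j - i) choose (n - k)) * g (k + i)) = (\<Sum>i\<le>j. ?c k (k + i))"
    proof (rule sum.cong[OF refl])
      fix i assume "i \<in> {..j}"
      then have "n + j - (k + i) = (n - k) + (j - i)" using k by simp
      then show "real (k + i choose k) * real ((n - k) + (j - i) choose (n - k)) * g (k + i) = ?c k (k + i)"
        by (simp only:)
    qed
    also have "\<dots> = (\<Sum>m\<in>(\<lambda>i. k + i) ` {..j}. ?c k m)"
      by (subst sum.reindex) auto
    also have "\<dots> \<le> (\<Sum>m\<le>n + j. ?c k m)"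
      using k g by (intro sum_mono2) auto
    finally show ?thesis .
  qed
  then have "(\<Sum>k\<le>n. \<Sum>i\<le>j. real (k + i choose k) * real ((n - k) + (j - i) choose (n - k)) * g (k + i))
      \<le> (\<Sum>k\<le>n. \<Sum>m\<le>n + j. ?c k m)"
    by (intro sum_mono) auto
  also have "\<dots> = (\<Sum>m\<le>n + j. \<Sum>k\<le>n. ?c k m)"
    by (rule sum.swap)
  also have "\<dots> = (\<Sum>m\<le>n + j. real (n + j choose n) * g m)"
  proof (rule sum.cong[OF refl])
    fix m assume m: "m \<in> {..n + j}"
    have "(\<Sum>k\<le>n. ?c k m) = real (\<Sum>k\<le>n. (m choose k) * ((n + j) - m choose (n - k))) * g m"
      by (simp add: sum_distrib_right)
    also have "(\<Sum>k\<le>n. (m choose k) * ((n + j) - m choose (n - k))) = (n + j choose n)"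
      using vandermonde[of m "n + j - m" n] m by simp
    finally show "(\<Sum>k\<le>n. ?c k m) = real (n + j choose n) * g m" .
  qed
  finally show ?thesis by (simp add: sum_distrib_left)
qed

section \<open>The time-Taylor coefficients\<close>

text \<open>Comparing coefficients of \<open>t ^ n\<close> in the equation gives
  \<open>n + 1\<close> times the next coefficient. Whole jets are carried along because order
  \<open>j\<close> of the next coefficient uses order \<open>j + 1\<close> of the earlier
  ones.\<close>

fun taylor_jet :: "(real \<Rightarrow> real) \<Rightarrow> nat \<Rightarrow> nat \<Rightarrow> real \<Rightarrow> real" where
  "taylor_jet u0 0 = (\<lambda>j x. (deriv ^^ j) u0 x / fact j)"
| "taylor_jet u0 (Suc n) =
    (\<lambda>j x. (\<Sum>k\<le>n. jet_flux (taylor_jet u0 k) (taylor_jet u0 (n - k)) j x) / real (Suc n))"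

lemma jet_sum_divide:
  assumes "\<And>k. k \<in> I \<Longrightarrow> jet (A k)"
  shows "jet (\<lambda>j x. (\<Sum>k\<in>I. A k j x) / c)"
  unfolding jet_def
proof (intro allI)
  fix j x
  have "((\<lambda>x. (\<Sum>k\<in>I. A k j x) / c) has_real_derivative (\<Sum>k\<in>I. jet_deriv (A k) j x) / c) (at x)"
    by (intro DERIV_cdivide DERIV_sum jetD assms)
  then show "((\<lambda>x. (\<Sum>k\<in>I. A k j x) / c) has_real_derivative jet_deriv (\<lambda>j x. (\<Sum>k\<in>I. A k j x) / c) j x) (at x)"
    by (simp only: jet_deriv_def sum_distrib_left times_divide_eq_right)
qed

text \<open>The constant is 1472 = 23 * 8 * 8: the flux estimate, the convolution of inverse
  squares, and the comparison of \<open>N + 1\<close> with \<open>2 * N\<close> in the cubic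
  denominator.\<close>

lemma (in slow_weight) taylor_jet_estimate:
  fixes \<kappa> R B :: real
  assumes smooth: "smooth u0" and \<kappa>: "0 < \<kappa>" and R: "0 < R"
    and u0: "\<And>j x. \<bar>(deriv ^^ j) u0 x\<bar> \<le> \<kappa> * R ^ j * fact j / (real j + 1) ^ 3 * W x"
    and B: "B = 1472 * \<kappa> * (1 + R)\<^sup>2"
  shows "jet (taylor_jet u0 n) \<and>
    (\<forall>j x. \<bar>taylor_jet u0 n j x\<bar> \<le> \<kappa> * B ^ n * R ^ j * real (n + j choose n) / (real (n + j) + 1) ^ 3 * W x)"
proof (induction n rule: less_induct)
  case (less n)
  define h where "h = (\<lambda>n j. \<kappa> * B ^ n * R ^ j * real (n + j choose n) / (real (n + j) + 1) ^ 3)"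
  \<comment> \<open>A common majorant for a coefficient and its first derivative: the derivative
    costs one power of the denominator and a factor \<open>R\<close>, and \<open>1 + R\<close>
    covers both cases.\<close>
  define e where "e = (\<lambda>n j. \<kappa> * (1 + R) * B ^ n * R ^ j * real (n + j choose n) / (real (n + j) + 1)\<^sup>2)"
  have B0: "0 < B" using \<kappa> R B by simp
  show ?case
  proof (cases n)
    case 0
    have "jet (\<lambda>j x. (deriv ^^ j) u0 x / fact j)"
      unfolding jet_def
    proof (intro allI)
      fix j x
      have "((\<lambda>x. (deriv ^^ j) u0 x / fact j) has_real_derivative (deriv ^^ Suc j) u0 x / fact j) (at x)"
        by (intro DERIV_cdivide deriv_funpow_has_derivative smooth)
      then show "((\<lambda>x. (deriv ^^ j) u0 x / fact j) has_real_derivative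
          jet_deriv (\<lambda>j x. (deriv ^^ j) u0 x / fact j) j x) (at x)"
        by (simp add: jet_deriv_def fact_Suc del: funpow.simps)
    qed
    moreover have "\<bar>(deriv ^^ j) u0 x / fact j\<bar> \<le> \<kappa> * R ^ j / (real j + 1) ^ 3 * W x" for j x
      using u0[of j x] by (simp add: field_simps)
    ultimately show ?thesis by (simp add: 0)
  next
    case (Suc n')
    have IH: "jet (taylor_jet u0 k)" "\<And>j x. \<bar>taylor_jet u0 k j x\<bar> \<le> h k j * W x" if "k \<le> n'" for k
      using less.IH[of k] that by (auto simp: Suc h_def)
    have e0: "0 \<le> e k j" for k j using \<kappa> R B0 by (simp add: e_def)
    have he: "h k j \<le> e k j" "real (Suc j) * h k (Suc j) \<le> e k j" for k j
    proof -
      let ?p = "\<kappa> * B ^ k * R ^ j * real (k + j choose k)" and ?N = "real (k + j) + 1"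
      have p0: "0 \<le> ?p" using \<kappa> R B0 by simp
      have e_eq: "e k j = ?p * (1 / ?N\<^sup>2) + ?p * R * (1 / ?N\<^sup>2)"
        by (simp add: e_def field_simps)
      have "h k j = ?p * (1 / ?N ^ 3)" by (simp add: h_def)
      also have "\<dots> \<le> ?p * (1 / ?N\<^sup>2)"
        using p0 by (intro mult_left_mono divide_left_mono power_increasing) auto
      also have "\<dots> \<le> e k j" using p0 R by (simp add: e_eq)
      finally show "h k j \<le> e k j" .
      \<comment> \<open>The factor \<open>j + 1\<close> of the x-derivative becomes the total order
        \<open>k + j + 1\<close>, which cancels one power of the denominator.\<close>
      have "Suc j * (Suc (k + j) choose k) = Suc (k + j) * (k + j choose k)"
        using binomial_absorb_comp[of "Suc (k + j)" k] by simp
      then have bin: "real (Suc j) * real (Suc (k + j) choose k) = ?N * real (k + j choose k)"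
        by (metis of_nat_mult of_nat_Suc add.commute)
      have "real (Suc j) * h k (Suc j)
          = \<kappa> * B ^ k * R ^ Suc j * (real (Suc j) * real (Suc (k + j) choose k)) / (?N + 1) ^ 3"
        by (simp add: h_def add.commute add.left_commute)
      also have "\<dots> = ?p * R * (?N / (?N + 1) ^ 3)"
        unfolding bin by simp
      also have "?N / (?N + 1) ^ 3 \<le> ?N / ?N ^ 3"
        by (intro divide_left_mono power_mono) auto
      also have "?N / ?N ^ 3 = 1 / ?N\<^sup>2" by (simp add: power3_eq_cube power2_eq_square)
      also have "?p * R * (1 / ?N\<^sup>2) \<le> e k j" using p0 by (simp add: e_eq)
      finally show "real (Suc j) * h k (Suc j) \<le> e k j"
        using p0 R by (simp add: mult_left_mono)
    qed
    have b: "\<bar>taylor_jet u0 k j x\<bar> \<le> e k j * W x" if "k \<le> n'" for k j x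
      using order_trans[OF IH(2)[OF that] mult_right_mono[OF he(1) nonneg]] .
    have b': "\<bar>jet_deriv (taylor_jet u0 k) j x\<bar> \<le> e k j * W x" if "k \<le> n'" for k j x
    proof -
      have "\<bar>jet_deriv (taylor_jet u0 k) j x\<bar> \<le> real (Suc j) * (h k (Suc j) * W x)"
        unfolding jet_deriv_def abs_mult using IH(2)[OF that] by (intro mult_mono) auto
      also have "\<dots> \<le> e k j * W x"
        using mult_right_mono[OF he(2) nonneg] by (simp only: mult.assoc)
      finally show ?thesis .
    qed
    have fl: "jet (jet_flux (taylor_jet u0 k) (taylor_jet u0 (n' - k)))"
        "\<bar>jet_flux (taylor_jet u0 k) (taylor_jet u0 (n' - k)) j x\<bar> \<le> 23 * (\<Sum>i\<le>j. e k i * e (n' - k) (j - i)) * W x"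
      if "k \<le> n'" for k j x
      using that by (intro jet_flux_estimate[where a = "e k" and b = "e (n' - k)"] IH(1) b b' e0; simp)+
    have "jet (taylor_jet u0 n)"
      unfolding Suc taylor_jet.simps using fl(1) by (intro jet_sum_divide) auto
    moreover have "\<bar>taylor_jet u0 n j x\<bar> \<le> h n j * W x" for j x
    proof -
      let ?N = "real (n' + j) + 1" and ?bin = "real (n' + j choose n')"
      let ?q = "\<lambda>m. 1 / ((real m + 1)\<^sup>2 * (real (n' + j - m) + 1)\<^sup>2)"
      have "(\<Sum>k\<le>n'. \<Sum>i\<le>j. e k i * e (n' - k) (j - i))
          = (\<Sum>k\<le>n'. \<Sum>i\<le>j. (\<kappa> * (1 + R))\<^sup>2 * B ^ n' * R ^ j *
              (real (k + i choose k) * real ((n' - k) + (j - i) choose (n' - k)) * ?q (k + i)))"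
      proof (intro sum.cong refl)
        fix k i assume "k \<in> {..n'}" "i \<in> {..j}"
        then have "B ^ n' = B ^ k * B ^ (n' - k)" "R ^ j = R ^ i * R ^ (j - i)"
          "n' + j - (k + i) = (n' - k) + (j - i)"
          by (auto simp flip: power_add)
        then show "e k i * e (n' - k) (j - i) = (\<kappa> * (1 + R))\<^sup>2 * B ^ n' * R ^ j *
              (real (k + i choose k) * real ((n' - k) + (j - i) choose (n' - k)) * ?q (k + i))"
          by (simp add: e_def power2_eq_square)
      qed
      also have "\<dots> = (\<kappa> * (1 + R))\<^sup>2 * B ^ n' * R ^ j * (\<Sum>k\<le>n'. \<Sum>i\<le>j.
              real (k + i choose k) * real ((n' - k) + (j - i) choose (n' - k)) * ?q (k + i))"
        by (simp only: sum_distrib_left)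
      also have "\<dots> \<le> (\<kappa> * (1 + R))\<^sup>2 * B ^ n' * R ^ j * (?bin * (8 / ?N\<^sup>2))"
      proof (rule mult_left_mono)
        have "(\<Sum>k\<le>n'. \<Sum>i\<le>j. real (k + i choose k) * real ((n' - k) + (j - i) choose (n' - k)) * ?q (k + i))
            \<le> ?bin * (\<Sum>m\<le>n' + j. ?q m)"
          by (rule sum_binomial_product_le) simp
        also have "\<dots> \<le> ?bin * (8 / ?N\<^sup>2)"
          by (rule mult_left_mono[OF sum_inverse_squares_convolution_le]) simp
        finally show "(\<Sum>k\<le>n'. \<Sum>i\<le>j. real (k + i choose k) * real ((n' - k) + (j - i) choose (n' - k)) * ?q (k + i))
            \<le> ?bin * (8 / ?N\<^sup>2)" .
      qed (use R B0 in auto)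
      finally have S: "(\<Sum>k\<le>n'. \<Sum>i\<le>j. e k i * e (n' - k) (j - i)) \<le> (\<kappa> * (1 + R))\<^sup>2 * B ^ n' * R ^ j * (?bin * (8 / ?N\<^sup>2))" .
      have "23 * (\<Sum>k\<le>n'. \<Sum>i\<le>j. e k i * e (n' - k) (j - i))
          \<le> 23 * ((\<kappa> * (1 + R))\<^sup>2 * B ^ n' * R ^ j * (?bin * (8 / ?N\<^sup>2)))"
        using S by simp
      \<comment> \<open>Here 23 * 8 * \<open>\<kappa> * (1 + R) ^ 2\<close> equals
        \<open>B / 8\<close>: the quadratic dependence on \<open>\<kappa>\<close> is traded for one
        more power of \<open>B\<close>.\<close>
      also have "\<dots> = \<kappa> * B ^ Suc n' * R ^ j * ?bin * (1 / (8 * ?N\<^sup>2))"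
        by (simp add: B power2_eq_square)
      also have "\<dots> \<le> \<kappa> * B ^ Suc n' * R ^ j * ?bin * (?N / (?N + 1) ^ 3)"
      proof (rule mult_left_mono)
        have "(?N + 1) ^ 3 \<le> (2 * ?N) ^ 3" by (intro power_mono) auto
        then have "?N / (2 * ?N) ^ 3 \<le> ?N / (?N + 1) ^ 3"
          by (intro divide_left_mono) auto
        moreover have "?N / (2 * ?N) ^ 3 = 1 / (8 * ?N\<^sup>2)"
        proof -
          have "a / (2 * a) ^ 3 = 1 / (8 * a\<^sup>2)" for a :: real
            by (simp add: power_mult_distrib power3_eq_cube power2_eq_square)
          then show ?thesis .
        qed
        ultimately show "1 / (8 * ?N\<^sup>2) \<le> ?N / (?N + 1) ^ 3" by simp
      qed (use \<kappa> R B0 in auto)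
      also have "\<dots> = real (Suc n') * h n j"
      proof -
        \<comment> \<open>The companion identity in time: dividing by \<open>n' + 1\<close> removes
          the total order again and thereby recovers the cubic denominator.\<close>
        have "Suc n' * (Suc (n' + j) choose Suc n') = Suc (n' + j) * (n' + j choose n')"
          by (rule Suc_times_binomial)
        then have bin: "real (Suc n') * real (Suc (n' + j) choose Suc n') = ?N * ?bin"
          by (metis of_nat_mult of_nat_Suc add.commute)
        have "real (Suc n') * h n j = \<kappa> * B ^ Suc n' * R ^ j * (real (Suc n') * real (Suc (n' + j) choose Suc n')) / (?N + 1) ^ 3"
          by (simp add: h_def Suc add.commute add.left_commute)
        then show ?thesis unfolding bin by simp
      qed
      finally have key: "23 * (\<Sum>k\<le>n'. \<Sum>i\<le>j. e k i * e (n' - k) (j - i)) \<le> real (Suc n') * h n j" .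
      have "\<bar>\<Sum>k\<le>n'. jet_flux (taylor_jet u0 k) (taylor_jet u0 (n' - k)) j x\<bar>
          \<le> (\<Sum>k\<le>n'. 23 * (\<Sum>i\<le>j. e k i * e (n' - k) (j - i)) * W x)"
        using fl(2) by (intro order_trans[OF sum_abs] sum_mono) auto
      also have "\<dots> = 23 * (\<Sum>k\<le>n'. \<Sum>i\<le>j. e k i * e (n' - k) (j - i)) * W x"
        by (simp only: sum_distrib_left sum_distrib_right)
      also have "\<dots> \<le> real (Suc n') * h n j * W x"
        by (rule mult_right_mono[OF key nonneg])
      finally show ?thesis
        by (simp add: Suc abs_divide divide_le_eq mult_ac del: of_nat_Suc)
    qed
    ultimately show ?thesis by (simp add: h_def)
  qed
qed

lemma cube_le_8_power: "(real j + 1) ^ 3 \<le> 8 ^ j"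
proof -
  have "Suc j \<le> 2 ^ j" by (rule Suc_leI[OF less_exp])
  then have "real j + 1 \<le> 2 ^ j" by (metis of_nat_Suc of_nat_le_iff of_nat_numeral of_nat_power add.commute)
  then have "(real j + 1) ^ 3 \<le> (2 ^ j) ^ 3" by (intro power_mono) auto
  also have "(2 ^ j :: real) ^ 3 = 8 ^ j" by (simp flip: power_mult add: mult.commute[of j] power_mult)
  finally show ?thesis .
qed

text \<open>Once the recursion is closed, the polynomial weights and binomials have done their work
  and plain geometric bounds suffice for the series.\<close>

lemma (in slow_weight) taylor_jet_geometric:
  assumes smooth: "smooth u0" and s: "0 < s" and C: "0 \<le> C"
    and u0: "\<And>j x. \<bar>(deriv ^^ j) u0 x\<bar> \<le> C * fact j * (1 / s) ^ j * W x"
  obtains \<kappa> \<rho> \<sigma> :: real where "0 < \<kappa>" "0 < \<rho>" "0 < \<sigma>"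
    "\<And>n. jet (taylor_jet u0 n)" "\<And>n j x. \<bar>taylor_jet u0 n j x\<bar> \<le> \<kappa> * \<rho> ^ n * \<sigma> ^ j * W x"
proof -
  \<comment> \<open>The initial bound has no cubic denominator;
    \<open>(j + 1) ^ 3 \<le> 8 ^ j\<close> inserts one at the price of the 8 in \<open>R\<close>.
    The 1 added to \<open>C\<close> ensures positivity.\<close>
  define \<kappa> R B where "\<kappa> = C + 1" and "R = 8 / s" and "B = 1472 * (C + 1) * (1 + 8 / s)\<^sup>2"
  have pos: "0 < \<kappa>" "0 < R" "0 < B" 
    using s C unfolding \<kappa>_def R_def B_def
    by (auto intro!: mult_pos_pos zero_less_power add_pos_pos add_nonneg_pos simp del: mult_pos_pos distrib_left_numeral)
  have "\<bar>(deriv ^^ j) u0 x\<bar> \<le> \<kappa> * R ^ j * fact j / (real j + 1) ^ 3 * W x" for j x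
  proof -
    have "1 \<le> 8 ^ j / (real j + 1) ^ 3"
      using cube_le_8_power[of j] by simp
    then have "C * 1 \<le> \<kappa> * (8 ^ j / (real j + 1) ^ 3)"
      using C by (intro mult_mono) (auto simp: \<kappa>_def)
    then have "C * (fact j * (1 / s) ^ j * W x) \<le> \<kappa> * (8 ^ j / (real j + 1) ^ 3) * (fact j * (1 / s) ^ j * W x)"
      using s nonneg by (intro mult_right_mono) auto
    also have "\<dots> = \<kappa> * R ^ j * fact j / (real j + 1) ^ 3 * W x"
      by (simp add: R_def power_divide mult_ac)
    finally show ?thesis using u0[of j x] by (simp add: mult_ac)
  qed
  note est = taylor_jet_estimate[OF smooth pos(1,2) this, of B]
  have Beq: "B = 1472 * \<kappa> * (1 + R)\<^sup>2" by (simp add: B_def \<kappa>_def R_def)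
  show ?thesis
  proof (rule that[of \<kappa> "2 * B" "2 * R"])
    show "jet (taylor_jet u0 n)" for n using est[OF Beq] by blast
    fix n j x
    \<comment> \<open>The factor \<open>2 ^ (n + j)\<close> is shared out to \<open>B\<close> and
      \<open>R\<close>, which explains the doubled rates.\<close>
    have "real (n + j choose n) / (real (n + j) + 1) ^ 3 \<le> 2 ^ (n + j)"
    proof -
      have "real (n + j choose n) \<le> 2 ^ (n + j)"
        using binomial_le_pow2[of "n + j" n] by (metis of_nat_le_iff of_nat_numeral of_nat_power)
      moreover have "1 \<le> (real (n + j) + 1) ^ 3" by (rule one_le_power) simp
      ultimately show ?thesis
        using frac_le[of "2 ^ (n + j)" "real (n + j choose n)" 1 "(real (n + j) + 1) ^ 3"] by simp
    qed
    then have "\<kappa> * B ^ n * R ^ j * (real (n + j choose n) / (real (n + j) + 1) ^ 3) \<le> \<kappa> * B ^ n * R ^ j * 2 ^ (n + j)"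
      using pos by (intro mult_left_mono) auto
    also have "\<dots> = \<kappa> * (2 * B) ^ n * (2 * R) ^ j"
      by (simp add: power_add power_mult_distrib)
    finally have "\<kappa> * B ^ n * R ^ j * real (n + j choose n) / (real (n + j) + 1) ^ 3 * W x
        \<le> \<kappa> * (2 * B) ^ n * (2 * R) ^ j * W x"
      using nonneg by (intro mult_right_mono) auto
    with est[OF Beq, of n] show "\<bar>taylor_jet u0 n j x\<bar> \<le> \<kappa> * (2 * B) ^ n * (2 * R) ^ j * W x"
      by (meson order_trans)
  qed (use pos in auto)
qed

section \<open>Re-expansion of power series\<close>

text \<open>Expanding \<open>(t0 + d) ^ n\<close> binomially gives an absolutely summable family in
  \<open>n\<close>, \<open>m\<close>, \<open>i\<close>, which may be summed in either order. The
  resulting coefficients involve neither \<open>d\<close> nor \<open>h\<close>, so a single array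
  serves a whole neighbourhood.\<close>

lemma power_series_reexpansion:
  fixes c :: "nat \<Rightarrow> nat \<Rightarrow> real"
  assumes c: "\<And>n i. \<bar>c n i\<bar> \<le> K * \<rho> ^ n * \<sigma> ^ i"
    and nn: "0 \<le> K" "0 \<le> \<rho>" "0 \<le> \<sigma>"
    and \<rho>: "\<rho> * (\<bar>d\<bar> + \<bar>t0\<bar>) < 1" and \<sigma>: "\<sigma> * \<bar>h\<bar> < 1"
    and f: "\<And>n. (\<lambda>i. c n i * h ^ i) sums f n"
  shows "((\<lambda>(m, i). (\<Sum>\<^sub>\<infinity>n. real (n choose m) * t0 ^ (n - m) * c n i) * d ^ m * h ^ i) has_sum
           (\<Sum>n. f n * (t0 + d) ^ n)) UNIV"
proof -
  define b where "b = (\<lambda>n m. \<rho> ^ n * (real (n choose m) * \<bar>d\<bar> ^ m * \<bar>t0\<bar> ^ (n - m)))"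
  define T where "T = (\<lambda>((n, m), i). (real (n choose m) * d ^ m * t0 ^ (n - m)) * (c n i * h ^ i))"
  let ?r = "\<rho> * (\<bar>d\<bar> + \<bar>t0\<bar>)"
  have r0: "0 \<le> ?r" and s0: "0 \<le> \<sigma> * \<bar>h\<bar>" using nn by auto
  have "(\<lambda>(n, m). b n m) summable_on UNIV \<times> UNIV"
  proof (rule summable_on_SigmaI)
    \<comment> \<open>For \<open>m > n\<close> the truncated exponent \<open>n - m\<close> is
      harmless, because the binomial coefficient is 0.\<close>
    show "((\<lambda>m. case (n, m) of (n, m) \<Rightarrow> b n m) has_sum ?r ^ n) UNIV" for n
      by (rule has_sum_finite_neutralI[of "{..n}"])
         (auto simp: b_def power_mult_distrib binomial_ring sum_distrib_left)
    show "(\<lambda>n. ?r ^ n) summable_on UNIV"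
      using r0 \<rho> by (intro norm_summable_imp_summable_on) (auto simp: norm_power intro!: summable_geometric)
  qed (use nn in \<open>auto simp: b_def\<close>)
  then have bs: "(\<lambda>p. b (fst p) (snd p)) summable_on UNIV"
    by (simp add: case_prod_beta')
  have "(\<lambda>(p, i). b (fst p) (snd p) * K * (\<sigma> * \<bar>h\<bar>) ^ i) summable_on UNIV \<times> UNIV"
  proof (rule summable_on_SigmaI)
    fix p :: "nat \<times> nat"
    have "((\<lambda>i. (\<sigma> * \<bar>h\<bar>) ^ i) has_sum 1 / (1 - \<sigma> * \<bar>h\<bar>)) UNIV"
      using s0 \<sigma> by (intro norm_summable_imp_has_sum geometric_sums)
        (auto simp: norm_power intro!: summable_geometric)
    from has_sum_cmult_right[OF this]
    show "((\<lambda>i. case (p, i) of (p, i) \<Rightarrow> b (fst p) (snd p) * K * (\<sigma> * \<bar>h\<bar>) ^ i) has_sum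
        b (fst p) (snd p) * K * (1 / (1 - \<sigma> * \<bar>h\<bar>))) UNIV"
      by simp
  next
    show "(\<lambda>p. b (fst p) (snd p) * K * (1 / (1 - \<sigma> * \<bar>h\<bar>))) summable_on UNIV"
      by (intro summable_on_cmult_left bs)
  qed (use nn in \<open>auto simp: b_def\<close>)
  then have "(\<lambda>(p, i). b (fst p) (snd p) * K * (\<sigma> * \<bar>h\<bar>) ^ i) summable_on UNIV"
    by simp
  then have Tabs: "(\<lambda>x. norm (T x)) summable_on UNIV"
  proof (rule Infinite_Sum.abs_summable_on_comparison_test')
    fix x :: "(nat \<times> nat) \<times> nat"
    obtain n m i where x: "x = ((n, m), i)" by (metis surj_pair)
    have "\<bar>c n i\<bar> * \<bar>h\<bar> ^ i \<le> K * \<rho> ^ n * \<sigma> ^ i * \<bar>h\<bar> ^ i"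
      by (intro mult_right_mono c) auto
    then have "(real (n choose m) * \<bar>d\<bar> ^ m * \<bar>t0\<bar> ^ (n - m)) * (\<bar>c n i\<bar> * \<bar>h\<bar> ^ i)
        \<le> (real (n choose m) * \<bar>d\<bar> ^ m * \<bar>t0\<bar> ^ (n - m)) * (K * \<rho> ^ n * \<sigma> ^ i * \<bar>h\<bar> ^ i)"
      by (intro mult_left_mono) auto
    then show "norm (T x) \<le> (case x of (p, i) \<Rightarrow> b (fst p) (snd p) * K * (\<sigma> * \<bar>h\<bar>) ^ i)"
      by (simp add: x T_def b_def abs_mult power_abs power_mult_distrib mult_ac)
  qed
  then obtain S where S: "(T has_sum S) UNIV"
    using Infinite_Sum.abs_summable_summable[of T] summable_on_def by blast
  \<comment> \<open>First order of summation: over \<open>i\<close> to recover \<open>f n\<close>,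
    then over \<open>m\<close> by the binomial theorem, then over \<open>n\<close>.\<close>
  have "((\<lambda>p. (real (fst p choose snd p) * d ^ snd p * t0 ^ (fst p - snd p)) * f (fst p)) has_sum S) UNIV"
  proof (rule has_sum_SigmaD[where B = "\<lambda>_. UNIV"])
    show "(T has_sum S) (UNIV \<times> UNIV)" using S by simp
    fix p :: "nat \<times> nat"
    obtain n m where p: "p = (n, m)" by fastforce
    have "((\<lambda>i. c n i * h ^ i) has_sum f n) UNIV"
    proof (rule norm_summable_imp_has_sum[OF _ f])
      show "summable (\<lambda>i. norm (c n i * h ^ i))"
      proof (rule summable_comparison_test')
        show "summable (\<lambda>i. K * \<rho> ^ n * (\<sigma> * \<bar>h\<bar>) ^ i)"
          using s0 \<sigma> by (intro summable_mult summable_geometric) auto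
        show "norm (norm (c n i * h ^ i)) \<le> K * \<rho> ^ n * (\<sigma> * \<bar>h\<bar>) ^ i" for i
          using mult_right_mono[OF c[of n i], of "\<bar>h\<bar> ^ i"]
          by (simp add: abs_mult power_abs power_mult_distrib mult_ac)
      qed
    qed
    from has_sum_cmult_right[OF this]
    show "((\<lambda>i. T (p, i)) has_sum (real (fst p choose snd p) * d ^ snd p * t0 ^ (fst p - snd p)) * f (fst p)) UNIV"
      by (simp add: T_def p)
  qed
  then have "((\<lambda>p. (real (fst p choose snd p) * d ^ snd p * t0 ^ (fst p - snd p)) * f (fst p)) has_sum S) (UNIV \<times> UNIV)"
    by simp
  then have "((\<lambda>n. f n * (t0 + d) ^ n) has_sum S) UNIV"
  proof (rule has_sum_SigmaD)
    fix n
    show "((\<lambda>m. (real (fst (n, m) choose snd (n, m)) * d ^ snd (n, m) * t0 ^ (fst (n, m) - snd (n, m))) * f (fst (n, m)))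
        has_sum f n * (t0 + d) ^ n) UNIV"
      by (rule has_sum_finite_neutralI[of "{..n}"])
         (auto simp: add.commute[of t0] binomial_ring sum_distrib_left mult_ac)
  qed
  then have Seq: "S = (\<Sum>n. f n * (t0 + d) ^ n)"
    using has_sum_imp_sums sums_unique by blast
  \<comment> \<open>Second order of summation: the same family with \<open>n\<close>
    innermost.\<close>
  let ?\<phi> = "\<lambda>((m, i), n). ((n, m), i) :: (nat \<times> nat) \<times> nat"
  have bij: "bij_betw ?\<phi> ((UNIV \<times> UNIV) \<times> UNIV) UNIV"
    by (rule bij_betwI[where g = "\<lambda>((n, m), i). ((m, i), n)"]) auto
  have S': "((\<lambda>x. T (?\<phi> x)) has_sum S) ((UNIV \<times> UNIV) \<times> UNIV)"
    using has_sum_reindex_bij_betw[OF bij, of T S] S by blast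
  have "((\<lambda>p. (\<Sum>\<^sub>\<infinity>n. real (n choose fst p) * t0 ^ (n - fst p) * c n (snd p)) * d ^ fst p * h ^ snd p) has_sum S) (UNIV \<times> UNIV)"
    using S'
  proof (rule has_sum_SigmaD)
    fix p :: "nat \<times> nat"
    obtain m i where p: "p = (m, i)" by fastforce
    have "(\<lambda>(p, n). T (?\<phi> (p, n))) summable_on (UNIV \<times> UNIV) \<times> UNIV"
      using S' by (auto simp: summable_on_def case_prod_beta')
    from summable_on_SigmaD1[OF this, of p]
    have "(\<lambda>n. T (?\<phi> (p, n))) summable_on UNIV" by simp
    then have "((\<lambda>n. T (?\<phi> (p, n))) has_sum infsum (\<lambda>n. T (?\<phi> (p, n))) UNIV) UNIV"
      by (rule has_sum_infsum)
    also have "infsum (\<lambda>n. T (?\<phi> (p, n))) UNIV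
        = (\<Sum>\<^sub>\<infinity>n. (d ^ m * h ^ i) * (real (n choose m) * t0 ^ (n - m) * c n i))"
      by (intro infsum_cong) (simp add: T_def p mult_ac)
    \<comment> \<open>If \<open>d ^ m * h ^ i = 0\<close>, both sides vanish whatever value the
      inner \<open>infsum\<close> takes.\<close>
    also have "\<dots> = (d ^ m * h ^ i) * (\<Sum>\<^sub>\<infinity>n. real (n choose m) * t0 ^ (n - m) * c n i)"
      by (rule infsum_cmult_right')
    finally show "((\<lambda>n. T (?\<phi> (p, n))) has_sum
        (\<Sum>\<^sub>\<infinity>n. real (n choose fst p) * t0 ^ (n - fst p) * c n (snd p)) * d ^ fst p * h ^ snd p) UNIV"
      by (simp add: p mult_ac)
  qed
  then show ?thesis
    by (simp add: Seq case_prod_beta')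
qed

text \<open>For normalised derivatives the Lagrange remainder is exactly
  \<open>A n (x0 + z) * h ^ n\<close>, which the uniform bound makes geometrically small, with the
  same radius at every centre \<open>x0\<close>.\<close>

lemma jet_taylor_sums:
  assumes A: "jet A" and b: "\<And>j x. \<bar>A j x\<bar> \<le> K * \<sigma> ^ j" and h: "\<bar>\<sigma> * h\<bar> < 1"
  shows "(\<lambda>i. A i x0 * h ^ i) sums A 0 (x0 + h)"
  unfolding sums_def
proof (rule LIM_zero_cancel, rule Lim_null_comparison)
  show "(\<lambda>n. K * \<bar>\<sigma> * h\<bar> ^ n) \<longlonglongrightarrow> 0"
    using h by (intro tendsto_mult_right_zero LIMSEQ_power_zero) simp
  have "\<bar>(\<Sum>m<n. A m x0 * h ^ m) - A 0 (x0 + h)\<bar> \<le> K * \<bar>\<sigma> * h\<bar> ^ n" for n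
  proof -
    have "((\<lambda>y. fact m * A m (x0 + y)) has_real_derivative fact (Suc m) * A (Suc m) (x0 + y)) (at y)" for m y
    proof -
      have "((\<lambda>y. A m (x0 + y)) has_real_derivative jet_deriv A m (x0 + y) * 1) (at y)"
        by (rule DERIV_chain2[OF jetD[OF A]]) (auto intro!: derivative_eq_intros)
      from DERIV_cmult[OF this, of "fact m"] show ?thesis
        by (simp add: jet_deriv_def mult_ac)
    qed
    then obtain z where "fact 0 * A 0 (x0 + h) = (\<Sum>m<n. fact m * A m (x0 + 0) / fact m * h ^ m)
        + fact n * A n (x0 + z) / fact n * h ^ n"
      using Maclaurin_all_le[of "\<lambda>m y. fact m * A m (x0 + y)" "\<lambda>y. fact 0 * A 0 (x0 + y)" h n] by auto
    then have "(\<Sum>m<n. A m x0 * h ^ m) - A 0 (x0 + h) = - (A n (x0 + z) * h ^ n)"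
      by simp
    then have "\<bar>(\<Sum>m<n. A m x0 * h ^ m) - A 0 (x0 + h)\<bar> = \<bar>A n (x0 + z)\<bar> * \<bar>h\<bar> ^ n"
      by (simp add: abs_mult power_abs)
    also have "\<dots> \<le> (K * \<sigma> ^ n) * \<bar>h\<bar> ^ n"
      by (intro mult_right_mono b) auto
    also have "\<dots> \<le> K * \<bar>\<sigma> * h\<bar> ^ n"
    proof -
      have "0 \<le> K" using b[of 0 0] by simp
      then have "K * \<sigma> ^ n \<le> K * \<bar>\<sigma>\<bar> ^ n"
        by (intro mult_left_mono) (auto simp flip: power_abs)
      then have "K * \<sigma> ^ n * \<bar>h\<bar> ^ n \<le> K * \<bar>\<sigma>\<bar> ^ n * \<bar>h\<bar> ^ n"
        by (intro mult_right_mono) auto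
      then show ?thesis by (simp add: abs_mult power_mult_distrib mult.assoc)
    qed
    finally show ?thesis .
  qed
  then show "\<forall>\<^sub>F n in sequentially. norm ((\<Sum>m<n. A m x0 * h ^ m) - A 0 (x0 + h)) \<le> K * \<bar>\<sigma> * h\<bar> ^ n"
    by simp
qed

section \<open>The solution\<close>

lemma summable_Suc_half_power: "summable (\<lambda>n. real (Suc n) * (1/2) ^ n)"
  using geometric_deriv_sums[of "1/2 :: real"] by (simp add: sums_iff)

lemma summable_of_le_half_power:
  fixes f :: "nat \<Rightarrow> real"
  assumes "\<And>n. \<bar>f n\<bar> \<le> c * (1/2) ^ n"
  shows "summable (\<lambda>n. \<bar>f n\<bar>)"
proof (rule summable_comparison_test')
  show "summable (\<lambda>n. c * (1/2) ^ n)" by (intro summable_mult summable_geometric) simp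
qed (use assms in simp)

lemma sums_of_le_half_power:
  fixes f :: "nat \<Rightarrow> real"
  assumes "f sums s" "\<And>n. \<bar>f n\<bar> \<le> c * (1/2) ^ n"
  shows "\<bar>s\<bar> \<le> 2 * c"
proof -
  have "(\<lambda>n. c * (1/2) ^ n) sums (c * (1 / (1 - 1/2)))"
    by (intro sums_mult geometric_sums) simp
  from norm_sums_le[OF assms(1) this] show ?thesis using assms(2) by simp
qed

text \<open>The Cauchy coefficients are at most \<open>\<alpha> * \<beta> * (n + 1) / 2 ^ n\<close>,
  uniformly in the point; this summable bound justifies integrating term by term.\<close>

lemma convolution_Cauchy_product:
  fixes a b :: "nat \<Rightarrow> real \<Rightarrow> real"
  assumes [measurable]: "k \<in> borel_measurable borel" "\<And>n. a n \<in> borel_measurable borel"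
      "\<And>n. b n \<in> borel_measurable borel"
    and k: "\<And>z. \<bar>k z\<bar> \<le> kernel_G z"
    and a: "\<And>n y. \<bar>a n y\<bar> \<le> \<alpha> * (1/2) ^ n" and b: "\<And>n y. \<bar>b n y\<bar> \<le> \<beta> * (1/2) ^ n"
  shows "(\<lambda>n. \<Sum>i\<le>n. (k \<star> (\<lambda>y. a i y * b (n - i) y)) x) sums (k \<star> (\<lambda>y. (\<Sum>n. a n y) * (\<Sum>n. b n y))) x"
proof -
  have nn: "0 \<le> \<alpha>" "0 \<le> \<beta>" using a[of 0 0] b[of 0 0] by auto
  define s where "s = (\<lambda>n y. \<Sum>i\<le>n. a i y * b (n - i) y)"
  have [measurable]: "s n \<in> borel_measurable borel" for n unfolding s_def by measurable
  have ab: "\<bar>a i y * b (n - i) y\<bar> \<le> \<alpha> * \<beta> * (1/2) ^ n" if "i \<le> n" for i n y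
  proof -
    have "\<bar>a i y * b (n - i) y\<bar> \<le> (\<alpha> * (1/2) ^ i) * (\<beta> * (1/2) ^ (n - i))"
      unfolding abs_mult using nn by (intro mult_mono a b) auto
    also have "\<dots> = \<alpha> * \<beta> * ((1/2) ^ i * (1/2) ^ (n - i))" by simp
    also have "\<dots> = \<alpha> * \<beta> * (1/2) ^ n" using that by (simp only: power_add[symmetric] le_add_diff_inverse)
    finally show ?thesis .
  qed
  have sb: "\<bar>s n y\<bar> \<le> \<alpha> * \<beta> * (real (Suc n) * (1/2) ^ n)" for n y
  proof -
    have "\<bar>s n y\<bar> \<le> (\<Sum>i\<le>n. \<alpha> * \<beta> * (1/2) ^ n)"
      unfolding s_def by (rule order_trans[OF sum_abs sum_mono]) (use ab in auto)
    then show ?thesis by (simp add: mult_ac)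
  qed
  have int: "integrable lborel (\<lambda>y. k (x - y) * s n y)" for n
    by (rule integrable_kernel_mult_bounded[OF _ _ k sb]) measurable
  have "(\<lambda>n. \<integral>y. k (x - y) * s n y \<partial>lborel) sums (\<integral>y. (\<Sum>n. k (x - y) * s n y) \<partial>lborel)"
  proof (rule sums_integral[OF int])
    show "AE y in lborel. summable (\<lambda>n. norm (k (x - y) * s n y))"
    proof
      fix y
      show "summable (\<lambda>n. norm (k (x - y) * s n y))"
      proof (rule summable_comparison_test')
        show "summable (\<lambda>n. \<bar>k (x - y)\<bar> * (\<alpha> * \<beta> * (real (Suc n) * (1/2) ^ n)))"
          by (intro summable_mult summable_Suc_half_power)
        show "norm (norm (k (x - y) * s n y)) \<le> \<bar>k (x - y)\<bar> * (\<alpha> * \<beta> * (real (Suc n) * (1/2) ^ n))" for n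
          using mult_left_mono[OF sb[of n y], of "\<bar>k (x - y)\<bar>"] by (simp add: abs_mult)
      qed
    qed
    show "summable (\<lambda>n. \<integral>y. norm (k (x - y) * s n y) \<partial>lborel)"
    proof (rule summable_comparison_test')
      show "summable (\<lambda>n. \<alpha> * \<beta> * (real (Suc n) * (1/2) ^ n))"
        by (intro summable_mult summable_Suc_half_power)
      show "norm (\<integral>y. norm (k (x - y) * s n y) \<partial>lborel) \<le> \<alpha> * \<beta> * (real (Suc n) * (1/2) ^ n)" for n
        using convolution_bound[of "\<lambda>z. \<bar>k z\<bar>" "\<lambda>y. \<bar>s n y\<bar>" "\<alpha> * \<beta> * (real (Suc n) * (1/2) ^ n)" x] k sb[of n]
        by (simp add: convolution_def abs_mult)
    qed
  qed
  moreover have "(\<integral>y. k (x - y) * s n y \<partial>lborel) = (\<Sum>i\<le>n. (k \<star> (\<lambda>y. a i y * b (n - i) y)) x)" for n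
    unfolding s_def convolution_def sum_distrib_left
    by (rule Bochner_Integration.integral_sum) (rule integrable_kernel_mult_bounded[OF _ _ k ab]; simp)
  moreover have "(\<Sum>n. k (x - y) * s n y) = k (x - y) * ((\<Sum>n. a n y) * (\<Sum>n. b n y))" for y
  proof -
    have "(\<lambda>n. s n y) sums ((\<Sum>n. a n y) * (\<Sum>n. b n y))"
      unfolding s_def real_norm_def[symmetric]
      by (intro Cauchy_product_sums) (use summable_of_le_half_power[OF a] summable_of_le_half_power[OF b] in auto)
    from sums_mult[OF this, of "k (x - y)"] show ?thesis by (simp add: sums_iff)
  qed
  ultimately show ?thesis by (simp add: convolution_def)
qed

locale time_series = slow_weight W for W +
  fixes U :: "nat \<Rightarrow> nat \<Rightarrow> real \<Rightarrow> real" and \<kappa> \<rho> \<sigma> :: real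
  assumes pos: "0 < \<kappa>" "0 < \<rho>" "0 < \<sigma>"
    and jet_U: "jet (U n)"
    and U_le: "\<bar>U n j x\<bar> \<le> \<kappa> * \<rho> ^ n * \<sigma> ^ j * W x"
    and U_Suc: "real (Suc n) * U (Suc n) 0 x = (\<Sum>k\<le>n. jet_flux (U k) (U (n - k)) 0 x)"
begin

definition v :: "nat \<Rightarrow> real \<Rightarrow> real \<Rightarrow> real" where
  "v j t x = (\<Sum>n. U n j x * t ^ n)"

text \<open>Half the radius of convergence guaranteed by the bounds: terms are then dominated by
  \<open>(1/2) ^ n\<close> on the closed interval, and re-expansion about any interior time still
  has room, since \<open>2 * radius = 1 / \<rho>\<close>.\<close>

definition radius :: real where "radius = 1 / (2 * \<rho>)"

lemma radius_pos: "0 < radius" using pos by (simp add: radius_def)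

lemma power_le_half:
  assumes "\<bar>t\<bar> \<le> radius"
  shows "\<rho> ^ n * \<bar>t\<bar> ^ n \<le> (1/2) ^ n"
proof -
  have "\<rho> * \<bar>t\<bar> \<le> 1/2" using assms pos by (simp add: radius_def field_simps)
  then have "(\<rho> * \<bar>t\<bar>) ^ n \<le> (1/2) ^ n" using pos by (intro power_mono) auto
  then show ?thesis by (simp add: power_mult_distrib)
qed

lemma term_le:
  assumes "\<bar>t\<bar> \<le> radius"
  shows "\<bar>U n j x * t ^ n\<bar> \<le> \<kappa> * \<sigma> ^ j * W x * (1/2) ^ n"
proof -
  have "\<bar>U n j x * t ^ n\<bar> \<le> \<kappa> * \<rho> ^ n * \<sigma> ^ j * W x * \<bar>t\<bar> ^ n"
    unfolding abs_mult power_abs by (intro mult_right_mono U_le) auto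
  also have "\<dots> = \<kappa> * \<sigma> ^ j * W x * (\<rho> ^ n * \<bar>t\<bar> ^ n)" by simp
  also have "\<dots> \<le> \<kappa> * \<sigma> ^ j * W x * (1/2) ^ n"
    using pos nonneg by (intro mult_left_mono power_le_half assms) auto
  finally show ?thesis .
qed

lemma term_le':
  assumes "\<bar>t\<bar> \<le> radius"
  shows "\<bar>U n j x * t ^ n\<bar> \<le> \<kappa> * \<sigma> ^ j * (1/2) ^ n"
proof -
  have "\<kappa> * \<sigma> ^ j * W x * (1/2) ^ n \<le> \<kappa> * \<sigma> ^ j * 1 * (1/2) ^ n"
    using pos le_1 by (intro mult_right_mono mult_left_mono) auto
  with term_le[OF assms, of n j x] show ?thesis by simp
qed

lemma v_sums: "\<bar>t\<bar> \<le> radius \<Longrightarrow> (\<lambda>n. U n j x * t ^ n) sums v j t x"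
  unfolding v_def
  using summable_of_le_half_power[OF term_le] by (intro summable_sums) (auto intro: summable_rabs_cancel)

lemma v_le: "\<bar>t\<bar> \<le> radius \<Longrightarrow> \<bar>v j t x\<bar> \<le> 2 * (\<kappa> * \<sigma> ^ j * W x)"
  by (rule sums_of_le_half_power[OF v_sums term_le])

text \<open>Quadratic remainders of the single terms, uniform in the point and geometric in
  \<open>n\<close>, add up to a quadratic remainder of the sum.\<close>

lemma jet_v:
  assumes t: "\<bar>t\<bar> \<le> radius"
  shows "jet (\<lambda>j. v j t)"
  unfolding jet_def
proof (intro allI)
  fix j x
  define M where "M = real (Suc j) * (real (Suc (Suc j)) * (\<kappa> * \<sigma> ^ Suc (Suc j)))"
  show "(v j t has_real_derivative jet_deriv (\<lambda>j. v j t) j x) (at x)"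
  proof (rule quadratic_remainder_imp_derivative)
    fix h
    have "(\<lambda>n. U n j (x + h) * t ^ n - U n j x * t ^ n - h * (real (Suc j) * (U n (Suc j) x * t ^ n)))
        sums (v j t (x + h) - v j t x - h * jet_deriv (\<lambda>j. v j t) j x)"
      unfolding jet_deriv_def by (intro sums_diff sums_mult v_sums t)
    moreover have "\<bar>U n j (x + h) * t ^ n - U n j x * t ^ n - h * (real (Suc j) * (U n (Suc j) x * t ^ n))\<bar>
        \<le> M * h\<^sup>2 * (1/2) ^ n" for n
    proof -
      have "((\<lambda>y. U n j y * t ^ n) has_real_derivative jet_deriv (U n) j y * t ^ n) (at y)" for y
        by (intro DERIV_cmult_right jetD jet_U)
      moreover have "((\<lambda>y. jet_deriv (U n) j y * t ^ n) has_real_derivative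
          jet_deriv (jet_deriv (U n)) j y * t ^ n) (at y)" for y
        by (intro DERIV_cmult_right jetD jet_jet_deriv jet_U)
      moreover have "\<bar>jet_deriv (jet_deriv (U n)) j y * t ^ n\<bar> \<le> M * (1/2) ^ n" for y
      proof -
        have "jet_deriv (jet_deriv (U n)) j y * t ^ n
            = real (Suc j) * (real (Suc (Suc j)) * (U n (Suc (Suc j)) y * t ^ n))"
          by (simp only: jet_deriv_def mult.assoc)
        also have "\<bar>\<dots>\<bar> = real (Suc j) * (real (Suc (Suc j)) * \<bar>U n (Suc (Suc j)) y * t ^ n\<bar>)"
          by (simp only: abs_mult abs_of_nat)
        also have "\<dots> \<le> real (Suc j) * (real (Suc (Suc j)) * (\<kappa> * \<sigma> ^ Suc (Suc j) * (1/2) ^ n))"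
          by (intro mult_left_mono term_le' t) auto
        finally show ?thesis by (simp only: M_def mult.assoc)
      qed
      ultimately have "\<bar>U n j (x + h) * t ^ n - U n j x * t ^ n - h * (jet_deriv (U n) j x * t ^ n)\<bar>
          \<le> (M * (1/2) ^ n) * h\<^sup>2"
        by (rule quadratic_remainder_le)
      then show ?thesis by (simp only: jet_deriv_def mult_ac)
    qed
    ultimately have "\<bar>v j t (x + h) - v j t x - h * jet_deriv (\<lambda>j. v j t) j x\<bar> \<le> 2 * (M * h\<^sup>2)"
      by (rule sums_of_le_half_power)
    then show "\<bar>v j t (x + h) - v j t x - h * jet_deriv (\<lambda>j. v j t) j x\<bar> \<le> (2 * M) * h\<^sup>2"
      by simp
  qed
qed

lemma deriv_v:
  assumes "\<bar>t\<bar> \<le> radius"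
  shows "(deriv ^^ i) (v 0 t) = (\<lambda>x. fact i * v i t x)"
proof (induction i)
  case (Suc i)
  have "((\<lambda>x. fact i * v i t x) has_real_derivative fact i * jet_deriv (\<lambda>j. v j t) i x) (at x)" for x
    by (intro DERIV_cmult jetD[OF jet_v[OF assms]])
  then have "deriv (\<lambda>x. fact i * v i t x) = (\<lambda>x. fact i * jet_deriv (\<lambda>j. v j t) i x)"
    by (intro ext DERIV_imp_deriv)
  then show ?case by (simp add: Suc jet_deriv_def mult_ac)
qed simp

lemma integrable_square_le_weight:
  assumes [measurable]: "f \<in> borel_measurable borel" and f: "\<And>x. \<bar>f x\<bar> \<le> c * W x"
  shows "integrable lborel (\<lambda>x. (f x)\<^sup>2)"
    and "(\<integral>x. (f x)\<^sup>2 \<partial>lborel) \<le> c\<^sup>2 * (\<integral>x. (W x)\<^sup>2 \<partial>lborel)"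
proof -
  have le: "(f x)\<^sup>2 \<le> c\<^sup>2 * (W x)\<^sup>2" for x
    using power_mono[OF f[of x] abs_ge_zero, of 2] by (simp add: power_mult_distrib)
  have ci: "integrable lborel (\<lambda>x. c\<^sup>2 * (W x)\<^sup>2)"
    using integrable_square by simp
  show i: "integrable lborel (\<lambda>x. (f x)\<^sup>2)"
    by (rule Bochner_Integration.integrable_bound[OF ci]) (use le in auto)
  have "(\<integral>x. (f x)\<^sup>2 \<partial>lborel) \<le> (\<integral>x. c\<^sup>2 * (W x)\<^sup>2 \<partial>lborel)"
    by (rule integral_mono[OF i ci le])
  then show "(\<integral>x. (f x)\<^sup>2 \<partial>lborel) \<le> c\<^sup>2 * (\<integral>x. (W x)\<^sup>2 \<partial>lborel)" by simp
qed

lemma sobolev_v: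
  assumes t: "\<bar>t\<bar> \<le> radius"
  shows "sobolev m (v 0 t)"
  unfolding sobolev_def deriv_v[OF t]
proof (intro conjI allI impI)
  show "(\<lambda>x. fact j * v j t x) differentiable at x" for j x
    using DERIV_cmult[OF jetD[OF jet_v[OF t]]] real_differentiable_def by blast
  show "square_integrable (\<lambda>x. fact j * v j t x)" for j
  proof -
    have [measurable]: "v j t \<in> borel_measurable borel" by (rule jet_measurable[OF jet_v[OF t]])
    have "\<bar>fact j * v j t x\<bar> \<le> (fact j * (2 * (\<kappa> * \<sigma> ^ j))) * W x" for x
      using mult_left_mono[OF v_le[OF t, of j x], of "fact j"] by (simp add: abs_mult mult_ac)
    from integrable_square_le_weight(1)[OF _ this] show ?thesis
      by (simp add: square_integrable_def)
  qed
qed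

lemma v_has_time_derivative:
  assumes "\<bar>t\<bar> < radius"
  shows "((\<lambda>\<tau>. v j \<tau> x) has_real_derivative (\<Sum>n. diffs (\<lambda>n. U n j x) n * t ^ n)) (at t)"
  unfolding v_def
  by (rule termdiffs_strong'[where K = radius]) (use assms v_sums in \<open>auto simp: sums_iff\<close>)

text \<open>Follows from bounding the time derivative, where the factor 4 is the sum of
  \<open>(n + 1) / 2 ^ n\<close>. Keeping \<open>W\<close> in the estimate is essential: integrating
  its square gives Lipschitz continuity in Sobolev norms.\<close>

lemma v_Lipschitz:
  assumes "\<bar>t\<bar> < radius" "\<bar>\<tau>\<bar> < radius"
  shows "\<bar>v j \<tau> x - v j t x\<bar> \<le> 4 * \<rho> * \<kappa> * \<sigma> ^ j * \<bar>\<tau> - t\<bar> * W x"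
proof -
  have bd: "\<bar>\<Sum>n. diffs (\<lambda>n. U n j x) n * r ^ n\<bar> \<le> 4 * \<rho> * \<kappa> * \<sigma> ^ j * W x" if r: "\<bar>r\<bar> < radius" for r
  proof -
    have le: "\<bar>diffs (\<lambda>n. U n j x) n * r ^ n\<bar> \<le> \<rho> * \<kappa> * \<sigma> ^ j * W x * (real (Suc n) * (1/2) ^ n)" for n
    proof -
      have "\<bar>diffs (\<lambda>n. U n j x) n * r ^ n\<bar> = real (Suc n) * \<bar>U (Suc n) j x\<bar> * \<bar>r\<bar> ^ n"
        by (simp add: diffs_def abs_mult power_abs)
      also have "\<dots> \<le> real (Suc n) * (\<kappa> * \<rho> ^ Suc n * \<sigma> ^ j * W x) * \<bar>r\<bar> ^ n"
        by (intro mult_right_mono mult_left_mono U_le) auto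
      also have "\<dots> = \<rho> * \<kappa> * \<sigma> ^ j * W x * (real (Suc n) * (\<rho> ^ n * \<bar>r\<bar> ^ n))"
        by simp
      also have "\<dots> \<le> \<rho> * \<kappa> * \<sigma> ^ j * W x * (real (Suc n) * (1/2) ^ n)"
        using pos nonneg r by (intro mult_left_mono power_le_half) auto
      finally show ?thesis .
    qed
    have g: "(\<lambda>n. \<rho> * \<kappa> * \<sigma> ^ j * W x * (real (Suc n) * (1/2) ^ n)) sums (\<rho> * \<kappa> * \<sigma> ^ j * W x * 4)"
      using sums_mult[OF geometric_deriv_sums[of "1/2 :: real"], of "\<rho> * \<kappa> * \<sigma> ^ j * W x"]
      by (simp add: power2_eq_square)
    have "summable (\<lambda>n. diffs (\<lambda>n. U n j x) n * r ^ n)"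
      by (rule summable_comparison_test'[OF sums_summable[OF g]]) (use le in simp)
    from norm_sums_le[OF summable_sums[OF this] g] le show ?thesis by (simp add: mult_ac)
  qed
  have "norm (v j \<tau> x - v j t x) \<le> 4 * \<rho> * \<kappa> * \<sigma> ^ j * W x * norm (\<tau> - t)"
  proof (rule field_differentiable_bound[where S = "{-radius<..<radius}" and f = "\<lambda>r. v j r x"
        and f' = "\<lambda>r. \<Sum>n. diffs (\<lambda>n. U n j x) n * r ^ n"])
    show "((\<lambda>r. v j r x) has_field_derivative (\<Sum>n. diffs (\<lambda>n. U n j x) n * r ^ n)) (at r within {-radius<..<radius})"
      if "r \<in> {-radius<..<radius}" for r
      using that by (intro DERIV_subset[OF v_has_time_derivative]) auto
    show "norm (\<Sum>n. diffs (\<lambda>n. U n j x) n * r ^ n) \<le> 4 * \<rho> * \<kappa> * \<sigma> ^ j * W x"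
      if "r \<in> {-radius<..<radius}" for r
      using that bd[of r] by auto
  qed (use assms in auto)
  then show ?thesis by (simp add: mult_ac)
qed

text \<open>Each quadratic term of the flux is the sum of a Cauchy product in \<open>t\<close>. Its
  coefficients add up to the right side of \<open>U_Suc\<close>, while \<open>diffs\<close> supplies
  the factor \<open>n + 1\<close> on the left.\<close>

lemma flux_v:
  assumes t: "\<bar>t\<bar> \<le> radius"
  shows "(\<Sum>n. diffs (\<lambda>n. U n 0 x) n * t ^ n) = flux (v 0 t) x"
proof -
  note [measurable] = jet_measurable[OF jet_U]
  have [measurable]: "v j t \<in> borel_measurable borel" for j by (rule jet_measurable[OF jet_v[OF t]])
  have kG: "\<bar>kernel_G z\<bar> \<le> kernel_G z" for z by (simp add: kernel_G_nonneg)
  have prod: "(\<lambda>n. (\<Sum>k\<le>n. U k i x * U (n - k) j x) * t ^ n) sums (v i t x * v j t x)" for i j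
  proof -
    have "(\<lambda>n. \<Sum>k\<le>n. (U k i x * t ^ k) * (U (n - k) j x * t ^ (n - k))) sums
        ((\<Sum>k. U k i x * t ^ k) * (\<Sum>k. U k j x * t ^ k))"
      using summable_of_le_half_power[OF term_le[OF t]] by (intro Cauchy_product_sums) auto
    also have "(\<lambda>n. \<Sum>k\<le>n. (U k i x * t ^ k) * (U (n - k) j x * t ^ (n - k)))
        = (\<lambda>n. (\<Sum>k\<le>n. U k i x * U (n - k) j x) * t ^ n)"
    proof (intro ext)
      fix n
      have "(U k i x * t ^ k) * (U (n - k) j x * t ^ (n - k)) = U k i x * U (n - k) j x * t ^ n" if "k \<le> n" for k
        using that by (simp add: mult_ac flip: power_add)
      then show "(\<Sum>k\<le>n. (U k i x * t ^ k) * (U (n - k) j x * t ^ (n - k))) = (\<Sum>k\<le>n. U k i x * U (n - k) j x) * t ^ n"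
        unfolding sum_distrib_right by (intro sum.cong) auto
    qed
    finally show ?thesis by (simp add: v_def)
  qed
  have conv: "(\<lambda>n. (\<Sum>k\<le>n. (K \<star> (\<lambda>y. U k i y * U (n - k) j y)) x) * t ^ n) sums (K \<star> (\<lambda>y. v i t y * v j t y)) x"
    if [measurable]: "K \<in> borel_measurable borel" and K: "\<And>z. \<bar>K z\<bar> \<le> kernel_G z" for K i j
  proof -
    have "(\<lambda>n. \<Sum>k\<le>n. (K \<star> (\<lambda>y. (U k i y * t ^ k) * (U (n - k) j y * t ^ (n - k)))) x) sums
        (K \<star> (\<lambda>y. (\<Sum>n. U n i y * t ^ n) * (\<Sum>n. U n j y * t ^ n))) x"
      by (rule convolution_Cauchy_product[OF _ _ _ K term_le'[OF t] term_le'[OF t]]) measurable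
    also have "(\<lambda>n. \<Sum>k\<le>n. (K \<star> (\<lambda>y. (U k i y * t ^ k) * (U (n - k) j y * t ^ (n - k)))) x)
        = (\<lambda>n. (\<Sum>k\<le>n. (K \<star> (\<lambda>y. U k i y * U (n - k) j y)) x) * t ^ n)"
    proof (intro ext)
      fix n
      have "(K \<star> (\<lambda>y. (U k i y * t ^ k) * (U (n - k) j y * t ^ (n - k)))) x
          = (K \<star> (\<lambda>y. U k i y * U (n - k) j y)) x * t ^ n" if "k \<le> n" for k
      proof -
        have "(\<lambda>y. (U k i y * t ^ k) * (U (n - k) j y * t ^ (n - k))) = (\<lambda>y. t ^ n * (U k i y * U (n - k) j y))"
          using that by (auto simp: mult_ac simp flip: power_add)
        then show ?thesis by (simp add: convolution_cmult)
      qed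
      then show "(\<Sum>k\<le>n. (K \<star> (\<lambda>y. (U k i y * t ^ k) * (U (n - k) j y * t ^ (n - k)))) x)
          = (\<Sum>k\<le>n. (K \<star> (\<lambda>y. U k i y * U (n - k) j y)) x) * t ^ n"
        unfolding sum_distrib_right by (intro sum.cong) auto
    qed
    finally show ?thesis by (simp add: v_def)
  qed
  have Ub: "\<bar>U n j y\<bar> \<le> \<kappa> * \<rho> ^ n * \<sigma> ^ j" for n j y
    using le_weight_imp_bounded[OF U_le, of n j y] pos by simp
  have intD: "integrable lborel (\<lambda>y. kernel_D (x - y) * (c * (U k i y * U l j y)))" for c k l i j
  proof (rule integrable_kernel_mult_bounded[OF _ _ kernel_D_abs_le])
    show "\<bar>c * (U k i y * U l j y)\<bar> \<le> \<bar>c\<bar> * ((\<kappa> * \<rho> ^ k * \<sigma> ^ i) * (\<kappa> * \<rho> ^ l * \<sigma> ^ j))" for y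
      unfolding abs_mult using pos by (intro mult_left_mono mult_mono Ub) auto
  qed measurable
  have jf: "jet_flux (U k) (U l) 0 x = 4 * (U k 0 x * U l 1 x)
      + (2 * (kernel_D \<star> (\<lambda>y. U k 1 y * U l 1 y)) x + 6 * (kernel_D \<star> (\<lambda>y. U k 0 y * U l 0 y)) x)
      + (kernel_G \<star> (\<lambda>y. U k 1 y * U l 1 y)) x - U k 1 x * U l 1 x" for k l
  proof -
    have "(kernel_D \<star> (\<lambda>y. 2 * (U k 1 y * U l 1 y) + 6 * (U k 0 y * U l 0 y))) x
        = 2 * (kernel_D \<star> (\<lambda>y. U k 1 y * U l 1 y)) x + 6 * (kernel_D \<star> (\<lambda>y. U k 0 y * U l 0 y)) x"
      by (simp only: convolution_add[OF intD intD] convolution_cmult)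
    moreover have "jet_mul (jet_deriv (U k)) (jet_deriv (U l)) 0 = (\<lambda>y. U k 1 y * U l 1 y)"
      by (auto simp: jet_mul_def jet_deriv_def)
    ultimately show ?thesis
      by (simp add: jet_flux_def jet_mul_def jet_deriv_def)
  qed
  have "(\<lambda>n. 4 * ((\<Sum>k\<le>n. U k 0 x * U (n - k) 1 x) * t ^ n)
      + (2 * ((\<Sum>k\<le>n. (kernel_D \<star> (\<lambda>y. U k 1 y * U (n - k) 1 y)) x) * t ^ n)
        + 6 * ((\<Sum>k\<le>n. (kernel_D \<star> (\<lambda>y. U k 0 y * U (n - k) 0 y)) x) * t ^ n))
      + (\<Sum>k\<le>n. (kernel_G \<star> (\<lambda>y. U k 1 y * U (n - k) 1 y)) x) * t ^ n
      - (\<Sum>k\<le>n. U k 1 x * U (n - k) 1 x) * t ^ n)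
    sums (4 * (v 0 t x * v 1 t x) + (2 * (kernel_D \<star> (\<lambda>y. v 1 t y * v 1 t y)) x + 6 * (kernel_D \<star> (\<lambda>y. v 0 t y * v 0 t y)) x)
      + (kernel_G \<star> (\<lambda>y. v 1 t y * v 1 t y)) x - v 1 t x * v 1 t x)"
    by (intro sums_diff sums_add sums_mult prod conv kernel_D_measurable kernel_G_measurable kernel_D_abs_le kG)
  also have "(\<lambda>n. 4 * ((\<Sum>k\<le>n. U k 0 x * U (n - k) 1 x) * t ^ n)
      + (2 * ((\<Sum>k\<le>n. (kernel_D \<star> (\<lambda>y. U k 1 y * U (n - k) 1 y)) x) * t ^ n)
        + 6 * ((\<Sum>k\<le>n. (kernel_D \<star> (\<lambda>y. U k 0 y * U (n - k) 0 y)) x) * t ^ n))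
      + (\<Sum>k\<le>n. (kernel_G \<star> (\<lambda>y. U k 1 y * U (n - k) 1 y)) x) * t ^ n
      - (\<Sum>k\<le>n. U k 1 x * U (n - k) 1 x) * t ^ n) = (\<lambda>n. diffs (\<lambda>n. U n 0 x) n * t ^ n)"
  proof (intro ext)
    fix n
    have "diffs (\<lambda>n. U n 0 x) n = (\<Sum>k\<le>n. jet_flux (U k) (U (n - k)) 0 x)"
      using U_Suc[of n x] by (simp add: diffs_def)
    also have "\<dots> = 4 * (\<Sum>k\<le>n. U k 0 x * U (n - k) 1 x)
      + (2 * (\<Sum>k\<le>n. (kernel_D \<star> (\<lambda>y. U k 1 y * U (n - k) 1 y)) x)
        + 6 * (\<Sum>k\<le>n. (kernel_D \<star> (\<lambda>y. U k 0 y * U (n - k) 0 y)) x))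
      + (\<Sum>k\<le>n. (kernel_G \<star> (\<lambda>y. U k 1 y * U (n - k) 1 y)) x)
      - (\<Sum>k\<le>n. U k 1 x * U (n - k) 1 x)"
      by (simp only: jf sum.distrib sum_subtractf sum_distrib_left)
    finally show "4 * ((\<Sum>k\<le>n. U k 0 x * U (n - k) 1 x) * t ^ n)
      + (2 * ((\<Sum>k\<le>n. (kernel_D \<star> (\<lambda>y. U k 1 y * U (n - k) 1 y)) x) * t ^ n)
        + 6 * ((\<Sum>k\<le>n. (kernel_D \<star> (\<lambda>y. U k 0 y * U (n - k) 0 y)) x) * t ^ n))
      + (\<Sum>k\<le>n. (kernel_G \<star> (\<lambda>y. U k 1 y * U (n - k) 1 y)) x) * t ^ n
      - (\<Sum>k\<le>n. U k 1 x * U (n - k) 1 x) * t ^ n = diffs (\<lambda>n. U n 0 x) n * t ^ n"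
      by (simp only: distrib_right left_diff_distrib mult.assoc)
  qed
  finally have "(\<Sum>n. diffs (\<lambda>n. U n 0 x) n * t ^ n) =
      4 * (v 0 t x * v 1 t x) + (2 * (kernel_D \<star> (\<lambda>y. v 1 t y * v 1 t y)) x + 6 * (kernel_D \<star> (\<lambda>y. v 0 t y * v 0 t y)) x)
      + (kernel_G \<star> (\<lambda>y. v 1 t y * v 1 t y)) x - v 1 t x * v 1 t x"
    by (simp add: sums_iff)
  also have "\<dots> = flux (v 0 t) x"
  proof -
    have d: "deriv (v 0 t) = v 1 t" using deriv_v[OF t, of 1] by simp
    have vb: "\<bar>v j t y\<bar> \<le> 2 * (\<kappa> * \<sigma> ^ j)" for j y
      using le_weight_imp_bounded[of "v j t y" "2 * (\<kappa> * \<sigma> ^ j)" y] v_le[OF t, of j y] pos by simp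
    have i: "integrable lborel (\<lambda>y. kernel_D (x - y) * (c * (v j t y)\<^sup>2))" for c j
    proof (rule integrable_kernel_mult_bounded[OF _ _ kernel_D_abs_le])
      show "\<bar>c * (v j t y)\<^sup>2\<bar> \<le> \<bar>c\<bar> * (2 * (\<kappa> * \<sigma> ^ j))\<^sup>2" for y
        using power_mono[OF vb[of j y] abs_ge_zero, of 2] by (simp add: abs_mult mult_left_mono)
    qed measurable
    show ?thesis
      unfolding flux_def convolution_nonlocal_source[OF sobolev_v[OF t]] d convolution_add[OF i i] convolution_cmult
      by (simp only: power2_eq_square mult.assoc)
  qed
  finally show ?thesis .
qed

lemma sobolev_norm_v_diff_le:
  assumes t: "\<bar>t\<bar> < radius" and \<tau>: "\<bar>\<tau>\<bar> < radius"
  shows "sobolev_norm m (\<lambda>x. v 0 \<tau> x - v 0 t x) \<le>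
    sqrt (\<Sum>i\<le>m. (fact i * (4 * \<rho> * \<kappa> * \<sigma> ^ i))\<^sup>2 * (\<integral>x. (W x)\<^sup>2 \<partial>lborel)) * \<bar>\<tau> - t\<bar>"
proof -
  have le: "(\<integral>x. ((deriv ^^ i) (\<lambda>x. v 0 \<tau> x - v 0 t x) x)\<^sup>2 \<partial>lborel)
      \<le> (fact i * (4 * \<rho> * \<kappa> * \<sigma> ^ i))\<^sup>2 * (\<integral>x. (W x)\<^sup>2 \<partial>lborel) * \<bar>\<tau> - t\<bar>\<^sup>2" if i: "i \<le> m" for i
  proof -
    have [measurable]: "v i \<tau> \<in> borel_measurable borel" "v i t \<in> borel_measurable borel"
      using t \<tau> by (auto intro: jet_measurable[OF jet_v])
    have eq: "(deriv ^^ i) (\<lambda>x. v 0 \<tau> x - v 0 t x) = (\<lambda>x. fact i * (v i \<tau> x - v i t x))"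
      using sobolev_diff(1)[OF sobolev_v[of \<tau> m] sobolev_v[of t m] i] t \<tau>
      by (simp add: deriv_v right_diff_distrib)
    have "\<bar>fact i * (v i \<tau> x - v i t x)\<bar> \<le> (fact i * (4 * \<rho> * \<kappa> * \<sigma> ^ i) * \<bar>\<tau> - t\<bar>) * W x" for x
      using mult_left_mono[OF v_Lipschitz[OF t \<tau>, of i x], of "fact i"] by (simp add: abs_mult mult_ac)
    from integrable_square_le_weight(2)[OF _ this] show ?thesis
      unfolding eq by (simp add: power_mult_distrib mult_ac)
  qed
  have "sobolev_norm m (\<lambda>x. v 0 \<tau> x - v 0 t x) \<le>
      sqrt (\<Sum>i\<le>m. (fact i * (4 * \<rho> * \<kappa> * \<sigma> ^ i))\<^sup>2 * (\<integral>x. (W x)\<^sup>2 \<partial>lborel) * \<bar>\<tau> - t\<bar>\<^sup>2)"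
    unfolding sobolev_norm_def using le by (intro real_sqrt_le_mono sum_mono) auto
  then show ?thesis
    by (simp only: sum_distrib_right[symmetric] real_sqrt_mult real_sqrt_abs abs_idempotent)
qed

lemma cauchy_solution_v: "cauchy_solution radius (U 0 0) (v 0)"
  unfolding cauchy_solution_def
proof (intro conjI ballI allI)
  fix t assume "t \<in> {-radius<..<radius}"
  then have t: "\<bar>t\<bar> < radius" by auto
  show "sobolev 3 (v 0 t)" using t by (intro sobolev_v) auto
  define L where "L = sqrt (\<Sum>i\<le>3. (fact i * (4 * \<rho> * \<kappa> * \<sigma> ^ i))\<^sup>2 * (\<integral>x. (W x)\<^sup>2 \<partial>lborel))"
  show "((\<lambda>\<tau>. sobolev_norm 3 (\<lambda>x. v 0 \<tau> x - v 0 t x)) \<longlongrightarrow> 0) (at t)"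
  proof (rule Lim_null_comparison)
    show "((\<lambda>\<tau>. L * \<bar>\<tau> - t\<bar>) \<longlongrightarrow> 0) (at t)"
      by (rule tendsto_eq_intros refl | simp)+
    have "\<forall>\<^sub>F \<tau> in at t. \<tau> \<in> {-radius<..<radius}"
      using t by (intro eventually_at_in_open') auto
    then show "\<forall>\<^sub>F \<tau> in at t. norm (sobolev_norm 3 (\<lambda>x. v 0 \<tau> x - v 0 t x)) \<le> L * \<bar>\<tau> - t\<bar>"
    proof eventually_elim
      case (elim \<tau>)
      then have "\<bar>\<tau>\<bar> < radius" by auto
      moreover have "0 \<le> sobolev_norm 3 f" for f by (simp add: sobolev_norm_def sum_nonneg)
      ultimately show ?case
        using sobolev_norm_v_diff_le[OF t, of \<tau> 3] by (simp add: L_def)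
    qed
  qed
  fix x
  show "((\<lambda>\<tau>. v 0 \<tau> x) has_real_derivative
      4 * v 0 t x * deriv (v 0 t) x + (kernel_G \<star> nonlocal_source (v 0 t)) x) (at t)"
    using v_has_time_derivative[OF t, of 0 x] flux_v[of t x] t by (simp add: flux_def)
next
  fix x
  show "v 0 0 x = U 0 0 x"
    by (simp add: v_def)
qed

lemma real_analytic_v: "real_analytic2_on (v 0) ({-radius<..<radius} \<times> UNIV)"
  unfolding real_analytic2_on_def
proof (clarify)
  fix t0 x0 :: real
  assume "t0 \<in> {-radius<..<radius}"
  then have t0: "\<bar>t0\<bar> < radius" by auto
  \<comment> \<open>\<open>1 / \<sigma>\<close> is the radius of the x-expansions, and
    \<open>radius\<close> ensures
    \<open>\<bar>t - t0\<bar> + \<bar>t0\<bar> < 1 / \<rho>\<close>.\<close>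
  define r where "r = min radius (1 / \<sigma>)"
  have r0: "0 < r" using radius_pos pos by (simp add: r_def)
  have b: "\<bar>U n j x\<bar> \<le> \<kappa> * \<rho> ^ n * \<sigma> ^ j" for n j x
    using le_weight_imp_bounded[OF U_le, of n j x] pos by simp
  define a where "a = (\<lambda>m i. \<Sum>\<^sub>\<infinity>n. real (n choose m) * t0 ^ (n - m) * U n i x0)"
  have sum: "((\<lambda>(m, i). a m i * (t - t0) ^ m * (x - x0) ^ i) has_sum v 0 t x) UNIV"
    if t: "\<bar>t - t0\<bar> < r" and x: "\<bar>x - x0\<bar> < r" for t x
  proof -
    have \<sigma>x: "\<sigma> * \<bar>x - x0\<bar> < 1"
      using x pos by (simp add: r_def field_simps)
    have "\<bar>t - t0\<bar> + \<bar>t0\<bar> < 2 * radius" using t t0 by (simp add: r_def)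
    then have "\<rho> * (\<bar>t - t0\<bar> + \<bar>t0\<bar>) < \<rho> * (2 * radius)" using pos by simp
    then have \<rho>t: "\<rho> * (\<bar>t - t0\<bar> + \<bar>t0\<bar>) < 1" using pos by (simp add: radius_def)
    have "(\<lambda>i. U n i x0 * (x - x0) ^ i) sums U n 0 (x0 + (x - x0))" for n
      using \<sigma>x pos by (intro jet_taylor_sums[OF jet_U b]) (simp add: abs_mult)
    then have f: "(\<lambda>i. U n i x0 * (x - x0) ^ i) sums U n 0 x" for n by simp
    have "((\<lambda>(m, i). (\<Sum>\<^sub>\<infinity>n. real (n choose m) * t0 ^ (n - m) * U n i x0) * (t - t0) ^ m * (x - x0) ^ i)
      has_sum (\<Sum>n. U n 0 x * (t0 + (t - t0)) ^ n)) UNIV"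
      using pos by (intro power_series_reexpansion[OF b _ _ _ \<rho>t \<sigma>x f]) auto
    then show ?thesis by (simp add: v_def a_def)
  qed
  show "\<exists>r>0. \<exists>a. \<forall>t x. \<bar>t - t0\<bar> < r \<longrightarrow> \<bar>x - x0\<bar> < r \<longrightarrow>
      ((\<lambda>(i, j). a i j * (t - t0) ^ i * (x - x0) ^ j) has_sum v 0 t x) UNIV"
    by (rule exI[of _ r], intro conjI[OF r0] exI[of _ a] allI impI sum)
qed

end

theorem theorem2p1:
  fixes s :: real and u0 :: "real \<Rightarrow> real"
  assumes "s > 0" and "u0 \<in> E_space s"
  shows "\<exists>\<epsilon>>0. \<exists>u.
           (cauchy_solution \<epsilon> u0 u \<and> real_analytic2_on u ({-\<epsilon><..<\<epsilon>} \<times> UNIV)) \<and>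
           (\<forall>v. cauchy_solution \<epsilon> u0 v \<and> real_analytic2_on v ({-\<epsilon><..<\<epsilon>} \<times> UNIV) \<longrightarrow>
              (\<forall>t\<in>{-\<epsilon><..<\<epsilon>}. \<forall>x. v t x = u t x))"
proof -
  obtain W C where W: "slow_weight W" and C: "0 \<le> C"
    and b: "\<And>j x. \<bar>(deriv ^^ j) u0 x\<bar> \<le> C * fact j * (1 / s) ^ j * W x"
    using E_space_weight[OF assms] by blast
  interpret slow_weight W by (rule W)
  have "smooth u0" using assms by (simp add: E_space_def)
  then obtain \<kappa> \<rho> \<sigma> where *: "0 < \<kappa>" "0 < \<rho>" "0 < \<sigma>" "\<And>n. jet (taylor_jet u0 n)"
    "\<And>n j x. \<bar>taylor_jet u0 n j x\<bar> \<le> \<kappa> * \<rho> ^ n * \<sigma> ^ j * W x"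
    using taylor_jet_geometric[OF _ assms(1) C b] by metis
  interpret time_series W "taylor_jet u0" \<kappa> \<rho> \<sigma>
    by unfold_locales (use * in simp_all)
  have "taylor_jet u0 0 0 = u0" by (simp add: fun_eq_iff)
  then have "cauchy_solution radius u0 (v 0)"
    using cauchy_solution_v by simp
  then have u: "cauchy_solution radius u0 (v 0) \<and> real_analytic2_on (v 0) ({-radius<..<radius} \<times> UNIV)"
    using real_analytic_v by simp
  show ?thesis
  proof (intro exI[of _ radius] exI[of _ "v 0"] conjI[OF radius_pos] conjI[OF u] allI impI ballI)
    fix w t x
    assume "cauchy_solution radius u0 w \<and> real_analytic2_on w ({-radius<..<radius} \<times> UNIV)"
      and "t \<in> {-radius<..<radius}"
    then show "w t x = v 0 t x"
      using u cauchy_solution_unique by metis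
  qed
qed

end
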